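(* Let $k$ be a reproducing kernel on $\mathcal{Y}$ whose RKHS $\mathcal{H}$ is separable, let $\mathbb{P}_{Y_0^*},\mathbb{P}_{Y_1^*}$ be the distributions of the potential outcomes, and let $\phi$, $\hat\phi^{(r)}$, $\hat\pi^{(r)}$, $\hat\beta_a^{(r)}$ ($r\in\{1,2\}$, $a\in\{0,1\}$), $\mathcal{D}_1,\mathcal{D}_2$ and $T_h^\dagger$ be as defined in the context. Suppose that (i) $\mathbb{E}[\phi(Z)]=0$; (ii) $\mathbb{E}\left[\langle \phi(Z_1),\phi(Z_2)\rangle_{\mathcal{H}}^2\right]>0$; (iii) $\mathbb{E}\left[\|\phi(Z)\|_{\mathcal{H}}^4\right]<\infty$. For $r\in\{1,2\}$, suppose that (iv) $\hat\phi^{(r)}$ is constructed independently from $\mathcal{D}_r$, or (v) the empirical process of $\hat\phi^{(r)}$ is asymptotically equicontinuous at $\phi$ and $\|\hat\phi^{(r)}\|_{\mathcal{H}}^2$ (the real-valued function $z\mapsto\|\hat\phi^{(r)}(z)\|_{\mathcal{H}}^2$) belongs to a Glivenko–Cantelli class. Suppose also that, for $r\in\{1,2\}$, (vi) $\|\hat\phi^{(r)}-\phi\|=o_{\mathbb{P}}(1)$; (vii) $\mathbb{P}(\hat\pi^{(r)}\in[\epsilon,1-\epsilon])=1$; and $$\|\hat\pi^{(r)}-\pi\|\,\sum_{a\in\{0,1\}}\|\hat\beta_a^{(r)}-\beta_a\| = o_{\mathbb{P}}\left(\frac{1}{\sqrt{n}}\right).$$ Then, as $n\to\infty$, $$T_h^\dagger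 \xrightarrow{d} N(0,1).$$
   Context: Setting. $Z=(X,A,Y)\sim\mathbb{P}$ takes values in $\mathcal{Z}=\mathcal{X}\times\{0,1\}\times\mathcal{Y}$, with covariates $X$, binary treatment $A$ and outcome $Y$. There are potential outcomes $Y_0^*,Y_1^*$ such that: (consistency) $Y=AY_1^*+(1-A)Y_0^*$; (no unmeasured confounding) $(Y_0^*,Y_1^* )$ is independent of $A$ given $X$; (overlap) for some fixed $\epsilon>0$, $\epsilon<\pi(X)<1-\epsilon$ almost surely, where $\pi(x)=\mathbb{P}(A=1\mid X=x)$. Let $\mathcal{H}$ be the RKHS of $k$. Define the $\mathcal{H}$-valued functions $\beta_a(x)=\mathbb{E}[k(\cdot,Y)\mid A=a,X=x]$, $a\in\{0,1\}$, and, for $z=(x,a,y)$, $$\phi(z)=\left\{\frac{a}{\pi(x)}-\frac{1-a}{1-\pi(x)}\right\}\{k(\cdot,y)-\beta_a(x)\}+\beta_1(x)-\beta_0(x).$$ Data and statistic. $Z_1,\dots,Z_{2n}$, $Z_i=(X_i,A_i,Y_i)$, are i.i.d. copies of $Z$; $\mathcal{D}_1=(Z_i)_{i=1}^n$ and $\mathcal{D}_2=(Z_j)_{j=n+1}^{2n}$. For $r\in\{1,2\}$, $\hat\pi^{(r)}$ (real-valued function of $x$) and $\hat\beta_a^{(r)}$ ($\mathcal{H}$-valued functions of $x$, $a\in\{0,1\}$) are random functions (depending on $n$) estimating $\pi$ and $\beta_a$, and $$\hat\phi^{(r)}(z)=\left\{\frac{a}{\hat\pi^{(r)}(x)}-\frac{1-a}{1-\hat\pi^{(r)}(x)}\right\}\{k(\cdot,y)-\hat\beta^{(r)}_a(x)\}+\hat\beta^{(r)}_1(x)-\hat\beta^{(r)}_0(x).$$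 Define, for $i=1,\dots,n$, $$f_h^\dagger(Z_i)=\frac1n\sum_{j=n+1}^{2n}\langle\hat\phi^{(1)}(Z_i),\hat\phi^{(2)}(Z_j)\rangle_{\mathcal{H}},$$ $$\bar f_h^\dagger=\frac1n\sum_{i=1}^n f_h^\dagger(Z_i),\qquad S_h^\dagger=\sqrt{\frac1n\sum_{i=1}^n\left(f_h^\dagger(Z_i)-\bar f_h^\dagger\right)^2},\qquad T_h^\dagger=\frac{\sqrt n\,\bar f_h^\dagger}{S_h^\dagger}.$$ Norms and notation. For a (possibly random) real-valued function $f$, $\|f\|^2=\int f(z)^2\,d\mathbb{P}(z)$; for a (possibly random) $\mathcal{H}$-valued function $\omega$, $\|\omega\|^2=\int\|\omega(z)\|_{\mathcal{H}}^2\,d\mathbb{P}(z)$ (the integral is over $z$ only, so these are random variables when the function is random). $X_n=o_{\mathbb{P}}(r_n)$ means $X_n/r_n\to0$ in probability. $\mathbb{P}\omega=\int\omega\,d\mathbb{P}$ (Bochner integral for $\mathcal{H}$-valued $\omega$). Asymptotic equicontinuity. Let $\mathbb{P}_n\omega$ denote the average of $\omega$ over the sample of size $n$ under consideration (for index $r$, the sample is $\mathcal{D}_r$). For a class $\mathcal{G}$ of $\mathcal{H}$-valued functions on $\mathcal{Z}$, the empirical process $\{\nu_n(\omega)=\sqrt n(\mathbb{P}_n-\mathbb{P})\omega:\omega\in\mathcal{G}\}$ is asymptotically equicontinuous at $\omega_0\in\mathcal{G}$ if for every (random) sequence $\{\hat\omega_n\}\subset\mathcal{G}$ with $\|\hat\omega_n-\omega_0\|\to0$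 in probability one has $\|\nu_n(\hat\omega_n)-\nu_n(\omega_0)\|_{\mathcal{H}}\to0$ in probability. "The empirical process of $\hat\phi^{(r)}$ is asymptotically equicontinuous at $\phi$" means this holds with $\omega_0=\phi$ for a class $\mathcal{G}$ containing $\phi$ and in which $\hat\phi^{(r)}$ takes its values. Glivenko–Cantelli class. A class $\mathcal{F}$ of integrable real-valued functions is a Glivenko–Cantelli class for $\mathbb{P}$ if $\sup_{f\in\mathcal{F}}\left|\frac1n\sum_{i=1}^n f(Z_i)-\mathbb{E}[f(Z)]\right|\to0$ in probability as $n\to\infty$, for $Z_1,Z_2,\dots$ i.i.d. from $\mathbb{P}$. *)

theory Defs
  imports "HOL-Probability.Probability"
begin

text \<open>
  The elements of the RKHS of \<open>k\<close> are functions on \<open>S\<close>. The Hilbert space is carried by a type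
  \<open>'h\<close>; \<open>evl h\<close> is the function that \<open>h\<close> stands for (elements that agree as functions on \<open>S\<close> are
  equal) and \<open>kf y\<close> is the element that stands for \<open>k(\<cdot>, y)\<close>. Completeness and separability of
  the space come from the classes of \<open>'h\<close>.
\<close>

definition is_rkhs ::
  "'y set \<Rightarrow> ('y \<Rightarrow> 'y \<Rightarrow> real) \<Rightarrow> ('h::{real_inner, banach} \<Rightarrow> 'y \<Rightarrow> real) \<Rightarrow> ('y \<Rightarrow> 'h) \<Rightarrow> bool"
  where
  "is_rkhs S k evl kf \<longleftrightarrow>
     (\<forall>y\<in>S. linear (\<lambda>h. evl h y)) \<and>
     (\<forall>h h'. (\<forall>y\<in>S. evl h y = evl h' y) \<longrightarrow> h = h') \<and>
     (\<forall>y\<in>S. \<forall>y'\<in>S. evl (kf y) y' = k y' y) \<and>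
     (\<forall>h. \<forall>y\<in>S. evl h y = h \<bullet> kf y)"

text \<open>\<open>g\<close> is a version of the regression function \<open>v \<mapsto> E[U | V = v]\<close>; Bochner integrals are used,
  since \<open>U\<close> may take values in a Hilbert space.\<close>

definition is_regression ::
  "'q measure \<Rightarrow> ('q \<Rightarrow> 'b::{banach, second_countable_topology}) \<Rightarrow> 'v measure \<Rightarrow> ('q \<Rightarrow> 'v) \<Rightarrow> ('v \<Rightarrow> 'b) \<Rightarrow> bool"
  where
  "is_regression Q U N V g \<longleftrightarrow>
     integrable Q U \<and> V \<in> measurable Q N \<and> g \<in> borel_measurable N \<and>
     integrable Q (\<lambda>w. g (V w)) \<and>
     (\<forall>B\<in>sets N. (LINT w:(V -` B \<inter> space Q)|Q. U w) = (LINT w:(V -` B \<inter> space Q)|Q. g (V w)))"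

definition cond_indep ::
  "'q measure \<Rightarrow> 'u measure \<Rightarrow> ('q \<Rightarrow> 'u) \<Rightarrow> 'v measure \<Rightarrow> ('q \<Rightarrow> 'v) \<Rightarrow> 'x measure \<Rightarrow> ('q \<Rightarrow> 'x) \<Rightarrow> bool"
  where
  "cond_indep Q NU U NV V NX X \<longleftrightarrow>
     (let F = vimage_algebra (space Q) X NX in
      \<forall>C\<in>sets NU. \<forall>D\<in>sets NV. AE w in Q.
        real_cond_exp Q F (\<lambda>w. of_bool (U w \<in> C \<and> V w \<in> D)) w =
        real_cond_exp Q F (\<lambda>w. of_bool (U w \<in> C)) w * real_cond_exp Q F (\<lambda>w. of_bool (V w \<in> D)) w)"

definition pseudo_outcome ::
  "('y \<Rightarrow> 'h::real_vector) \<Rightarrow> ('x \<Rightarrow> real) \<Rightarrow> (bool \<Rightarrow> 'x \<Rightarrow> 'h) \<Rightarrow> 'x \<times> bool \<times> 'y \<Rightarrow> 'h"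
  where
  "pseudo_outcome kf p b = (\<lambda>(x, a, y).
     (of_bool a / p x - (1 - of_bool a) / (1 - p x)) *\<^sub>R (kf y - b a x) + b True x - b False x)"

definition f_dagger ::
  "nat \<Rightarrow> ('z \<Rightarrow> 'h::real_inner) \<Rightarrow> ('z \<Rightarrow> 'h) \<Rightarrow> (nat \<Rightarrow> 'z) \<Rightarrow> nat \<Rightarrow> real" where
  "f_dagger n g1 g2 z i = (1 / real n) * (\<Sum>j = n+1..2*n. g1 (z i) \<bullet> g2 (z j))"

definition f_bar ::
  "nat \<Rightarrow> ('z \<Rightarrow> 'h::real_inner) \<Rightarrow> ('z \<Rightarrow> 'h) \<Rightarrow> (nat \<Rightarrow> 'z) \<Rightarrow> real" where
  "f_bar n g1 g2 z = (1 / real n) * (\<Sum>i = 1..n. f_dagger n g1 g2 z i)"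

definition S_dagger ::
  "nat \<Rightarrow> ('z \<Rightarrow> 'h::real_inner) \<Rightarrow> ('z \<Rightarrow> 'h) \<Rightarrow> (nat \<Rightarrow> 'z) \<Rightarrow> real" where
  "S_dagger n g1 g2 z =
     sqrt ((1 / real n) * (\<Sum>i = 1..n. (f_dagger n g1 g2 z i - f_bar n g1 g2 z)\<^sup>2))"

definition T_dagger ::
  "nat \<Rightarrow> ('z \<Rightarrow> 'h::real_inner) \<Rightarrow> ('z \<Rightarrow> 'h) \<Rightarrow> (nat \<Rightarrow> 'z) \<Rightarrow> real" where
  "T_dagger n g1 g2 z = sqrt (real n) * f_bar n g1 g2 z / S_dagger n g1 g2 z"

text \<open>\<open>fold_idx r n\<close> is the index set of the half sample \<open>D\<^sub>r\<close>: \<open>{1..n}\<close> for \<open>r = 1\<close> and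
  \<open>{n+1..2n}\<close> for \<open>r = 2\<close>.\<close>

definition fold_idx :: "nat \<Rightarrow> nat \<Rightarrow> nat set" where
  "fold_idx r n = {(r - 1) * n + 1..r * n}"

definition iid_sample :: "'w measure \<Rightarrow> 'z measure \<Rightarrow> nat set \<Rightarrow> (nat \<Rightarrow> 'w \<Rightarrow> 'z) \<Rightarrow> bool" where
  "iid_sample M P I Z \<longleftrightarrow>
     prob_space.indep_vars M (\<lambda>_. P) Z I \<and> (\<forall>i\<in>I. distr M P (Z i) = P)"

text \<open>The norm is extended-valued, so that a function that is not square integrable has norm
  \<open>\<infinity>\<close> and not the default value \<open>0\<close> of the Bochner integral.\<close>

definition L2norm :: "'z measure \<Rightarrow> ('z \<Rightarrow> 'b::real_normed_vector) \<Rightarrow> ennreal" where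
  "L2norm P f = (let I = (\<integral>\<^sup>+ z. ennreal ((norm (f z))\<^sup>2) \<partial>P) in
                 if I = \<top> then \<top> else ennreal (sqrt (enn2real I)))"

text \<open>\<open>X\<^sub>n = o\<^sub>P(r\<^sub>n)\<close> for nonnegative extended-valued \<open>X\<^sub>n\<close> and a sequence \<open>r\<close> that is eventually
  positive.\<close>

definition small_o_P :: "'w measure \<Rightarrow> (nat \<Rightarrow> 'w \<Rightarrow> ennreal) \<Rightarrow> (nat \<Rightarrow> real) \<Rightarrow> bool" where
  "small_o_P M X r \<longleftrightarrow>
     (\<forall>e>0. (\<lambda>n. measure M {w \<in> space M. X n w > ennreal (e * r n)}) \<longlonglongrightarrow> 0)"

text \<open>
  The random function \<open>g n\<close> is built from information (a sub-\<open>\<sigma>\<close>-algebra \<open>F\<close> of \<open>M\<close>) that is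
  independent of the data \<open>(Z i)\<close>, \<open>i \<in> I n\<close>. Independence of the single evaluations \<open>g n _ z\<close> from the data would be too weak:
  it ignores modifications of \<open>g n\<close> at a random null set of points \<open>z\<close>, such as the data points.
\<close>

definition constructed_indep ::
  "'w measure \<Rightarrow> 'z measure \<Rightarrow> (nat \<Rightarrow> 'w \<Rightarrow> 'z) \<Rightarrow> (nat \<Rightarrow> nat set) \<Rightarrow>
   (nat \<Rightarrow> 'w \<Rightarrow> 'z \<Rightarrow> 'h::topological_space) \<Rightarrow> bool" where
  "constructed_indep M P Z I g \<longleftrightarrow>
     (\<forall>n. \<exists>F. subalgebra M F \<and>
        (\<lambda>(w, z). g n w z) \<in> borel_measurable (F \<Otimes>\<^sub>M P) \<and>
        prob_space.indep_set M (sets F)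
          (sets (vimage_algebra (space M) (\<lambda>w. \<lambda>i\<in>I n. Z i w) (Pi\<^sub>M (I n) (\<lambda>_. P)))))"

definition emp_process ::
  "'z measure \<Rightarrow> nat \<Rightarrow> (nat \<Rightarrow> 'z) \<Rightarrow> ('z \<Rightarrow> 'h::{banach, second_countable_topology}) \<Rightarrow> 'h" where
  "emp_process P n z g =
     sqrt (real n) *\<^sub>R ((1 / real n) *\<^sub>R (\<Sum>i = 1..n. g (z i)) - (\<integral>u. g u \<partial>P))"

text \<open>
  Asymptotic equicontinuity is a property of the class \<open>G\<close> and the law \<open>P\<close>. The size-\<open>n\<close> sample
  \<open>S n 1, \<dots>, S n n\<close> is therefore an arbitrary i.i.d. sample from \<open>P\<close> on \<open>M\<close>; both half samples
  (\<open>S n i = Z i\<close> and \<open>S n i = Z (n + i)\<close>) are of this form. The random sequence \<open>g\<close> may depend on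
  the sample. If the sample were fixed, a non-measurable class \<open>G\<close> could be adapted to the
  particular underlying space \<open>M\<close>.
\<close>

definition asymp_equicontinuous ::
  "'w measure \<Rightarrow> 'z measure \<Rightarrow> ('z \<Rightarrow> 'h::{banach, second_countable_topology}) set \<Rightarrow> ('z \<Rightarrow> 'h) \<Rightarrow> bool"
  where
  "asymp_equicontinuous M P G g0 \<longleftrightarrow>
     g0 \<in> G \<and> (\<forall>g\<in>G. integrable P g) \<and>
     (\<forall>S g. (\<forall>n. iid_sample M P {1..n} (S n)) \<and>
            (\<forall>n. (\<lambda>(w, z). g n w z) \<in> borel_measurable (M \<Otimes>\<^sub>M P)) \<and>
            (\<forall>n. \<forall>w\<in>space M. g n w \<in> G) \<and>
            small_o_P M (\<lambda>n w. L2norm P (\<lambda>z. g n w z - g0 z)) (\<lambda>_. 1)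
        \<longrightarrow> small_o_P M
              (\<lambda>n w. ennreal (norm (emp_process P n (\<lambda>i. S n i w) (g n w)
                                    - emp_process P n (\<lambda>i. S n i w) g0)))
              (\<lambda>_. 1))"

text \<open>
  The i.i.d. sequence is the canonical one, on the product space. The supremum over \<open>F\<close> need not
  be measurable; as usual in empirical process theory, its convergence to \<open>0\<close> is in outer
  probability: the event that it exceeds \<open>e\<close> is covered by measurable sets \<open>B n\<close> whose
  probabilities tend to \<open>0\<close>.
\<close>

definition glivenko_cantelli :: "'z measure \<Rightarrow> ('z \<Rightarrow> real) set \<Rightarrow> bool" where
  "glivenko_cantelli P F \<longleftrightarrow>
     (\<forall>f\<in>F. integrable P f) \<and>
     (\<forall>e>0. \<exists>B. (\<forall>n. B n \<in> sets (Pi\<^sub>M UNIV (\<lambda>_::nat. P))) \<and>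
        (\<lambda>n. measure (Pi\<^sub>M UNIV (\<lambda>_::nat. P)) (B n)) \<longlonglongrightarrow> 0 \<and>
        (\<forall>n. \<forall>s \<in> space (Pi\<^sub>M UNIV (\<lambda>_::nat. P)) - B n. \<forall>f\<in>F.
           \<bar>(1 / real n) * (\<Sum>i = 1..n. f (s i)) - (\<integral>z. f z \<partial>P)\<bar> \<le> e))"

end

theory Submission
  imports Defs
begin

text \<open>
  Put \<open>U = n\<^sup>-\<^sup>1\<^sup>/\<^sup>2 \<Sum> \<phi>(Z\<^sub>i)\<close> over the first and \<open>V\<close> likewise over the second half sample, and
  \<open>q(v) = E \<langle>\<phi>(Z), v\<rangle>\<^sup>2\<close>. Conditionally on \<open>V = v\<close>, the variable \<open>\<langle>U, v\<rangle> / \<surd>q(v)\<close> is a normalized sum of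
  i.i.d. variables whose fourth moments are bounded as long as \<open>\<parallel>v\<parallel>\<close> stays bounded and \<open>q(v)\<close> stays
  away from \<open>0\<close>; a quantitative bound for characteristic functions then gives
  \<open>\<langle>U, V\<rangle> / \<surd>q(V) \<rightarrow> N(0,1)\<close> without a central limit theorem in Hilbert space. That \<open>q(V)\<close> does not
  accumulate at \<open>0\<close> follows from \<open>\<langle>v, u\<rangle>\<^sup>2 \<le> c q(v)\<close> for a suitable direction \<open>u\<close> in the range of the
  covariance operator, and the one-dimensional limit of \<open>\<langle>V, u\<rangle>\<close>.

  It remains to replace \<open>\<phi>\<close> by its estimates, that is, to show that for \<open>\<phi>'\<close> an estimate and \<open>h = \<phi>' - \<phi>\<close> both
  \<open>n\<^sup>-\<^sup>1\<^sup>/\<^sup>2 \<Sum> h(Z\<^sub>i)\<close> and \<open>n\<^sup>-\<^sup>1 \<Sum> \<parallel>h(Z\<^sub>i)\<parallel>\<^sup>2\<close> vanish in probability. The mean \<open>P h\<close> is controlled by the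
  product of the nuisance errors. The centered part is a conditional second moment computation if the
  estimate is independent of the sample. Under equicontinuity, the second claim is obtained by
  applying equicontinuity to the samples that mix points of both halves, in the manner of a
  symmetrization argument.
\<close>

section \<open>Convergence in probability as a filter\<close>

text \<open>The statistic is degenerate: given \<open>V\<close>, the numerator
  \<open>U \<bullet> V\<close> has variance \<open>q V\<close>, which stays random in the limit.
  Studentization estimates exactly this random variance, so the conditional limit is N(0,1) whatever
  the value of \<open>V\<close>, and mixing over \<open>V\<close> keeps it. Hence all bounds have to
  be uniform in v. Fourth moments control both the characteristic function and the estimated
  variance. The obstacle under equicontinuity is that an empirical process is linear in h while the
  mean of \<parallel>h\<parallel>^2 is quadratic, and the estimate may depend on all the data. Signs
  can be created all the same: exchanging points between the halves changes the sample but not the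
  estimate, and two complementary exchanges differ by a sum with signs. The class condition holds
  along every sequence of samples, hence along the worst exchange for each n; so for most outcomes
  most exchanges are good at once, and a Paley--Zygmund argument recovers the squares. A single
  pairing of the halves would see only differences within its pairs; the cyclic shifts compare every
  point of one half with every point of the other.\<close>

abbreviation fails_at_most :: "'w measure \<Rightarrow> real \<Rightarrow> ('w \<Rightarrow> bool) \<Rightarrow> bool" where
  "fails_at_most M \<eta> A \<equiv> \<exists>B\<in>sets M. measure M B \<le> \<eta> \<and> (\<forall>w\<in>space M - B. A w)"

text \<open>Convergence to 0 along this filter on pairs (n, w) is convergence in probability, so the
  calculus of limits and eventual properties applies to random sequences. The exceptional set is a
  measurable cover, hence no measurability is asked of the event itself.\<close>

definition inprob :: "'w measure \<Rightarrow> (nat \<times> 'w) filter" where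
  "inprob M = Abs_filter (\<lambda>A. \<forall>\<eta>>0. \<forall>\<^sub>F n in sequentially.
     fails_at_most M \<eta> (\<lambda>w. A (n, w)))"

lemma (in finite_measure) eventually_inprob:
  "eventually A (inprob M) \<longleftrightarrow> (\<forall>\<eta>>0. \<forall>\<^sub>F n in sequentially.
     fails_at_most M \<eta> (\<lambda>w. A (n, w)))"
  unfolding inprob_def
proof (rule eventually_Abs_filter, rule is_filter.intro, goal_cases)
  case 1
  then show ?case by (auto intro!: always_eventually bexI[of _ "{}"])
next
  case (2 P Q)
  show ?case
  proof (intro allI impI)
    fix \<eta> :: real assume "\<eta> > 0"
    with 2 half_gt_zero[OF this] have "\<forall>\<^sub>F n in sequentially. fails_at_most M (\<eta>/2) (\<lambda>w. P (n, w))"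
      "\<forall>\<^sub>F n in sequentially. fails_at_most M (\<eta>/2) (\<lambda>w. Q (n, w))"
      by blast+
    then show "\<forall>\<^sub>F n in sequentially. fails_at_most M \<eta> (\<lambda>w. P (n, w) \<and> Q (n, w))"
    proof eventually_elim
      case (elim n)
      then obtain B C where "B \<in> sets M" "C \<in> sets M" "measure M B \<le> \<eta>/2" "measure M C \<le> \<eta>/2"
        "\<forall>w\<in>space M - B. P (n, w)" "\<forall>w\<in>space M - C. Q (n, w)" by auto
      then show ?case
        using measure_Un_le[of B M C] by (intro bexI[of _ "B \<union> C"]) auto
    qed
  qed
next
  case (3 P Q)
  show ?case
  proof (intro allI impI)
    fix \<eta> :: real assume "\<eta> > 0"
    with 3(2) have "\<forall>\<^sub>F n in sequentially. fails_at_most M \<eta> (\<lambda>w. P (n, w))"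
      by auto
    then show "\<forall>\<^sub>F n in sequentially. fails_at_most M \<eta> (\<lambda>w. Q (n, w))"
      by eventually_elim (use 3(1) in blast)
  qed
qed

lemma (in finite_measure) eventually_inprobI:
  assumes "\<And>n. {w \<in> space M. \<not> A n w} \<in> sets M"
    and "(\<lambda>n. measure M {w \<in> space M. \<not> A n w}) \<longlonglongrightarrow> 0"
  shows "\<forall>\<^sub>F (n, w) in inprob M. A n w"
  unfolding eventually_inprob
proof (intro allI impI)
  fix \<eta> :: real assume "\<eta> > 0"
  with assms(2) have "\<forall>\<^sub>F n in sequentially. measure M {w \<in> space M. \<not> A n w} < \<eta>"
    by (auto dest: order_tendstoD)
  then show "\<forall>\<^sub>F n in sequentially. fails_at_most M \<eta> (\<lambda>w. case (n, w) of (n, w) \<Rightarrow> A n w)"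
    by eventually_elim (use assms(1) in \<open>auto intro!: bexI[of _ "{w \<in> space M. \<not> A _ w}"]\<close>)
qed

text \<open>The event need not be measurable: monotonicity of \<open>measure\<close> requires only
  that the covering set is.\<close>

lemma (in finite_measure) inprob_measure_tendsto_0:
  assumes "\<forall>\<^sub>F (n, w) in inprob M. \<not> A n w"
  shows "(\<lambda>n. measure M {w \<in> space M. A n w}) \<longlonglongrightarrow> 0"
proof (rule order_tendstoI)
  fix a :: real assume "a < 0"
  then show "\<forall>\<^sub>F n in sequentially. a < measure M {w \<in> space M. A n w}"
    by (intro always_eventually allI less_le_trans[OF _ measure_nonneg])
next
  fix a :: real assume "0 < a"
  then have "0 < a/2" by simp
  with assms have "\<forall>\<^sub>F n in sequentially.
     fails_at_most M (a/2) (\<lambda>w. \<not> A n w)"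
    unfolding eventually_inprob by fastforce
  then show "\<forall>\<^sub>F n in sequentially. measure M {w \<in> space M. A n w} < a"
  proof eventually_elim
    case (elim n)
    then obtain B where B: "B \<in> sets M" "measure M B \<le> a/2" "\<forall>w\<in>space M - B. \<not> A n w" by auto
    then have "measure M {w \<in> space M. A n w} \<le> measure M B"
      by (intro finite_measure_mono) auto
    with B \<open>0 < a\<close> show ?case by auto
  qed
qed

lemma (in finite_measure) eventually_inprob_AE:
  assumes "\<And>n. AE w in M. A n w"
  shows "\<forall>\<^sub>F (n, w) in inprob M. A n w"
  unfolding eventually_inprob
proof (intro allI impI always_eventually)
  fix \<eta> :: real and n assume "\<eta> > 0"
  obtain N where "N \<in> null_sets M" "{w \<in> space M. \<not> A n w} \<subseteq> N"
    using assms[of n] unfolding eventually_ae_filter by blast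
  then show "fails_at_most M \<eta> (\<lambda>w. case (n, w) of (n, w) \<Rightarrow> A n w)"
    using \<open>\<eta> > 0\<close> by (intro bexI[of _ N]) (auto simp: measure_eq_emeasure_eq_ennreal null_setsD1 measure_def null_setsD2)
qed

lemma (in finite_measure) filterlim_fst_inprob: "filterlim fst sequentially (inprob M)"
  unfolding filterlim_iff eventually_inprob
  by (auto elim!: eventually_mono intro!: bexI[of _ "{}"])

lemma (in finite_measure) inprob_sequentially:
  "eventually A sequentially \<Longrightarrow> \<forall>\<^sub>F (n, w) in inprob M. A n"
  using filterlim_fst_inprob unfolding filterlim_iff by (simp add: case_prod_unfold)

lemma (in finite_measure) inprob_tendsto_const:
  "(X \<longlongrightarrow> l) sequentially \<Longrightarrow> ((\<lambda>(n, w). X n) \<longlongrightarrow> l) (inprob M)"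
  using filterlim_compose[OF _ filterlim_fst_inprob, of X] by (simp add: case_prod_unfold)

lemma (in finite_measure) inprob_space: "\<forall>\<^sub>F (n, w) in inprob M. w \<in> space M"
  by (rule eventually_inprob_AE) auto

text \<open>The good event \<open>C\<close> may depend on \<eta>. Statements in probability can thus
  be proved under bounds that hold only with probability close to 1, with constants that get worse
  as \<eta> decreases.\<close>

lemma (in finite_measure) eventually_inprob_tight:
  assumes "\<And>\<eta>. \<eta> > 0 \<Longrightarrow> \<exists>C. (\<forall>\<^sub>F n in sequentially.
      fails_at_most M \<eta> (\<lambda>w. C n w)) \<and>
      (\<forall>\<^sub>F (n, w) in inprob M. C n w \<longrightarrow> A n w)"
  shows "\<forall>\<^sub>F (n, w) in inprob M. A n w"
  unfolding eventually_inprob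
proof (intro allI impI)
  fix \<eta> :: real assume "\<eta> > 0"
  then obtain C where C: "\<forall>\<^sub>F n in sequentially. fails_at_most M (\<eta>/2) (\<lambda>w. C n w)"
     "\<forall>\<^sub>F (n, w) in inprob M. C n w \<longrightarrow> A n w"
    using assms[of "\<eta>/2"] by auto
  from C(2) \<open>\<eta> > 0\<close> have "\<forall>\<^sub>F n in sequentially. fails_at_most M (\<eta>/2) (\<lambda>w. C n w \<longrightarrow> A n w)"
    unfolding eventually_inprob by (drule_tac spec[of _ "\<eta>/2"]) auto
  with C(1) show "\<forall>\<^sub>F n in sequentially. fails_at_most M \<eta> (\<lambda>w. case (n, w) of (n, w) \<Rightarrow> A n w)"
  proof eventually_elim
    case (elim n)
    then obtain B D where "B \<in> sets M" "D \<in> sets M" "measure M B \<le> \<eta>/2" "measure M D \<le> \<eta>/2"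
        "\<forall>w\<in>space M - B. C n w" "\<forall>w\<in>space M - D. C n w \<longrightarrow> A n w" by auto
    then show ?case
      using measure_Un_le[of B M D] by (intro bexI[of _ "B \<union> D"]) auto
  qed
qed

section \<open>Passage between limits along the filter and \<open>small_o_P\<close>\<close>

lemma ennreal_tendsto_0I:
  fixes X :: "'a \<Rightarrow> ennreal"
  assumes "\<And>e. e > (0::real) \<Longrightarrow> \<forall>\<^sub>F x in F. X x \<le> ennreal e"
  shows "(X \<longlongrightarrow> 0) F"
proof (rule order_tendstoI)
  fix a :: ennreal assume "0 < a"
  then obtain b where b: "0 < b" "b < a" using dense by blast
  then have "\<forall>\<^sub>F x in F. X x \<le> ennreal (enn2real b)"
    by (intro assms) (auto simp: enn2real_positive_iff intro: less_le_trans[OF _ top_greatest])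
  moreover have "ennreal (enn2real b) = b"
    using b by (auto intro!: ennreal_enn2real less_le_trans[OF _ top_greatest])
  ultimately show "\<forall>\<^sub>F x in F. X x < a"
    using b by (auto elim!: eventually_mono)
qed simp

lemma ennreal_tendsto_0D:
  fixes X :: "'a \<Rightarrow> ennreal"
  assumes "(X \<longlongrightarrow> 0) F" "e > (0::real)"
  shows "\<forall>\<^sub>F x in F. X x \<le> ennreal e"
  using order_tendstoD(2)[OF assms(1), of "ennreal e"] assms(2)
  by (auto elim!: eventually_mono)

text \<open>Measurability matters in this direction: \<open>small_o_P\<close> measures the event
  itself, and \<open>measure\<close> takes the default value 0 on non-measurable sets.\<close>

lemma (in finite_measure) small_o_P_imp_tendsto:
  assumes "small_o_P M X (\<lambda>_. 1)" "\<And>n. X n \<in> borel_measurable M"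
  shows "((\<lambda>(n, w). X n w) \<longlongrightarrow> 0) (inprob M)"
proof (rule ennreal_tendsto_0I)
  fix e :: real assume e: "e > 0"
  have [measurable]: "X n \<in> borel_measurable M" for n by fact
  have "(\<lambda>n. measure M {w \<in> space M. X n w > ennreal e}) \<longlonglongrightarrow> 0"
    using assms(1) e by (auto simp: small_o_P_def)
  then have "\<forall>\<^sub>F (n, w) in inprob M. X n w \<le> ennreal e"
    by (intro eventually_inprobI) (auto simp: not_le)
  then show "\<forall>\<^sub>F x in inprob M. (case x of (n, w) \<Rightarrow> X n w) \<le> ennreal e"
    by (simp add: case_prod_unfold)
qed

lemma (in finite_measure) tendsto_imp_small_o_P:
  assumes "((\<lambda>(n, w). X n w) \<longlongrightarrow> 0) (inprob M)"
  shows "small_o_P M X (\<lambda>_. 1)"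
  unfolding small_o_P_def
proof (intro allI impI)
  fix e :: real assume "e > 0"
  then have "\<forall>\<^sub>F (n, w) in inprob M. X n w \<le> ennreal e"
    using ennreal_tendsto_0D[OF assms, of e] by (simp add: case_prod_unfold)
  then show "(\<lambda>n. measure M {w \<in> space M. ennreal (e * 1) < X n w}) \<longlonglongrightarrow> 0"
    by (intro inprob_measure_tendsto_0) (auto simp: not_less elim!: eventually_mono)
qed

text \<open>Independence as a product law of the pair. The two components may have different types,
  so that one can be the identity map into a sub-\<sigma>-algebra and the other a block of
  data.\<close>

definition independent_rv where
  "independent_rv M N1 \<xi> N2 D \<longleftrightarrow> \<xi> \<in> measurable M N1 \<and> D \<in> measurable M N2 \<and>
     distr M (N1 \<Otimes>\<^sub>M N2) (\<lambda>w. (\<xi> w, D w)) = distr M N1 \<xi> \<Otimes>\<^sub>M distr M N2 D"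

lemma (in prob_space) independent_rvI:
  assumes \<xi>[measurable]: "\<xi> \<in> measurable M N1" and D[measurable]: "D \<in> measurable M N2"
    and prod: "\<And>A B. A \<in> sets N1 \<Longrightarrow> B \<in> sets N2 \<Longrightarrow>
      prob (\<xi> -` A \<inter> space M \<inter> (D -` B \<inter> space M)) = prob (\<xi> -` A \<inter> space M) * prob (D -` B \<inter> space M)"
  shows "independent_rv M N1 \<xi> N2 D"
proof -
  interpret D: prob_space "distr M N2 D" by (rule prob_space_distr) simp
  interpret xi: prob_space "distr M N1 \<xi>" by (rule prob_space_distr) simp
  have "distr M N1 \<xi> \<Otimes>\<^sub>M distr M N2 D = distr M (N1 \<Otimes>\<^sub>M N2) (\<lambda>w. (\<xi> w, D w))"
  proof (rule pair_measure_eqI)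
    fix A B assume AB: "A \<in> sets (distr M N1 \<xi>)" "B \<in> sets (distr M N2 D)"
    then have [measurable]: "A \<in> sets N1" "B \<in> sets N2" by auto
    have "(\<lambda>w. (\<xi> w, D w)) -` (A \<times> B) \<inter> space M = \<xi> -` A \<inter> space M \<inter> (D -` B \<inter> space M)" by auto
    then have "emeasure (distr M (N1 \<Otimes>\<^sub>M N2) (\<lambda>w. (\<xi> w, D w))) (A \<times> B) =
        ennreal (prob (\<xi> -` A \<inter> space M \<inter> (D -` B \<inter> space M)))"
      by (simp add: emeasure_distr emeasure_eq_measure)
    also have "\<dots> = emeasure (distr M N1 \<xi>) A * emeasure (distr M N2 D) B"
      by (simp add: prod emeasure_distr emeasure_eq_measure ennreal_mult)
    finally show "emeasure (distr M N1 \<xi>) A * emeasure (distr M N2 D) B =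
       emeasure (distr M (N1 \<Otimes>\<^sub>M N2) (\<lambda>w. (\<xi> w, D w))) (A \<times> B)" by simp
  qed (auto simp: D.sigma_finite_measure_axioms xi.sigma_finite_measure_axioms)
  then show ?thesis by (simp add: independent_rv_def)
qed

lemma (in prob_space) indep_var_independent_rv:
  assumes "indep_var N1 \<xi> N2 D"
  shows "independent_rv M N1 \<xi> N2 D"
  using assms by (simp add: independent_rv_def indep_var_distribution_eq)

lemma (in prob_space) independent_rv_compose:
  assumes ind: "independent_rv M N1 \<xi> N2 D" and f[measurable]: "f \<in> measurable N1 L1" and g[measurable]: "g \<in> measurable N2 L2"
  shows "independent_rv M L1 (\<lambda>w. f (\<xi> w)) L2 (\<lambda>w. g (D w))"
proof -
  have [measurable]: "\<xi> \<in> measurable M N1" "D \<in> measurable M N2"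
    using ind by (auto simp: independent_rv_def)
  have "distr M (L1 \<Otimes>\<^sub>M L2) (\<lambda>w. (f (\<xi> w), g (D w))) =
    distr (distr M (N1 \<Otimes>\<^sub>M N2) (\<lambda>w. (\<xi> w, D w))) (L1 \<Otimes>\<^sub>M L2) (\<lambda>(x, y). (f x, g y))"
    by (subst distr_distr) (auto simp: comp_def)
  also have "\<dots> = distr (distr M N1 \<xi> \<Otimes>\<^sub>M distr M N2 D) (L1 \<Otimes>\<^sub>M L2) (\<lambda>(x, y). (f x, g y))"
    using ind by (simp add: independent_rv_def)
  also have "\<dots> = distr (distr M N1 \<xi>) L1 f \<Otimes>\<^sub>M distr (distr M N2 D) L2 g"
    by (subst pair_measure_distr) (auto intro!: prob_space_imp_sigma_finite prob_space.prob_space_distr prob_space_distr)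
  also have "\<dots> = distr M L1 (\<lambda>w. f (\<xi> w)) \<Otimes>\<^sub>M distr M L2 (\<lambda>w. g (D w))"
    by (simp add: distr_distr comp_def)
  finally show ?thesis by (simp add: independent_rv_def)
qed

text \<open>Fubini for the product law, pulled back to \<open>M\<close>. The outcome
  \<open>w'\<close> plays the part of an independent copy, so conditional means given
  \<open>\<xi>\<close> are plain integrals over \<open>M\<close>.\<close>

lemma (in prob_space) nn_integral_decouple:
  assumes ind: "independent_rv M N1 \<xi> N2 D" and K: "K \<in> borel_measurable (N1 \<Otimes>\<^sub>M N2)"
  shows "(\<integral>\<^sup>+w. K (\<xi> w, D w) \<partial>M) = (\<integral>\<^sup>+w. (\<integral>\<^sup>+w'. K (\<xi> w, D w') \<partial>M) \<partial>M)"
proof -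
  have [measurable]: "\<xi> \<in> measurable M N1" "D \<in> measurable M N2"
    using ind by (auto simp: independent_rv_def)
  note K[measurable]
  interpret D: prob_space "distr M N2 D" by (rule prob_space_distr) simp
  have "(\<integral>\<^sup>+w. K (\<xi> w, D w) \<partial>M) = (\<integral>\<^sup>+p. K p \<partial>distr M (N1 \<Otimes>\<^sub>M N2) (\<lambda>w. (\<xi> w, D w)))"
    by (subst nn_integral_distr) auto
  also have "distr M (N1 \<Otimes>\<^sub>M N2) (\<lambda>w. (\<xi> w, D w)) = distr M N1 \<xi> \<Otimes>\<^sub>M distr M N2 D"
    using ind by (simp add: independent_rv_def)
  also have "(\<integral>\<^sup>+p. K p \<partial>(distr M N1 \<xi> \<Otimes>\<^sub>M distr M N2 D)) =
      (\<integral>\<^sup>+x. (\<integral>\<^sup>+y. K (x, y) \<partial>distr M N2 D) \<partial>distr M N1 \<xi>)"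
    by (subst D.nn_integral_fst) auto
  also have "\<dots> = (\<integral>\<^sup>+w. (\<integral>\<^sup>+y. K (\<xi> w, y) \<partial>distr M N2 D) \<partial>M)"
    by (subst nn_integral_distr) (auto intro!: D.borel_measurable_nn_integral)
  also have "\<dots> = (\<integral>\<^sup>+w. (\<integral>\<^sup>+w'. K (\<xi> w, D w') \<partial>M) \<partial>M)"
    by (intro nn_integral_cong, subst nn_integral_distr) (auto intro!: measurable_compose[OF _ K] measurable_Pair1' dest: measurable_space[OF \<open>\<xi> \<in> measurable M N1\<close>])
  finally show ?thesis .
qed

lemma (in prob_space) integral_decouple:
  fixes K :: "_ \<Rightarrow> 'b :: {banach, second_countable_topology}"
  assumes ind: "independent_rv M N1 \<xi> N2 D" and K: "K \<in> borel_measurable (N1 \<Otimes>\<^sub>M N2)"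
    and bnd: "integrable M (\<lambda>w. K (\<xi> w, D w))"
  shows "(\<integral>w. K (\<xi> w, D w) \<partial>M) = (\<integral>w. (\<integral>w'. K (\<xi> w, D w') \<partial>M) \<partial>M)"
proof -
  have [measurable]: "\<xi> \<in> measurable M N1" "D \<in> measurable M N2"
    using ind by (auto simp: independent_rv_def)
  note K[measurable]
  interpret D: prob_space "distr M N2 D" by (rule prob_space_distr) simp
  interpret xi: prob_space "distr M N1 \<xi>" by (rule prob_space_distr) simp
  interpret pair_prob_space "distr M N1 \<xi>" "distr M N2 D" ..
  have eq: "distr M (N1 \<Otimes>\<^sub>M N2) (\<lambda>w. (\<xi> w, D w)) = distr M N1 \<xi> \<Otimes>\<^sub>M distr M N2 D"
    using ind by (simp add: independent_rv_def)
  have int: "integrable (distr M N1 \<xi> \<Otimes>\<^sub>M distr M N2 D) K"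
    using bnd by (simp add: eq[symmetric] integrable_distr_eq)
  have "(\<integral>w. K (\<xi> w, D w) \<partial>M) = (\<integral>p. K p \<partial>distr M (N1 \<Otimes>\<^sub>M N2) (\<lambda>w. (\<xi> w, D w)))"
    by (subst integral_distr) auto
  also note eq
  also have "(\<integral>p. K p \<partial>(distr M N1 \<xi> \<Otimes>\<^sub>M distr M N2 D)) =
      (\<integral>x. (\<integral>y. K (x, y) \<partial>distr M N2 D) \<partial>distr M N1 \<xi>)"
    by (rule integral_fst'[OF int, symmetric])
  also have "\<dots> = (\<integral>w. (\<integral>y. K (\<xi> w, y) \<partial>distr M N2 D) \<partial>M)"
    by (subst integral_distr) (auto intro!: D.borel_measurable_lebesgue_integral)
  also have "\<dots> = (\<integral>w. (\<integral>w'. K (\<xi> w, D w') \<partial>M) \<partial>M)"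
    by (intro Bochner_Integration.integral_cong refl, subst integral_distr) (auto intro!: measurable_compose[OF _ K] measurable_Pair1' dest: measurable_space[OF \<open>\<xi> \<in> measurable M N1\<close>])
  finally show ?thesis .
qed

text \<open>Markov's inequality given \<open>\<xi>\<close>. The kernel is set to 0 where its
  conditional mean exceeds \<delta>, so no unconditional moment of \<open>K\<close> has to
  exist.\<close>

lemma (in prob_space) inprob_conditional_Markov:
  fixes K :: "nat \<Rightarrow> _ \<Rightarrow> ennreal"
  assumes ind: "\<And>n. independent_rv M (N1 n) (\<xi> n) (N2 n) (D n)"
    and K: "\<And>n. K n \<in> borel_measurable (N1 n \<Otimes>\<^sub>M N2 n)"
    and lim: "((\<lambda>(n, w). \<integral>\<^sup>+w'. K n (\<xi> n w, D n w') \<partial>M) \<longlongrightarrow> 0) (inprob M)"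
  shows "((\<lambda>(n, w). K n (\<xi> n w, D n w)) \<longlongrightarrow> 0) (inprob M)"
proof (rule ennreal_tendsto_0I)
  fix e :: real assume e: "e > 0"
  have m[measurable]: "\<xi> n \<in> measurable M (N1 n)" "D n \<in> measurable M (N2 n)" for n
    using ind[of n] by (auto simp: independent_rv_def)
  note K[measurable]
  define L where "L n x = (\<integral>\<^sup>+w'. K n (x, D n w') \<partial>M)" for n x
  have L[measurable]: "L n \<in> borel_measurable (N1 n)" for n
    unfolding L_def by measurable
  have "\<forall>\<^sub>F (n, w) in inprob M. K n (\<xi> n w, D n w) \<le> ennreal e"
    unfolding eventually_inprob
  proof (intro allI impI)
    fix \<eta> :: real assume \<eta>: "\<eta> > 0"
    \<comment> \<open>Markov's inequality at level e gives \<delta> / e = \<eta> / 2 for the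
      truncated kernel; the other half of \<eta> pays for the set where the conditional mean is
      large.\<close>
    define \<delta> where "\<delta> = e * \<eta> / 2"
    have \<delta>: "\<delta> > 0" using e \<eta> by (simp add: \<delta>_def)
    have "\<forall>\<^sub>F (n, w) in inprob M. L n (\<xi> n w) \<le> ennreal \<delta>"
      using ennreal_tendsto_0D[OF lim \<delta>] by (auto simp: case_prod_unfold L_def)
    then have "\<forall>\<^sub>F n in sequentially. fails_at_most M (\<eta>/2) (\<lambda>w. L n (\<xi> n w) \<le> ennreal \<delta>)"
      unfolding eventually_inprob using \<eta> by (auto dest: spec[of _ "\<eta>/2"])
    then show "\<forall>\<^sub>F n in sequentially. fails_at_most M \<eta> (\<lambda>w. case (n, w) of (n, w) \<Rightarrow> K n (\<xi> n w, D n w) \<le> ennreal e)"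
    proof eventually_elim
      case (elim n)
      then obtain B where B: "B \<in> sets M" "measure M B \<le> \<eta>/2" "\<forall>w\<in>space M - B. L n (\<xi> n w) \<le> ennreal \<delta>" by auto
      define K' where "K' = (\<lambda>(x, d). indicator {x\<in>space (N1 n). L n x \<le> ennreal \<delta>} x * K n (x, d))"
      have K'[measurable]: "K' \<in> borel_measurable (N1 n \<Otimes>\<^sub>M N2 n)" unfolding K'_def by measurable
      define C where "C = {w\<in>space M. K' (\<xi> n w, D n w) > ennreal e}"
      have C: "C \<in> sets M" unfolding C_def by measurable
      have "ennreal e * emeasure M C \<le> (\<integral>\<^sup>+w. K' (\<xi> n w, D n w) \<partial>M)"
        unfolding nn_integral_cmult_indicator[OF C, symmetric]
        by (intro nn_integral_mono) (auto simp: C_def indicator_def)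
      also have "\<dots> = (\<integral>\<^sup>+w. (\<integral>\<^sup>+w'. K' (\<xi> n w, D n w') \<partial>M) \<partial>M)"
        by (rule nn_integral_decouple[OF ind K'])
      also have "\<dots> \<le> (\<integral>\<^sup>+w. ennreal \<delta> \<partial>M)"
        by (intro nn_integral_mono) (auto simp: K'_def indicator_def L_def split: if_splits)
      also have "\<dots> = ennreal \<delta>" by (simp add: emeasure_space_1)
      finally have "e * measure M C \<le> \<delta>"
        using e \<delta> by (simp add: emeasure_eq_measure ennreal_mult[symmetric])
      then have "measure M C \<le> \<eta>/2" using e by (simp add: \<delta>_def field_simps)
      then have "measure M (B \<union> C) \<le> \<eta>"
        using measure_Un_le[OF B(1) C] B by auto
      moreover have "\<forall>w\<in>space M - (B \<union> C). K n (\<xi> n w, D n w) \<le> ennreal e"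
        using B measurable_space[OF m(1)] by (auto simp: C_def K'_def indicator_def not_less split: if_splits)
      ultimately show ?case using B C by (intro bexI[of _ "B \<union> C"]) auto
    qed
  qed
  then show "\<forall>\<^sub>F x in inprob M. (case x of (n, w) \<Rightarrow> K n (\<xi> n w, D n w)) \<le> ennreal e"
    by (simp add: case_prod_unfold)
qed

lemma (in prob_space) inprob_Markov:
  fixes X :: "nat \<Rightarrow> 'a \<Rightarrow> ennreal"
  assumes X: "\<And>n. X n \<in> borel_measurable M" and lim: "(\<lambda>n. \<integral>\<^sup>+w. X n w \<partial>M) \<longlonglongrightarrow> 0"
  shows "((\<lambda>(n, w). X n w) \<longlongrightarrow> 0) (inprob M)"
proof -
  \<comment> \<open>A constant is independent of everything, so the conditional inequality contains
    the ordinary one.\<close>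
  have "independent_rv M (count_space UNIV) (\<lambda>_. ()) M (\<lambda>w. w)"
    by (rule independent_rvI) (auto simp: prob_space vimage_def Int_absorb2 dest: sets.sets_into_space)
  then show ?thesis
    using inprob_conditional_Markov[of "\<lambda>_. count_space (UNIV::unit set)" "\<lambda>_ _. ()" "\<lambda>_. M" "\<lambda>_ w. w" "\<lambda>n (x, w). X n w"] X
       inprob_tendsto_const[OF lim]
    by auto
qed

section \<open>Independent samples\<close>

lemma integrable_norm_sq_imp_integrable:
  fixes h :: "'z \<Rightarrow> 'h::{real_inner, banach, second_countable_topology}"
  assumes "finite_measure P" "h \<in> borel_measurable P" "integrable P (\<lambda>z. (norm (h z))\<^sup>2)"
  shows "integrable P h"
proof -
  interpret finite_measure P by fact
  have "integrable P (\<lambda>z. norm (h z))"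
    by (rule square_integrable_imp_integrable) (use assms in auto)
  then show ?thesis using assms by (simp add: integrable_norm_iff)
qed

lemma integrable_inner_L2:
  fixes g h :: "'z \<Rightarrow> 'h::{real_inner, banach, second_countable_topology}"
  assumes [measurable]: "g \<in> borel_measurable P" "h \<in> borel_measurable P"
    and "integrable P (\<lambda>z. (norm (g z))\<^sup>2)" "integrable P (\<lambda>z. (norm (h z))\<^sup>2)"
  shows "integrable P (\<lambda>z. g z \<bullet> h z)"
proof (rule Bochner_Integration.integrable_bound)
  show "integrable P (\<lambda>z. (norm (g z))\<^sup>2 + (norm (h z))\<^sup>2)" using assms by simp
  show "AE z in P. norm (g z \<bullet> h z) \<le> norm ((norm (g z))\<^sup>2 + (norm (h z))\<^sup>2)"
  proof (intro always_eventually allI)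
    fix z
    have "\<bar>g z \<bullet> h z\<bar> \<le> norm (g z) * norm (h z)" by (rule Cauchy_Schwarz_ineq2)
    also have "\<dots> \<le> (norm (g z))\<^sup>2 + (norm (h z))\<^sup>2"
      using sum_squares_bound[of "norm (g z)" "norm (h z)"] mult_nonneg_nonneg[OF norm_ge_zero[of "g z"] norm_ge_zero[of "h z"]] by linarith
    finally show "norm (g z \<bullet> h z) \<le> norm ((norm (g z))\<^sup>2 + (norm (h z))\<^sup>2)" by simp
  qed
qed measurable

lemma norm_sq_diff:
  fixes x y :: "'h::real_inner"
  shows "(norm (x - y))\<^sup>2 = (norm x)\<^sup>2 - 2 * (x \<bullet> y) + (norm y)\<^sup>2"
  unfolding power2_norm_eq_inner inner_diff_left inner_diff_right
  by (simp add: inner_commute[of y x])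

lemma integrable_norm_sq_diff:
  fixes g h :: "'z \<Rightarrow> 'h::{real_inner, banach, second_countable_topology}"
  assumes [measurable]: "g \<in> borel_measurable P" "h \<in> borel_measurable P"
    and "integrable P (\<lambda>z. (norm (g z))\<^sup>2)" "integrable P (\<lambda>z. (norm (h z))\<^sup>2)"
  shows "integrable P (\<lambda>z. (norm (g z - h z))\<^sup>2)"
proof -
  have "integrable P (\<lambda>z. (norm (g z))\<^sup>2 - 2 * (g z \<bullet> h z) + (norm (h z))\<^sup>2)"
    using assms integrable_inner_L2[of g P h] by simp
  then show ?thesis
    by (simp only: norm_sq_diff)
qed

lemma (in prob_space) integral_norm_sq_centered:
  fixes h :: "'a \<Rightarrow> 'h::{real_inner, banach, second_countable_topology}"
  assumes [measurable]: "h \<in> borel_measurable M" and h: "integrable M (\<lambda>z. (norm (h z))\<^sup>2)"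
  shows "(\<integral>z. (norm (h z - (\<integral>z. h z \<partial>M)))\<^sup>2 \<partial>M) = (\<integral>z. (norm (h z))\<^sup>2 \<partial>M) - (norm (\<integral>z. h z \<partial>M))\<^sup>2"
proof -
  define m where "m = (\<integral>z. h z \<partial>M)"
  have int: "integrable M h"
    by (rule integrable_norm_sq_imp_integrable) (use h finite_measure_axioms in auto)
  have "(\<integral>z. (norm (h z - m))\<^sup>2 \<partial>M) = (\<integral>z. (norm (h z))\<^sup>2 - 2 * (h z \<bullet> m) + (norm m)\<^sup>2 \<partial>M)"
    by (intro Bochner_Integration.integral_cong refl norm_sq_diff)
  also have "\<dots> = (\<integral>z. (norm (h z))\<^sup>2 \<partial>M) - 2 * (m \<bullet> m) + (norm m)\<^sup>2"
    using int h by (simp add: prob_space m_def)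
  finally show ?thesis by (simp add: power2_norm_eq_inner m_def)
qed

lemma iid_sampleD:
  assumes "prob_space M" "iid_sample M P I Z" "i \<in> I"
  shows "Z i \<in> measurable M P" "distr M P (Z i) = P" "prob_space P"
proof -
  interpret prob_space M by fact
  show 1: "Z i \<in> measurable M P" using assms by (auto simp: iid_sample_def indep_vars_def)
  show 2: "distr M P (Z i) = P" using assms by (auto simp: iid_sample_def)
  show "prob_space P" using prob_space_distr[OF 1] 2 by simp
qed

lemma iid_sample_subset:
  assumes "prob_space M" "iid_sample M P I Z" "J \<subseteq> I"
  shows "iid_sample M P J Z"
  using assms prob_space.indep_vars_subset[OF assms(1)] by (auto simp: iid_sample_def)

text \<open>Injectivity makes the singleton blocks {s j} disjoint, and functions of disjoint blocks
  are independent. This is what makes the mixed samples i.i.d.\<close>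

lemma iid_sample_reindex:
  assumes M: "prob_space M" and Z: "iid_sample M P I Z" and s: "inj_on s J" "s ` J \<subseteq> I"
  shows "iid_sample M P J (\<lambda>j. Z (s j))"
proof -
  interpret prob_space M by fact
  have "indep_vars (\<lambda>j. PiM {s j} (\<lambda>_. P)) (\<lambda>j w. restrict (\<lambda>i. Z i w) {s j}) J"
    using Z s by (intro indep_vars_restrict[of _ _ I]) (auto simp: iid_sample_def disjoint_family_on_def inj_on_def)
  then have "indep_vars (\<lambda>_. P) (\<lambda>j w. (\<lambda>f. f (s j)) (restrict (\<lambda>i. Z i w) {s j})) J"
    by (rule indep_vars_compose2) auto
  then have "indep_vars (\<lambda>_. P) (\<lambda>j. Z (s j)) J" by simp
  then show ?thesis using Z s by (auto simp: iid_sample_def)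
qed

lemma iid_sample_pair:
  assumes M: "prob_space M" and Z: "iid_sample M P I Z" and ij: "i \<in> I" "j \<in> I" "i \<noteq> j"
  shows "independent_rv M P (Z i) P (Z j)"
proof -
  interpret prob_space M by fact
  have "indep_vars (\<lambda>_. P) Z I" using Z by (simp add: iid_sample_def)
  then have "indep_var (PiM {i} (\<lambda>_. P)) (\<lambda>\<omega>. restrict (\<lambda>i. Z i \<omega>) {i}) (PiM {j} (\<lambda>_. P)) (\<lambda>\<omega>. restrict (\<lambda>i. Z i \<omega>) {j})"
    using ij by (intro indep_var_restrict) auto
  then have "independent_rv M P (\<lambda>w. (\<lambda>f. f i) (restrict (\<lambda>i. Z i w) {i})) P (\<lambda>w. (\<lambda>f. f j) (restrict (\<lambda>i. Z i w) {j}))"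
    by (rule independent_rv_compose[OF indep_var_independent_rv]) auto
  then show ?thesis by simp
qed

text \<open>With the first point frozen, the integral over the second moves inside the inner product
  and meets the mean 0 of \<open>h\<close>.\<close>

lemma iid_sample_pair_inner:
  fixes h :: "'z \<Rightarrow> 'h::{real_inner, banach, second_countable_topology}"
  assumes M: "prob_space M" and Z: "iid_sample M P I Z" and ij: "i \<in> I" "j \<in> I" "i \<noteq> j"
    and [measurable]: "h \<in> borel_measurable P" and h2: "integrable P (\<lambda>z. (norm (h z))\<^sup>2)"
    and mean: "(\<integral>z. h z \<partial>P) = 0"
  shows "integrable M (\<lambda>w. h (Z i w) \<bullet> h (Z j w))" "(\<integral>w. h (Z i w) \<bullet> h (Z j w) \<partial>M) = 0"
proof -
  interpret prob_space M by fact
  note [measurable] = iid_sampleD(1)[OF M Z ij(1)] iid_sampleD(1)[OF M Z ij(2)]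
  interpret P: prob_space P by (rule iid_sampleD[OF M Z ij(1)])
  have h: "integrable P h"
    by (rule integrable_norm_sq_imp_integrable) (use h2 P.finite_measure_axioms in auto)
  have int: "integrable M (\<lambda>w. (norm (h (Z i w)))\<^sup>2)" if "i \<in> I" for i
    using h2 iid_sampleD[OF M Z that] integrable_distr_eq[of "Z i" M P "\<lambda>z. (norm (h z))\<^sup>2"] by simp
  have [measurable]: "(\<lambda>w. h (Z i w)) \<in> borel_measurable M" "(\<lambda>w. h (Z j w)) \<in> borel_measurable M" by measurable
  show *: "integrable M (\<lambda>w. h (Z i w) \<bullet> h (Z j w))"
    using ij by (intro integrable_inner_L2 int) auto
  have "(\<integral>w. h (Z i w) \<bullet> h (Z j w) \<partial>M) = (\<integral>w. (\<integral>w'. h (Z i w) \<bullet> h (Z j w') \<partial>M) \<partial>M)"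
    using integral_decouple[OF iid_sample_pair[OF M Z ij], of "\<lambda>(x, y). h x \<bullet> h y"] * by simp
  also have "\<dots> = (\<integral>w. 0 \<partial>M)"
  proof (rule Bochner_Integration.integral_cong[OF refl])
    fix w
    have "(\<integral>w'. h (Z i w) \<bullet> h (Z j w') \<partial>M) = (\<integral>z. h (Z i w) \<bullet> h z \<partial>distr M P (Z j))"
      by (subst integral_distr) auto
    also have "\<dots> = h (Z i w) \<bullet> (\<integral>z. h z \<partial>P)"
      using iid_sampleD[OF M Z ij(2)] h by simp
    finally show "(\<integral>w'. h (Z i w) \<bullet> h (Z j w') \<partial>M) = 0" using mean by simp
  qed
  finally show "(\<integral>w. h (Z i w) \<bullet> h (Z j w) \<partial>M) = 0" by simp
qed

text \<open>Only the diagonal of the double sum survives, and centering can only decrease the second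
  moment. The bound uses the uncentered moment so that an L2 distance can be inserted
  directly.\<close>

lemma iid_second_moment:
  fixes h :: "'z \<Rightarrow> 'h::{real_inner, banach, second_countable_topology}"
  assumes M: "prob_space M" and Z: "iid_sample M P I Z" and I: "finite I"
    and [measurable]: "h \<in> borel_measurable P" and h2: "integrable P (\<lambda>z. (norm (h z))\<^sup>2)"
  shows "integrable M (\<lambda>w. (norm (\<Sum>i\<in>I. h (Z i w) - (\<integral>z. h z \<partial>P)))\<^sup>2)"
    "(\<integral>w. (norm (\<Sum>i\<in>I. h (Z i w) - (\<integral>z. h z \<partial>P)))\<^sup>2 \<partial>M) \<le> card I * (\<integral>z. (norm (h z))\<^sup>2 \<partial>P)"
proof -
  interpret prob_space M by fact
  have "integrable M (\<lambda>w. (norm (\<Sum>i\<in>I. h (Z i w) - (\<integral>z. h z \<partial>P)))\<^sup>2) \<and>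
    (\<integral>w. (norm (\<Sum>i\<in>I. h (Z i w) - (\<integral>z. h z \<partial>P)))\<^sup>2 \<partial>M) \<le> card I * (\<integral>z. (norm (h z))\<^sup>2 \<partial>P)"
  proof (cases "I = {}")
    case False
    then obtain i0 where i0: "i0 \<in> I" by auto
    interpret P: prob_space P by (rule iid_sampleD[OF M Z i0])
    define m where "m = (\<integral>z. h z \<partial>P)"
    define h0 where "h0 z = h z - m" for z
    have [measurable]: "h0 \<in> borel_measurable P" unfolding h0_def by measurable
    have h: "integrable P h"
      by (rule integrable_norm_sq_imp_integrable) (use h2 P.finite_measure_axioms in auto)
    have m0: "(\<integral>z. h0 z \<partial>P) = 0"
      using h by (simp add: h0_def m_def P.prob_space)
    have h02: "integrable P (\<lambda>z. (norm (h0 z))\<^sup>2)"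
      unfolding h0_def by (rule integrable_norm_sq_diff) (use h2 in auto)
    have h0le: "(\<integral>z. (norm (h0 z))\<^sup>2 \<partial>P) \<le> (\<integral>z. (norm (h z))\<^sup>2 \<partial>P)"
      using P.integral_norm_sq_centered[of h] h2 by (simp add: h0_def m_def)
    have exp: "(norm (\<Sum>i\<in>I. h0 (Z i w)))\<^sup>2 = (\<Sum>i\<in>I. \<Sum>j\<in>I. h0 (Z i w) \<bullet> h0 (Z j w))" for w
      unfolding power2_norm_eq_inner inner_sum_left by (simp add: inner_sum_right)
    have diag: "integrable M (\<lambda>w. h0 (Z i w) \<bullet> h0 (Z i w))"
       "(\<integral>w. h0 (Z i w) \<bullet> h0 (Z i w) \<partial>M) = (\<integral>z. (norm (h0 z))\<^sup>2 \<partial>P)" if "i \<in> I" for i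
      using h02 iid_sampleD[OF M Z that] integrable_distr_eq[of "Z i" M P "\<lambda>z. (norm (h0 z))\<^sup>2"]
        integral_distr[of "Z i" M P "\<lambda>z. (norm (h0 z))\<^sup>2"] by (simp_all add: power2_norm_eq_inner)
    have int: "integrable M (\<lambda>w. h0 (Z i w) \<bullet> h0 (Z j w))" if "i \<in> I" "j \<in> I" for i j
      using diag(1)[OF that(1)] iid_sample_pair_inner(1)[OF M Z that _ _ h02 m0] by (cases "i = j") auto
    have "(\<integral>w. (norm (\<Sum>i\<in>I. h0 (Z i w)))\<^sup>2 \<partial>M) = (\<Sum>i\<in>I. \<Sum>j\<in>I. (\<integral>w. h0 (Z i w) \<bullet> h0 (Z j w) \<partial>M))"
      unfolding exp using int by simp
    also have "\<dots> = (\<Sum>i\<in>I. \<Sum>j\<in>I. if i = j then (\<integral>z. (norm (h0 z))\<^sup>2 \<partial>P) else 0)"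
      by (intro sum.cong refl) (auto simp: diag iid_sample_pair_inner(2)[OF M Z _ _ _ _ h02 m0])
    also have "\<dots> = card I * (\<integral>z. (norm (h0 z))\<^sup>2 \<partial>P)"
      using I by simp
    finally have "(\<integral>w. (norm (\<Sum>i\<in>I. h0 (Z i w)))\<^sup>2 \<partial>M) \<le> card I * (\<integral>z. (norm (h z))\<^sup>2 \<partial>P)"
      using h0le by (simp add: mult_left_mono)
    moreover have "integrable M (\<lambda>w. (norm (\<Sum>i\<in>I. h0 (Z i w)))\<^sup>2)"
      unfolding exp using int by simp
    ultimately show ?thesis by (simp add: h0_def m_def)
  qed simp
  then show "integrable M (\<lambda>w. (norm (\<Sum>i\<in>I. h (Z i w) - (\<integral>z. h z \<partial>P)))\<^sup>2)"
    "(\<integral>w. (norm (\<Sum>i\<in>I. h (Z i w) - (\<integral>z. h z \<partial>P)))\<^sup>2 \<partial>M) \<le> card I * (\<integral>z. (norm (h z))\<^sup>2 \<partial>P)" by auto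
qed

section \<open>Characteristic functions of normalized sums\<close>

lemma exp_minus_quadratic:
  fixes x :: real
  assumes "0 \<le> x"
  shows "\<bar>exp (- x) - (1 - x)\<bar> \<le> x\<^sup>2 / 2"
proof -
  have 1: "1 + x + x\<^sup>2 / 2 \<le> exp x" by (rule exp_lower_Taylor_quadratic) fact
  \<comment> \<open>Since (1 + x + x^2/2)(1 - x + x^2/2) = 1 + x^4/4, the quadratic lower bound for
    exp x turns into an upper bound for exp (-x).\<close>
  have "1 \<le> 1 + x^4/4" by simp
  also have "\<dots> = (1 + x + x\<^sup>2 / 2) * (1 - x + x\<^sup>2 / 2)" by (simp add: field_simps power_def numeral_eq_Suc)
  also have "\<dots> \<le> exp x * (1 - x + x\<^sup>2 / 2)"
  proof (rule mult_right_mono[OF 1])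
    have "0 \<le> (1 - x)\<^sup>2 + 1" by simp
    then show "0 \<le> 1 - x + x\<^sup>2 / 2" by (simp add: power2_eq_square algebra_simps)
  qed
  finally have "exp (-x) \<le> 1 - x + x\<^sup>2 / 2" by (simp add: exp_minus field_simps)
  moreover have "1 - x \<le> exp (-x)" using exp_ge_add_one_self[of "-x"] by simp
  ultimately show ?thesis by (auto simp: abs_le_iff)
qed

lemma iid_sum_char:
  fixes f :: "'z \<Rightarrow> real"
  assumes M: "prob_space M" and Z: "iid_sample M P I Z" and I: "finite I" "I \<noteq> {}"
    and [measurable]: "f \<in> borel_measurable P"
  shows "char (distr M borel (\<lambda>w. \<Sum>i\<in>I. f (Z i w))) t = (char (distr P borel f) t) ^ card I"
proof -
  interpret prob_space M by fact
  have "indep_vars (\<lambda>_. borel) (\<lambda>i w. f (Z i w)) I"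
    by (rule indep_vars_compose2[of "\<lambda>_. P"]) (use Z in \<open>auto simp: iid_sample_def\<close>)
  then have "char (distr M borel (\<lambda>w. \<Sum>i\<in>I. f (Z i w))) t = (\<Prod>i\<in>I. char (distr M borel (\<lambda>w. f (Z i w))) t)"
    by (rule char_distr_sum)
  also have "\<dots> = (\<Prod>i\<in>I. char (distr P borel f) t)"
  proof (intro prod.cong refl)
    fix i assume i: "i \<in> I"
    note [measurable] = iid_sampleD(1)[OF M Z i]
    have "distr M borel (\<lambda>w. f (Z i w)) = distr (distr M P (Z i)) borel f"
      by (subst distr_distr) (auto simp: comp_def)
    then show "char (distr M borel (\<lambda>w. f (Z i w))) t = char (distr P borel f) t"
      using iid_sampleD(2)[OF M Z i] by simp
  qed
  finally show ?thesis by simp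
qed

lemma (in prob_space) integrable_power4:
  fixes f :: "'a \<Rightarrow> real"
  assumes [measurable]: "f \<in> borel_measurable M" and f4: "integrable M (\<lambda>z. f z ^ 4)"
  shows "integrable M (\<lambda>z. (f z)\<^sup>2)" "integrable M f" "integrable M (\<lambda>z. \<bar>f z\<bar> ^ 3)"
    "(\<integral>z. \<bar>f z\<bar> ^ 3 \<partial>M) \<le> 1 + (\<integral>z. f z ^ 4 \<partial>M)"
proof -
  show 2: "integrable M (\<lambda>z. (f z)\<^sup>2)"
    by (rule square_integrable_imp_integrable) (use f4 in \<open>auto simp: power4_eq_xxxx power2_eq_square mult.assoc\<close>)
  then show "integrable M f" by (rule square_integrable_imp_integrable[rotated]) simp
  have bnd: "\<bar>x\<bar> ^ 3 \<le> 1 + x ^ 4" for x :: real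
  proof (cases "\<bar>x\<bar> \<le> 1")
    case True
    then have "\<bar>x\<bar> ^ 3 \<le> 1" by (simp add: power_le_one)
    moreover have "0 \<le> x ^ 4" by simp
    ultimately show ?thesis by linarith
  next
    case False
    then have "\<bar>x\<bar> ^ 3 \<le> \<bar>x\<bar> ^ 4" by (intro power_increasing) auto
    then show ?thesis by simp
  qed
  show "integrable M (\<lambda>z. \<bar>f z\<bar> ^ 3)"
    by (rule Bochner_Integration.integrable_bound[of _ "\<lambda>z. 1 + f z ^ 4"])
       (use f4 bnd in \<open>auto simp: abs_of_nonneg\<close>)
  then have "(\<integral>z. \<bar>f z\<bar> ^ 3 \<partial>M) \<le> (\<integral>z. 1 + f z ^ 4 \<partial>M)"
    using f4 bnd by (intro integral_mono) auto
  then show "(\<integral>z. \<bar>f z\<bar> ^ 3 \<partial>M) \<le> 1 + (\<integral>z. f z ^ 4 \<partial>M)"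
    using f4 by (simp add: prob_space)
qed

text \<open>A Berry--Esseen type estimate at the level of characteristic functions. Its point is
  that the error depends on \<open>f\<close> through the fourth moment alone, because
  \<open>f\<close> will be a projection on a random direction.\<close>

lemma iid_sum_char_bound:
  fixes f :: "'z \<Rightarrow> real"
  assumes M: "prob_space M" and Z: "iid_sample M P I Z" and I: "finite I" "card I = n" "n > 0"
    and f[measurable]: "f \<in> borel_measurable P" and f4: "integrable P (\<lambda>z. f z ^ 4)"
    and f0: "(\<integral>z. f z \<partial>P) = 0" and f2: "(\<integral>z. (f z)\<^sup>2 \<partial>P) = 1"
  shows "cmod (char (distr M borel (\<lambda>w. (\<Sum>i\<in>I. f (Z i w)) / sqrt n)) t - exp (- (t\<^sup>2) / 2))
     \<le> (\<bar>t\<bar> ^ 3 * (1 + (\<integral>z. f z ^ 4 \<partial>P)) + t ^ 4) / sqrt n"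
proof -
  interpret prob_space M by fact
  have "I \<noteq> {}" using I by auto
  then obtain i0 where i0: "i0 \<in> I" by auto
  interpret P: prob_space P by (rule iid_sampleD[OF M Z i0])
  interpret Pf: prob_space "distr P borel f" by (rule P.prob_space_distr) simp
  interpret Pf: real_distribution "distr P borel f" by (rule P.real_distribution_distr) simp
  note mom = P.integrable_power4[OF f f4]
  define u where "u = t / sqrt n"
  define x where "x = u\<^sup>2 / 2"
  have n: "real n > 0" using I by simp
  have u2: "u\<^sup>2 = t\<^sup>2 / n" using n by (simp add: u_def power_divide)
  note [measurable] = iid_sampleD(1)[OF M Z]
  have meas: "(\<lambda>w. \<Sum>i\<in>I. f (Z i w)) \<in> borel_measurable M"
    by (intro borel_measurable_sum) measurable
  have "char (distr M borel (\<lambda>w. (\<Sum>i\<in>I. f (Z i w)) / sqrt n)) t = char (distr M borel (\<lambda>w. \<Sum>i\<in>I. f (Z i w))) u"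
    unfolding char_def u_def using meas by (simp add: integral_distr field_simps)
  also have "\<dots> = (char (distr P borel f) u) ^ n"
    using iid_sum_char[OF M Z I(1) \<open>I \<noteq> {}\<close>] I by simp
  finally have c: "char (distr M borel (\<lambda>w. (\<Sum>i\<in>I. f (Z i w)) / sqrt n)) t = (char (distr P borel f) u) ^ n" .
  have e: "complex_of_real (exp (- (t\<^sup>2) / 2)) = complex_of_real (exp (- x)) ^ n"
    using n by (simp add: x_def u2 exp_of_nat_mult[symmetric] flip: of_real_power)
  have v: "P.variance f = 1" using f0 f2 by simp
  \<comment> \<open>Keeping only the cubic entry of the minimum leaves |u|^3 / 6 times the third
    absolute moment, which is at most 1 plus the fourth moment.\<close>
  have "cmod (char (distr P borel f) u - (1 - u\<^sup>2 * 1 / 2)) \<le> u\<^sup>2 / 6 * (\<integral>z. min (6 * (f z)\<^sup>2) (\<bar>u\<bar> * \<bar>f z\<bar> ^ 3) \<partial>P)"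
    by (rule P.char_approx3'[OF f mom(2) mom(1) f0 v refl])
  also have "\<dots> \<le> u\<^sup>2 / 6 * (\<integral>z. \<bar>u\<bar> * \<bar>f z\<bar> ^ 3 \<partial>P)"
    using mom by (intro mult_left_mono integral_mono) auto
  also have "\<dots> \<le> u\<^sup>2 / 6 * (\<bar>u\<bar> * (1 + (\<integral>z. f z ^ 4 \<partial>P)))"
    using mom(4) by (auto intro!: mult_left_mono)
  finally have b0: "cmod (char (distr P borel f) u - (1 - u\<^sup>2 * 1 / 2)) \<le> u\<^sup>2 / 6 * (\<bar>u\<bar> * (1 + (\<integral>z. f z ^ 4 \<partial>P)))" .
  then have b1: "cmod (char (distr P borel f) u - (1 - x)) \<le> \<bar>u\<bar>^3 * (1 + (\<integral>z. f z ^ 4 \<partial>P)) / 6"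
  proof -
    have "\<bar>u\<bar>^3 = u\<^sup>2 * \<bar>u\<bar>" by (simp add: power3_eq_cube power2_eq_square)
    then show ?thesis
      using b0 by (simp add: x_def)
  qed
  have b2: "cmod (complex_of_real (1 - x) - complex_of_real (exp (- x))) \<le> x\<^sup>2 / 2"
    using exp_minus_quadratic[of x] unfolding of_real_diff[symmetric] norm_of_real by (simp add: x_def abs_minus_commute)
  have "cmod (char (distr M borel (\<lambda>w. (\<Sum>i\<in>I. f (Z i w)) / sqrt n)) t - exp (- (t\<^sup>2) / 2)) =
      cmod ((char (distr P borel f) u) ^ n - complex_of_real (exp (- x)) ^ n)"
    unfolding c e ..
  \<comment> \<open>For complex numbers of modulus at most 1, n-th powers differ by at most n times
    the difference. With u = t / sqrt n the two errors below are of order n^(-3/2) and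
    n^(-2).\<close>
  also have "\<dots> \<le> n * cmod (char (distr P borel f) u - complex_of_real (exp (- x)))"
    by (rule norm_power_diff) (auto simp: Pf.cmod_char_le_1 x_def)
  also have "cmod (char (distr P borel f) u - complex_of_real (exp (- x))) \<le>
      cmod (char (distr P borel f) u - (1 - x)) + cmod (complex_of_real (1 - x) - complex_of_real (exp (- x)))"
    using norm_triangle_ineq[of "char (distr P borel f) u - (1 - x)" "complex_of_real (1 - x) - complex_of_real (exp (- x))"] by simp
  also have "\<dots> \<le> \<bar>u\<bar>^3 * (1 + (\<integral>z. f z ^ 4 \<partial>P)) / 6 + x\<^sup>2 / 2"
    using b1 b2 by (rule add_mono)
  also have "n * \<dots> = (\<bar>t\<bar>^3 * (1 + (\<integral>z. f z ^ 4 \<partial>P))) / (6 * sqrt n) + t^4 / (8 * real n)"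
  proof -
    have "\<bar>u\<bar>^3 = \<bar>t\<bar>^3 / (n * sqrt n)" using n by (simp add: u_def power_divide power3_eq_cube abs_mult)
    moreover have "x\<^sup>2 = t^4 / (4 * (real n * real n))" unfolding x_def u2 by (simp add: power_divide power2_eq_square power4_eq_xxxx mult_ac)
    ultimately have "n * (\<bar>u\<bar>^3 * Y / 6 + x\<^sup>2 / 2) = (\<bar>t\<bar>^3 * Y) / (6 * sqrt n) + t^4 / (8 * real n)" for Y
      using n by (simp only:) (simp add: field_simps)
    then show ?thesis .
  qed
  also have "\<dots> \<le> (\<bar>t\<bar>^3 * (1 + (\<integral>z. f z ^ 4 \<partial>P))) / sqrt n + t^4 / sqrt n"
  proof (intro add_mono)
    have "0 \<le> (\<integral>z. f z ^ 4 \<partial>P)" by (intro Bochner_Integration.integral_nonneg) auto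
    then show "\<bar>t\<bar>^3 * (1 + (\<integral>z. f z ^ 4 \<partial>P)) / (6 * sqrt n) \<le> \<bar>t\<bar>^3 * (1 + (\<integral>z. f z ^ 4 \<partial>P)) / sqrt n"
      using n by (intro divide_left_mono) auto
    have "sqrt n * 1 \<le> sqrt n * sqrt n" using I by (intro mult_left_mono) auto
    then have "sqrt n \<le> 8 * real n" using n by simp
    then show "t ^ 4 / (8 * real n) \<le> t ^ 4 / sqrt n"
      using n by (intro divide_left_mono) auto
  qed
  finally show ?thesis using n by (simp add: add_divide_distrib mult_left_mono)
qed

lemma (in prob_space) inprob_bounded_convergence:
  fixes X :: "nat \<Rightarrow> 'a \<Rightarrow> 'b::{banach, second_countable_topology}"
  assumes [measurable]: "\<And>n. X n \<in> borel_measurable M" and bnd: "\<And>n w. norm (X n w) \<le> C"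
    and lim: "((\<lambda>(n, w). X n w) \<longlongrightarrow> 0) (inprob M)"
  shows "(\<lambda>n. \<integral>w. X n w \<partial>M) \<longlonglongrightarrow> 0"
proof (rule tendstoI)
  fix e :: real assume e: "e > 0"
  have C: "C \<ge> 0" using bnd norm_ge_zero order_trans by blast
  \<comment> \<open>The exceptional set then contributes at most C * \<eta> \<le> e / 4; the summand
    1 avoids a division by 0 when C = 0.\<close>
  define \<eta> where "\<eta> = e / (4 * (C + 1))"
  have \<eta>: "\<eta> > 0" using e C by (simp add: \<eta>_def)
  have "\<forall>\<^sub>F x in inprob M. dist (case x of (n, w) \<Rightarrow> X n w) 0 < e/2"
    using lim e by (intro tendstoD) auto
  then have "\<forall>\<^sub>F n in sequentially. fails_at_most M \<eta> (\<lambda>w. norm (X n w) < e/2)"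
    unfolding eventually_inprob using \<eta> by auto
  then show "\<forall>\<^sub>F n in sequentially. dist (\<integral>w. X n w \<partial>M) 0 < e"
  proof eventually_elim
    case (elim n)
    then obtain B where B: "B \<in> sets M" "measure M B \<le> \<eta>" "\<forall>w\<in>space M - B. norm (X n w) < e/2" by auto
    have int: "integrable M (X n)"
      by (rule integrable_const_bound[of _ C]) (use bnd in auto)
    have "norm (\<integral>w. X n w \<partial>M) \<le> (\<integral>w. norm (X n w) \<partial>M)" by (rule integral_norm_bound)
    also have "\<dots> \<le> (\<integral>w. e/2 + C * indicator B w \<partial>M)"
    proof (rule integral_mono)
      show "integrable M (\<lambda>w. e/2 + C * indicator B w)" using B(1)
          by (intro Bochner_Integration.integrable_add integrable_const integrable_mult_right integrable_real_indicator) (auto simp: less_top[symmetric])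
      show "norm (X n w) \<le> e/2 + C * indicator B w" if "w \<in> space M" for w
        using that B(3) e bnd[of n w] C by (cases "w \<in> B") (auto intro: less_imp_le)
    qed (use int in auto)
    also have "\<dots> = e/2 + C * measure M B"
      using B(1) by (subst Bochner_Integration.integral_add) (auto simp: prob_space less_top[symmetric])
    also have "\<dots> \<le> e/2 + C * \<eta>" using B(2) C by (simp add: mult_left_mono)
    also have "\<dots> < e" using e C by (simp add: \<eta>_def field_simps add_pos_nonneg)
    finally show ?case by simp
  qed
qed

lemma isCont_cdf_std_normal: "isCont (cdf std_normal_distribution) x"
proof -
  interpret real_distribution std_normal_distribution by (rule real_dist_normal_dist)
  have "emeasure std_normal_distribution {x} = 0" for x :: real
  proof -
    have "emeasure std_normal_distribution {x} = (\<integral>\<^sup>+y. std_normal_density y * indicator {x} y \<partial>lborel)"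
      by (subst emeasure_density) auto
    also have "\<dots> = (\<integral>\<^sup>+y. 0 \<partial>(lborel::real measure))"
      using AE_lborel_singleton[of x] by (intro nn_integral_cong_AE) (auto elim!: eventually_mono)
    finally show ?thesis by simp
  qed
  then show ?thesis by (simp add: isCont_cdf measure_def)
qed

text \<open>Continuity of the cdf at 0. Every lower bound on \<open>q V\<close> comes from this: a
  projection of \<open>V\<close> is nearly normal and so rarely close to 0.\<close>

lemma std_normal_small_ball:
  assumes "\<eta> > 0"
  obtains a where "a > 0" "cdf std_normal_distribution a - cdf std_normal_distribution (- a) < \<eta>"
proof -
  have "(\<lambda>a. cdf std_normal_distribution a - cdf std_normal_distribution (- a)) \<midarrow>0\<rightarrow> cdf std_normal_distribution 0 - cdf std_normal_distribution (- 0)"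
    by (intro tendsto_diff isCont_tendsto_compose[OF isCont_cdf_std_normal] tendsto_minus tendsto_ident_at)
  then have "\<forall>\<^sub>F a in at 0. cdf std_normal_distribution a - cdf std_normal_distribution (- a) < \<eta>"
    using order_tendstoD(2)[of _ _ "at 0" \<eta>] assms by simp
  then have "\<forall>\<^sub>F a in at_right 0. cdf std_normal_distribution a - cdf std_normal_distribution (- a) < \<eta>"
    by (simp add: eventually_at_split)
  then obtain b where "b > 0" "\<forall>y>0. y < b \<longrightarrow> cdf std_normal_distribution y - cdf std_normal_distribution (- y) < \<eta>"
    unfolding eventually_at_right_field by auto
  then show ?thesis using that[of "b/2"] by auto
qed

section \<open>The two-sample oracle statistic\<close>

locale two_sample = prob_space M for M :: "'w measure" +
  fixes P :: "'z measure" and Z :: "nat \<Rightarrow> 'w \<Rightarrow> 'z"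
    and \<phi> :: "'z \<Rightarrow> 'h::{real_inner, banach, second_countable_topology}"
  assumes Z: "iid_sample M P {1..} Z"
    and \<phi>_meas[measurable]: "\<phi> \<in> borel_measurable P"
    and \<phi>4: "integrable P (\<lambda>z. norm (\<phi> z) ^ 4)"
    and mean: "(\<integral>z. \<phi> z \<partial>P) = 0"
    and nondeg: "(\<integral>w. (\<phi> (Z 1 w) \<bullet> \<phi> (Z 2 w))\<^sup>2 \<partial>M) > 0"
begin

section \<open>Moments and independence of the two half sums\<close>

lemma prob_M: "prob_space M" by (rule prob_space_axioms)

lemma Z_meas[measurable]: "1 \<le> i \<Longrightarrow> Z i \<in> measurable M P"
  using iid_sampleD(1)[OF prob_M Z] by auto

sublocale P: prob_space P
  using iid_sampleD(3)[OF prob_M Z, of 1] by auto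

text \<open>The quadratic form of the covariance operator: since \<phi> has mean 0, this is the
  variance of \<phi> in direction v.\<close>

definition q :: "'h \<Rightarrow> real" where "q v = (\<integral>z. (\<phi> z \<bullet> v)\<^sup>2 \<partial>P)"

definition m4 :: real where "m4 = (\<integral>z. norm (\<phi> z) ^ 4 \<partial>P)"

definition m2 :: real where "m2 = (\<integral>z. (norm (\<phi> z))\<^sup>2 \<partial>P)"

definition U :: "nat \<Rightarrow> 'w \<Rightarrow> 'h" where "U n w = (1 / sqrt n) *\<^sub>R (\<Sum>i\<in>{1..n}. \<phi> (Z i w))"

definition V :: "nat \<Rightarrow> 'w \<Rightarrow> 'h" where "V n w = (1 / sqrt n) *\<^sub>R (\<Sum>i\<in>{n+1..2*n}. \<phi> (Z i w))"

lemma U_meas[measurable]: "U n \<in> borel_measurable M"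
  unfolding U_def by (intro borel_measurable_scaleR borel_measurable_const borel_measurable_sum) auto

lemma V_meas[measurable]: "V n \<in> borel_measurable M"
  unfolding V_def by (intro borel_measurable_scaleR borel_measurable_const borel_measurable_sum) auto

lemma q_meas[measurable]: "q \<in> borel_measurable borel"
  unfolding q_def by measurable

lemma q_nonneg: "q v \<ge> 0"
  unfolding q_def by (intro Bochner_Integration.integral_nonneg) auto

lemma \<phi>2: "integrable P (\<lambda>z. (norm (\<phi> z))\<^sup>2)"
  using P.integrable_power4(1)[of "\<lambda>z. norm (\<phi> z)"] \<phi>4 by simp

lemma \<phi>_int: "integrable P \<phi>"
  by (rule integrable_norm_sq_imp_integrable[OF P.finite_measure_axioms \<phi>_meas \<phi>2])

lemma m4_nonneg: "m4 \<ge> 0" and m2_nonneg: "m2 \<ge> 0"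
  unfolding m4_def m2_def by (auto intro!: Bochner_Integration.integral_nonneg)

lemma inner_power4:
  shows "integrable P (\<lambda>z. (\<phi> z \<bullet> v) ^ 4)" "(\<integral>z. (\<phi> z \<bullet> v) ^ 4 \<partial>P) \<le> norm v ^ 4 * m4"
proof -
  have b: "(\<phi> z \<bullet> v) ^ 4 \<le> norm v ^ 4 * norm (\<phi> z) ^ 4" for z
  proof -
    have "\<bar>\<phi> z \<bullet> v\<bar> ^ 4 \<le> (norm (\<phi> z) * norm v) ^ 4"
      by (intro power_mono Cauchy_Schwarz_ineq2) auto
    then show ?thesis by (simp add: power_mult_distrib mult.commute)
  qed
  show 1: "integrable P (\<lambda>z. (\<phi> z \<bullet> v) ^ 4)"
    by (rule Bochner_Integration.integrable_bound[of _ "\<lambda>z. norm v ^ 4 * norm (\<phi> z) ^ 4"]) (use \<phi>4 b in auto)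
  have "(\<integral>z. (\<phi> z \<bullet> v) ^ 4 \<partial>P) \<le> (\<integral>z. norm v ^ 4 * norm (\<phi> z) ^ 4 \<partial>P)"
    using \<phi>4 1 b by (intro integral_mono) auto
  then show "(\<integral>z. (\<phi> z \<bullet> v) ^ 4 \<partial>P) \<le> norm v ^ 4 * m4" by (simp add: m4_def)
qed

lemma inner_power2: "integrable P (\<lambda>z. (\<phi> z \<bullet> v)\<^sup>2)"
  by (rule P.integrable_power4(1)[OF _ inner_power4(1)]) measurable

lemma inner_mean: "(\<integral>z. \<phi> z \<bullet> v \<partial>P) = 0"
  using \<phi>_int mean by simp

lemma blocks_independent:
  "independent_rv M (PiM {n+1..2*n} (\<lambda>_. P)) (\<lambda>w. \<lambda>i\<in>{n+1..2*n}. Z i w) (PiM {1..n} (\<lambda>_. P)) (\<lambda>w. \<lambda>i\<in>{1..n}. Z i w)"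
  by (rule indep_var_independent_rv, rule indep_var_restrict[of _ _ "{1..}"]) (use Z in \<open>auto simp: iid_sample_def\<close>)

text \<open>Independence from the raw first block, and not only from \<open>U\<close>, serves the
  law of large numbers for the quadratic form, where the points of the first block enter one by
  one.\<close>

lemma V_independent:
  "independent_rv M borel (V n) (PiM {1..n} (\<lambda>_. P)) (\<lambda>w. \<lambda>i\<in>{1..n}. Z i w)"
proof -
  have "independent_rv M borel (\<lambda>w. (\<lambda>d. (1 / sqrt n) *\<^sub>R (\<Sum>i\<in>{n+1..2*n}. \<phi> (d i))) (\<lambda>i\<in>{n+1..2*n}. Z i w))
     (PiM {1..n} (\<lambda>_. P)) (\<lambda>w. (\<lambda>d. d) (\<lambda>i\<in>{1..n}. Z i w))"
    by (rule independent_rv_compose[OF blocks_independent]) measurable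
  moreover have "(\<lambda>w. (\<lambda>d. (1 / sqrt n) *\<^sub>R (\<Sum>i\<in>{n+1..2*n}. \<phi> (d i))) (\<lambda>i\<in>{n+1..2*n}. Z i w)) = V n"
    by (auto simp: V_def fun_eq_iff intro!: sum.cong)
  ultimately show ?thesis by simp
qed

lemma UV_independent: "independent_rv M borel (V n) borel (U n)"
proof -
  have "independent_rv M borel (\<lambda>w. (\<lambda>v. v) (V n w)) borel
     (\<lambda>w. (\<lambda>d. (1 / sqrt n) *\<^sub>R (\<Sum>i\<in>{1..n}. \<phi> (d i))) (\<lambda>i\<in>{1..n}. Z i w))"
    by (rule independent_rv_compose[OF V_independent]) measurable
  moreover have "(\<lambda>w. (\<lambda>d. (1 / sqrt n) *\<^sub>R (\<Sum>i\<in>{1..n}. \<phi> (d i))) (\<lambda>i\<in>{1..n}. Z i w)) = U n"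
    by (auto simp: U_def fun_eq_iff intro!: sum.cong)
  ultimately show ?thesis by simp
qed

lemma block_second_moment:
  assumes I: "finite I" "I \<subseteq> {1..}" "card I = n"
  shows "integrable M (\<lambda>w. (norm ((1 / sqrt n) *\<^sub>R (\<Sum>i\<in>I. \<phi> (Z i w))))\<^sup>2)"
    "(\<integral>w. (norm ((1 / sqrt n) *\<^sub>R (\<Sum>i\<in>I. \<phi> (Z i w))))\<^sup>2 \<partial>M) \<le> m2"
proof -
  note * = iid_second_moment[OF prob_M iid_sample_subset[OF prob_M Z I(2)] I(1) \<phi>_meas \<phi>2]
  have eq: "(norm ((1 / sqrt n) *\<^sub>R (\<Sum>i\<in>I. \<phi> (Z i w))))\<^sup>2 = (1 / n) * (norm (\<Sum>i\<in>I. \<phi> (Z i w)))\<^sup>2" for w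
    by (simp add: power_mult_distrib power_divide)
  show "integrable M (\<lambda>w. (norm ((1 / sqrt n) *\<^sub>R (\<Sum>i\<in>I. \<phi> (Z i w))))\<^sup>2)"
    unfolding eq using *(1) by (simp add: mean)
  have "(\<integral>w. (norm ((1 / sqrt n) *\<^sub>R (\<Sum>i\<in>I. \<phi> (Z i w))))\<^sup>2 \<partial>M) \<le> (1 / n) * (n * m2)"
    unfolding eq using mult_left_mono[OF *(2), of "1 / n"] I by (simp add: mean m2_def)
  then show "(\<integral>w. (norm ((1 / sqrt n) *\<^sub>R (\<Sum>i\<in>I. \<phi> (Z i w))))\<^sup>2 \<partial>M) \<le> m2"
    using m2_nonneg by (cases "n = 0") auto
qed

lemma U_second_moment: "integrable M (\<lambda>w. (norm (U n w))\<^sup>2)" "(\<integral>w. (norm (U n w))\<^sup>2 \<partial>M) \<le> m2"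
  unfolding U_def by (rule block_second_moment; auto)+

lemma V_second_moment: "integrable M (\<lambda>w. (norm (V n w))\<^sup>2)" "(\<integral>w. (norm (V n w))\<^sup>2 \<partial>M) \<le> m2"
  unfolding V_def by (rule block_second_moment; auto)+

lemma tight_of_second_moment:
  fixes X :: "nat \<Rightarrow> 'w \<Rightarrow> 'h"
  assumes "\<And>n. X n \<in> borel_measurable M" "\<And>n. integrable M (\<lambda>w. (norm (X n w))\<^sup>2)"
    and "\<And>n. (\<integral>w. (norm (X n w))\<^sup>2 \<partial>M) \<le> c" and \<eta>: "\<eta> > 0"
  shows "\<exists>K>0. \<forall>n. fails_at_most M \<eta> (\<lambda>w. norm (X n w) \<le> K)"
proof -
  define K where "K = sqrt ((\<bar>c\<bar> + 1) / \<eta>)"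
  have K: "K > 0" "K\<^sup>2 = (\<bar>c\<bar> + 1) / \<eta>" using \<eta> by (auto simp: K_def)
  have [measurable]: "X n \<in> borel_measurable M" for n by fact
  have "measure M {w\<in>space M. (norm (X n w))\<^sup>2 \<ge> K\<^sup>2} \<le> \<eta>" for n
  proof -
    have "measure M {w\<in>space M. (norm (X n w))\<^sup>2 \<ge> K\<^sup>2} \<le> (\<integral>w. (norm (X n w))\<^sup>2 \<partial>M) / K\<^sup>2"
      using zero_less_power[OF K(1), of 2] assms(2)[of n] by (intro integral_Markov_inequality_measure[where A="{}"]) auto
    also have "\<dots> \<le> (\<bar>c\<bar> + 1) / K\<^sup>2"
      using assms(3)[of n] by (intro divide_right_mono) auto
    also have "\<dots> = \<eta>" using K \<eta> by (simp add: add_nonneg_pos less_imp_neq)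
    finally show ?thesis .
  qed
  moreover have "norm (X n w) \<le> K" if "\<not> (norm (X n w))\<^sup>2 \<ge> K\<^sup>2" for n w
    using that K(1) by (meson less_imp_le not_le power2_le_imp_le)
  ultimately have "fails_at_most M \<eta> (\<lambda>w. norm (X n w) \<le> K)" for n
    by (intro bexI[of _ "{w\<in>space M. (norm (X n w))\<^sup>2 \<ge> K\<^sup>2}"]) auto
  with K(1) show ?thesis by blast
qed

text \<open>Cauchy--Schwarz for a positive semidefinite form, by minimizing
  \<open>q (v - t *\<^sub>R w)\<close> over t.\<close>

lemma q_Cauchy_Schwarz:
  "(\<integral>z. (\<phi> z \<bullet> v) * (\<phi> z \<bullet> w) \<partial>P)\<^sup>2 \<le> q v * q w"
  "integrable P (\<lambda>z. (\<phi> z \<bullet> v) * (\<phi> z \<bullet> w))"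
proof -
  have i: "integrable P (\<lambda>z. (\<phi> z \<bullet> v) * (\<phi> z \<bullet> w))" for v w
  proof -
    have "integrable P (\<lambda>z. ((\<phi> z \<bullet> (v + w))\<^sup>2 - (\<phi> z \<bullet> v)\<^sup>2 - (\<phi> z \<bullet> w)\<^sup>2) / 2)"
      using inner_power2 by (intro Bochner_Integration.integrable_diff integrable_divide) auto
    then show ?thesis by (simp add: inner_add_right power2_sum)
  qed
  define b where "b v w = (\<integral>z. (\<phi> z \<bullet> v) * (\<phi> z \<bullet> w) \<partial>P)" for v w
  have expand: "q (v - t *\<^sub>R w) = q v - 2 * t * b v w + t\<^sup>2 * q w" for t v w
  proof -
    have "q (v - t *\<^sub>R w) = (\<integral>z. (\<phi> z \<bullet> v)\<^sup>2 - (2 * t) * ((\<phi> z \<bullet> v) * (\<phi> z \<bullet> w)) + t\<^sup>2 * (\<phi> z \<bullet> w)\<^sup>2 \<partial>P)"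
      unfolding q_def by (intro Bochner_Integration.integral_cong refl) (simp add: inner_diff_right power2_eq_square algebra_simps)
    also have "\<dots> = q v - 2 * t * b v w + t\<^sup>2 * q w"
      unfolding q_def b_def using i inner_power2 by simp
    finally show ?thesis .
  qed
  have main: "(b v w)\<^sup>2 \<le> q v * q w" if "q w > 0" for v w
  proof -
    have "0 \<le> q (v - (b v w / q w) *\<^sub>R w)" by (rule q_nonneg)
    also have "\<dots> = q v - (b v w)\<^sup>2 / q w"
      unfolding expand using that by (simp add: power2_eq_square field_simps)
    finally show ?thesis using that by (simp add: field_simps)
  qed
  have sym: "b v w = b w v" for v w by (simp add: b_def mult.commute)
  have "(b v w)\<^sup>2 \<le> q v * q w"
  proof (cases "q w > 0 \<or> q v > 0")
    case True
    then show ?thesis using main[of w v] main[of v w] sym[of v w] by (auto simp: mult.commute)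
  next
    case False
    then have z: "q w = 0" "q v = 0" using q_nonneg[of w] q_nonneg[of v] by auto
    \<comment> \<open>With both quadratic coefficients 0 the expansion is linear in t, and t = b v w
      leaves -2 (b v w)^2.\<close>
    have "0 \<le> q (v - b v w *\<^sub>R w)" by (rule q_nonneg)
    then have "(b v w)\<^sup>2 \<le> 0" unfolding expand using z by (simp add: power2_eq_square)
    then show ?thesis using z by simp
  qed
  then show "(\<integral>z. (\<phi> z \<bullet> v) * (\<phi> z \<bullet> w) \<partial>P)\<^sup>2 \<le> q v * q w" by (simp add: b_def)
  show "integrable P (\<lambda>z. (\<phi> z \<bullet> v) * (\<phi> z \<bullet> w))" by (rule i)
qed

text \<open>Take u = \<Sigma> w for the covariance operator \<Sigma> and some w with q w > 0. Then v
  \<bullet> u is the covariance form of v and w, and Cauchy--Schwarz bounds its square by q w * q v.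
  A vector outside the range of \<Sigma> need not admit such a bound.\<close>

lemma exists_direction:
  obtains u c where "c > 0" "q u > 0" "\<And>v. (v \<bullet> u)\<^sup>2 \<le> c * q v"
proof -
  \<comment> \<open>If q vanished identically, integrating out Z 2 with Z 1 frozen would give E q
    (\<phi> (Z 1)) = 0 for the quantity in \<open>nondeg\<close>.\<close>
  have "\<exists>w. q w > 0"
  proof (rule ccontr)
    assume "\<not> (\<exists>w. q w > 0)"
    then have q0: "q w = 0" for w using q_nonneg[of w] by (auto simp: not_less intro: antisym)
    have ind: "independent_rv M P (Z 1) P (Z 2)"
      by (rule iid_sample_pair[OF prob_M Z]) auto
    \<comment> \<open>A non-integrable function has the default Bochner integral 0, which
      \<open>nondeg\<close> excludes.\<close>
    have "integrable M (\<lambda>w. (\<phi> (Z 1 w) \<bullet> \<phi> (Z 2 w))\<^sup>2)"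
      using nondeg not_integrable_integral_eq by fastforce
    then have "(\<integral>w. (\<phi> (Z 1 w) \<bullet> \<phi> (Z 2 w))\<^sup>2 \<partial>M) = (\<integral>w. (\<integral>w'. (\<phi> (Z 1 w) \<bullet> \<phi> (Z 2 w'))\<^sup>2 \<partial>M) \<partial>M)"
      using integral_decouple[OF ind, of "\<lambda>(x, y). (\<phi> x \<bullet> \<phi> y)\<^sup>2"] by simp
    also have "\<dots> = (\<integral>w. q (\<phi> (Z 1 w)) \<partial>M)"
    proof (rule Bochner_Integration.integral_cong[OF refl])
      fix w
      have "(\<integral>w'. (\<phi> (Z 1 w) \<bullet> \<phi> (Z 2 w'))\<^sup>2 \<partial>M) = (\<integral>z. (\<phi> (Z 1 w) \<bullet> \<phi> z)\<^sup>2 \<partial>distr M P (Z 2))"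
        by (subst integral_distr) auto
      then show "(\<integral>w'. (\<phi> (Z 1 w) \<bullet> \<phi> (Z 2 w'))\<^sup>2 \<partial>M) = q (\<phi> (Z 1 w))"
        using iid_sampleD(2)[OF prob_M Z, of 2] by (simp add: q_def inner_commute)
    qed
    finally show False using nondeg q0 by simp
  qed
  then obtain w where w: "q w > 0" ..
  define u where "u = (\<integral>z. (\<phi> z \<bullet> w) *\<^sub>R \<phi> z \<partial>P)"
  have int: "integrable P (\<lambda>z. (\<phi> z \<bullet> w) *\<^sub>R \<phi> z)"
  proof (rule Bochner_Integration.integrable_bound)
    show "integrable P (\<lambda>z. norm w * (norm (\<phi> z))\<^sup>2)" using \<phi>2 by simp
    show "AE z in P. norm ((\<phi> z \<bullet> w) *\<^sub>R \<phi> z) \<le> norm (norm w * (norm (\<phi> z))\<^sup>2)"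
      using Cauchy_Schwarz_ineq2[of _ w]
      by (auto simp: power2_eq_square mult_ac intro!: always_eventually)
         (metis mult.assoc mult.commute mult_left_mono norm_ge_zero)
  qed measurable
  have vu: "v \<bullet> u = (\<integral>z. (\<phi> z \<bullet> v) * (\<phi> z \<bullet> w) \<partial>P)" for v
  proof -
    have "v \<bullet> u = (\<integral>z. v \<bullet> ((\<phi> z \<bullet> w) *\<^sub>R \<phi> z) \<partial>P)"
      unfolding u_def using int by (simp del: inner_scaleR_right)
    then show ?thesis by (simp add: inner_commute mult.commute)
  qed
  have le: "(v \<bullet> u)\<^sup>2 \<le> q w * q v" for v
    unfolding vu using q_Cauchy_Schwarz[of v w] by (simp add: mult.commute)
  \<comment> \<open>This gives u \<noteq> 0, and the bound \<open>le\<close> applied to u itself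
    then forces q u > 0.\<close>
  have "w \<bullet> u = q w" unfolding vu q_def by (simp add: power2_eq_square)
  then have "u \<noteq> 0" using w by auto
  then have "0 < (u \<bullet> u)\<^sup>2" by simp
  also have "\<dots> \<le> q w * q u" by (rule le)
  finally have "q u > 0" using w by (simp add: zero_less_mult_iff)
  with w le that show thesis by blast
qed

lemma inner_sum_char_tendsto:
  assumes I: "\<And>n. finite (I n)" "\<And>n. I n \<subseteq> {1..}" "\<And>n. card (I n) = n" and v: "q v > 0"
  shows "(\<lambda>n. char (distr M borel (\<lambda>w. (\<Sum>i\<in>I n. (\<phi> (Z i w) \<bullet> v) / sqrt (q v)) / sqrt n)) t) \<longlonglongrightarrow> exp (- (t\<^sup>2) / 2)"
proof -
  define f where "f z = (\<phi> z \<bullet> v) / sqrt (q v)" for z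
  have f[measurable]: "f \<in> borel_measurable P" unfolding f_def by measurable
  have f4: "integrable P (\<lambda>z. f z ^ 4)" using inner_power4(1)[of v] by (simp add: f_def power_divide)
  have f0: "(\<integral>z. f z \<partial>P) = 0" using inner_mean[of v] by (simp add: f_def)
  have f2: "(\<integral>z. (f z)\<^sup>2 \<partial>P) = 1" using v by (simp add: f_def power_divide q_def)
  define c where "c = \<bar>t\<bar> ^ 3 * (1 + (\<integral>z. f z ^ 4 \<partial>P)) + t ^ 4"
  have "\<forall>\<^sub>F n in sequentially. cmod (char (distr M borel (\<lambda>w. (\<Sum>i\<in>I n. f (Z i w)) / sqrt n)) t - exp (- (t\<^sup>2) / 2)) \<le> c / sqrt n"
    using eventually_gt_at_top[of 0]
    by eventually_elim (use iid_sum_char_bound[OF prob_M iid_sample_subset[OF prob_M Z I(2)] I(1) I(3) _ f f4 f0 f2] in \<open>simp add: c_def\<close>)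
  moreover have "(\<lambda>n. c / sqrt (real n)) \<longlonglongrightarrow> 0"
    by (intro tendsto_divide_0[OF tendsto_const] filterlim_at_top_imp_at_infinity filterlim_compose[OF sqrt_at_top filterlim_real_sequentially])
  ultimately have "(\<lambda>n. char (distr M borel (\<lambda>w. (\<Sum>i\<in>I n. f (Z i w)) / sqrt n)) t - exp (- (t\<^sup>2) / 2)) \<longlonglongrightarrow> 0"
    by (rule Lim_null_comparison)
  then show ?thesis by (simp add: f_def LIM_zero_iff)
qed

lemma q_V_anticoncentration:
  assumes \<eta>: "\<eta> > 0"
  obtains \<delta> where "\<delta> > 0" "\<forall>\<^sub>F n in sequentially. measure M {w\<in>space M. q (V n w) \<le> \<delta>} \<le> \<eta>"
proof -
  obtain u c where c: "c > 0" and u: "q u > 0" and le: "\<And>v. (v \<bullet> u)\<^sup>2 \<le> c * q v"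
    using exists_direction by metis
  define N where "N n w = (\<Sum>i\<in>{n+1..2*n}. (\<phi> (Z i w) \<bullet> u) / sqrt (q u)) / sqrt n" for n :: nat and w
  have N: "N n w = (V n w \<bullet> u) / sqrt (q u)" for n w
    by (simp add: N_def V_def inner_sum_left sum_divide_distrib mult.commute)
  have [measurable]: "N n \<in> borel_measurable M" for n unfolding N[abs_def] by measurable
  have "weak_conv_m (\<lambda>n. distr M borel (N n)) std_normal_distribution"
  proof (rule levy_continuity)
    show "real_distribution (distr M borel (N n))" for n by simp
    show "real_distribution std_normal_distribution" by (rule real_dist_normal_dist)
    show "(\<lambda>n. char (distr M borel (N n)) t) \<longlonglongrightarrow> char std_normal_distribution t" for t
      unfolding char_std_normal_distribution N_def[abs_def] using u
      by (intro inner_sum_char_tendsto) auto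
  qed
  then have conv: "(\<lambda>n. cdf (distr M borel (N n)) x) \<longlonglongrightarrow> cdf std_normal_distribution x"
    if "isCont (cdf std_normal_distribution) x" for x
    using that by (simp add: weak_conv_m_def weak_conv_def)
  obtain a where a: "a > 0" "cdf std_normal_distribution a - cdf std_normal_distribution (- a) < \<eta>"
    by (rule std_normal_small_ball[OF \<eta>])
  have "(\<lambda>n. cdf (distr M borel (N n)) a - cdf (distr M borel (N n)) (-a)) \<longlonglongrightarrow> cdf std_normal_distribution a - cdf std_normal_distribution (- a)"
    by (intro tendsto_diff conv isCont_cdf_std_normal)
  with a have "\<forall>\<^sub>F n in sequentially. cdf (distr M borel (N n)) a - cdf (distr M borel (N n)) (-a) < \<eta>"
    by (intro order_tendstoD(2)) auto
  \<comment> \<open>Chosen so that q (V n w) \<le> \<delta> forces |N n w| \<le> a / 2. Halving a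
    puts this closed interval inside the half-open one from -a to a that a difference of cdf values
    measures.\<close>
  moreover define \<delta> where "\<delta> = a\<^sup>2 * q u / (4 * c)"
  have \<delta>: "\<delta> > 0" using a u c by (simp add: \<delta>_def)
  have "measure M {w\<in>space M. q (V n w) \<le> \<delta>} \<le> cdf (distr M borel (N n)) a - cdf (distr M borel (N n)) (-a)" for n
  proof -
    interpret N: real_distribution "distr M borel (N n)" by simp
    have "{w\<in>space M. q (V n w) \<le> \<delta>} \<subseteq> N n -` {-a <.. a} \<inter> space M"
    proof
      fix w assume "w \<in> {w\<in>space M. q (V n w) \<le> \<delta>}"
      then have w: "w \<in> space M" "q (V n w) \<le> \<delta>" by auto
      have "(N n w)\<^sup>2 = (V n w \<bullet> u)\<^sup>2 / q u" using u by (simp add: N power_divide)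
      also have "\<dots> \<le> c * \<delta> / q u"
        using le[of "V n w"] w u c by (intro divide_right_mono order_trans[OF le] mult_left_mono) auto
      also have "\<dots> = (a/2)\<^sup>2" using u c by (simp add: \<delta>_def power_divide)
      finally have "\<bar>N n w\<bar> \<le> a/2" using a by (simp add: abs_le_square_iff[symmetric])
      then show "w \<in> N n -` {-a<..a} \<inter> space M" using a w by (auto simp: abs_le_iff)
    qed
    then have "measure M {w\<in>space M. q (V n w) \<le> \<delta>} \<le> measure M (N n -` {-a <.. a} \<inter> space M)"
      by (intro finite_measure_mono) auto
    also have "\<dots> = cdf (distr M borel (N n)) a - cdf (distr M borel (N n)) (-a)"
      using a by (subst N.cdf_diff_eq) (auto simp: measure_distr)
    finally show ?thesis .
  qed
  ultimately have "\<forall>\<^sub>F n in sequentially. measure M {w\<in>space M. q (V n w) \<le> \<delta>} \<le> \<eta>"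
    by (auto elim!: eventually_mono intro: order_trans less_imp_le)
  with \<delta> that show thesis by blast
qed

text \<open>The event on which the estimates are uniform: half sums bounded by K, limiting variance
  at least \<delta>. For suitable constants its asymptotic probability is as close to 1 as
  desired.\<close>

definition regular :: "real \<Rightarrow> real \<Rightarrow> nat \<Rightarrow> 'w \<Rightarrow> bool" where
  "regular K \<delta> n w \<longleftrightarrow> norm (U n w) \<le> K \<and> norm (V n w) \<le> K \<and> \<delta> \<le> q (V n w)"

lemma regular_tight:
  assumes \<eta>: "\<eta> > 0"
  obtains K \<delta> where "K > 0" "\<delta> > 0"
    "\<forall>\<^sub>F n in sequentially. fails_at_most M \<eta> (\<lambda>w. regular K \<delta> n w)"
proof -
  have e: "\<eta>/3 > 0" using \<eta> by simp
  obtain K1 where K1: "K1 > 0" "\<And>n. fails_at_most M (\<eta>/3) (\<lambda>w. norm (U n w) \<le> K1)"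
    using tight_of_second_moment[of U m2 "\<eta>/3", OF U_meas U_second_moment e] by blast
  obtain K2 where K2: "K2 > 0" "\<And>n. fails_at_most M (\<eta>/3) (\<lambda>w. norm (V n w) \<le> K2)"
    using tight_of_second_moment[of V m2 "\<eta>/3", OF V_meas V_second_moment e] by blast
  obtain \<delta> where \<delta>: "\<delta> > 0" "\<forall>\<^sub>F n in sequentially. measure M {w\<in>space M. q (V n w) \<le> \<delta>} \<le> \<eta>/3"
    by (rule q_V_anticoncentration[OF e])
  have "\<forall>\<^sub>F n in sequentially. fails_at_most M \<eta> (\<lambda>w. regular (max K1 K2) \<delta> n w)"
    using \<delta>(2)
  proof eventually_elim
    case (elim n)
    obtain B1 where B1: "B1\<in>sets M" "measure M B1 \<le> \<eta>/3" "\<forall>w\<in>space M - B1. norm (U n w) \<le> K1" using K1(2)[of n] by auto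
    obtain B2 where B2: "B2\<in>sets M" "measure M B2 \<le> \<eta>/3" "\<forall>w\<in>space M - B2. norm (V n w) \<le> K2" using K2(2)[of n] by auto
    define B3 where "B3 = {w\<in>space M. q (V n w) \<le> \<delta>}"
    have B3: "B3 \<in> sets M" unfolding B3_def by measurable
    have "measure M (B1 \<union> B2 \<union> B3) \<le> \<eta>"
      using measure_Un_le[of "B1 \<union> B2" M B3] measure_Un_le[of "B1" M B2] B1 B2 B3 elim by (auto simp: B3_def)
    then show ?case
      using B1 B2 B3 by (intro bexI[of _ "B1 \<union> B2 \<union> B3"]) (auto simp: regular_def B3_def le_max_iff_disj)
  qed
  moreover have "max K1 K2 > 0" using K1(1) by simp
  ultimately show thesis using \<delta>(1) that by blast
qed

lemma eventually_inprob_regular: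
  assumes "\<And>K \<delta>. K > 0 \<Longrightarrow> \<delta> > 0 \<Longrightarrow> \<forall>\<^sub>F (n, w) in inprob M. regular K \<delta> n w \<longrightarrow> A n w"
  shows "\<forall>\<^sub>F (n, w) in inprob M. A n w"
proof (rule eventually_inprob_tight)
  fix \<eta> :: real assume "\<eta> > 0"
  then obtain K \<delta> where "K > 0" "\<delta> > 0"
    "\<forall>\<^sub>F n in sequentially. fails_at_most M \<eta> (\<lambda>w. regular K \<delta> n w)"
    by (rule regular_tight)
  with assms show "\<exists>C. (\<forall>\<^sub>F n in sequentially.
      fails_at_most M \<eta> (\<lambda>w. C n w)) \<and>
      (\<forall>\<^sub>F (n, w) in inprob M. C n w \<longrightarrow> A n w)"
    by blast
qed

end

section \<open>Stability of a studentized ratio under perturbation\<close>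

lemma bounded_inner_tendsto_0:
  fixes f g :: "'a \<Rightarrow> 'h::real_inner"
  assumes f: "\<forall>\<^sub>F x in F. norm (f x) \<le> K" and g: "(g \<longlongrightarrow> 0) F"
  shows "((\<lambda>x. f x \<bullet> g x) \<longlongrightarrow> 0) F"
proof (rule Lim_null_comparison)
  show "((\<lambda>x. \<bar>K\<bar> * norm (g x)) \<longlongrightarrow> 0) F"
    using tendsto_mult_left[OF tendsto_norm_zero[OF g], of "\<bar>K\<bar>"] by simp
  show "\<forall>\<^sub>F x in F. norm (f x \<bullet> g x) \<le> \<bar>K\<bar> * norm (g x)"
    using f
  proof eventually_elim
    case (elim x)
    have "norm (f x \<bullet> g x) \<le> norm (f x) * norm (g x)"
      using Cauchy_Schwarz_ineq2[of "f x" "g x"] by simp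
    also have "\<dots> \<le> \<bar>K\<bar> * norm (g x)" using elim by (intro mult_right_mono) auto
    finally show ?case .
  qed
qed

lemma bounded_mult_tendsto_0:
  fixes f g :: "'a \<Rightarrow> real"
  assumes "\<forall>\<^sub>F x in F. \<bar>f x\<bar> \<le> K" and "(g \<longlongrightarrow> 0) F"
  shows "((\<lambda>x. f x * g x) \<longlongrightarrow> 0) F"
  using bounded_inner_tendsto_0[of f K F g] assms by simp

text \<open>The difference is (N' - N) / sqrt Q' + N (sqrt Q - sqrt Q') / (sqrt Q sqrt Q'). Since Q'
  is eventually at least \<delta> / 2, both reciprocals are bounded, and |sqrt Q - sqrt Q'| \<le> |Q
  - Q'| / sqrt \<delta>.\<close>

lemma studentization_tendsto:
  fixes N N' Q Q' :: "'a \<Rightarrow> real"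
  assumes N: "((\<lambda>x. N' x - N x) \<longlongrightarrow> 0) F" and Q: "((\<lambda>x. Q' x - Q x) \<longlongrightarrow> 0) F"
    and K: "\<forall>\<^sub>F x in F. \<bar>N x\<bar> \<le> K" and \<delta>: "\<delta> > 0" "\<forall>\<^sub>F x in F. \<delta> \<le> Q x"
  shows "((\<lambda>x. N' x / sqrt (Q' x) - N x / sqrt (Q x)) \<longlongrightarrow> 0) F"
proof -
  define c where "c = 1 / sqrt (\<delta>/2)"
  have ev: "\<forall>\<^sub>F x in F. \<delta>/2 \<le> Q' x"
    using tendstoD[OF Q half_gt_zero[OF \<delta>(1)]] \<delta>(2)
    by eventually_elim (auto simp: dist_real_def abs_if split: if_splits)
  have inv: "\<bar>1 / sqrt y\<bar> \<le> c" if "\<delta>/2 \<le> y" for y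
  proof -
    have "sqrt (\<delta>/2) \<le> sqrt y" "0 < sqrt (\<delta>/2)" using that \<delta>(1) by auto
    then show ?thesis unfolding c_def by (auto intro!: divide_left_mono mult_pos_pos)
  qed
  have bQ': "\<forall>\<^sub>F x in F. \<bar>1 / sqrt (Q' x)\<bar> \<le> c" using ev by eventually_elim (rule inv)
  have bQ: "\<forall>\<^sub>F x in F. \<bar>1 / sqrt (Q x)\<bar> \<le> c" using \<delta>(2) by eventually_elim (rule inv, use \<delta>(1) in simp)
  have sq: "((\<lambda>x. sqrt (Q x) - sqrt (Q' x)) \<longlongrightarrow> 0) F"
  proof (rule Lim_null_comparison)
    show "((\<lambda>x. \<bar>Q' x - Q x\<bar> / sqrt \<delta>) \<longlongrightarrow> 0) F"
      using tendsto_divide[OF tendsto_rabs[OF Q] tendsto_const, of "sqrt \<delta>"] \<delta>(1) by simp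
    show "\<forall>\<^sub>F x in F. norm (sqrt (Q x) - sqrt (Q' x)) \<le> \<bar>Q' x - Q x\<bar> / sqrt \<delta>"
      using ev \<delta>(2)
    proof eventually_elim
      case (elim x)
      then have pos: "Q' x \<ge> 0" "Q x \<ge> 0" using \<delta>(1) by auto
      have "sqrt \<delta> \<le> sqrt (Q x)" using elim by simp
      then have "\<bar>sqrt (Q x) - sqrt (Q' x)\<bar> * sqrt \<delta> \<le> \<bar>sqrt (Q x) - sqrt (Q' x)\<bar> * (sqrt (Q x) + sqrt (Q' x))"
        using pos by (intro mult_left_mono) (auto intro: add_increasing2)
      also have "\<dots> = \<bar>(sqrt (Q x) - sqrt (Q' x)) * (sqrt (Q x) + sqrt (Q' x))\<bar>"
        using pos by (simp add: abs_mult)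
      also have "(sqrt (Q x) - sqrt (Q' x)) * (sqrt (Q x) + sqrt (Q' x)) = Q x - Q' x"
        using pos by (simp add: algebra_simps)
      finally show ?case using \<delta>(1) by (simp add: field_simps abs_minus_commute)
    qed
  qed
  have "((\<lambda>x. 1 / sqrt (Q' x) * (N' x - N x) + N x * (1 / sqrt (Q' x) * (1 / sqrt (Q x) * (sqrt (Q x) - sqrt (Q' x))))) \<longlongrightarrow> 0 + 0) F"
    by (rule tendsto_add bounded_mult_tendsto_0[OF bQ' N] bounded_mult_tendsto_0[OF K]
        bounded_mult_tendsto_0[OF bQ'] bounded_mult_tendsto_0[OF bQ sq])+
  moreover have "\<forall>\<^sub>F x in F. 1 / sqrt (Q' x) * (N' x - N x) + N x * (1 / sqrt (Q' x) * (1 / sqrt (Q x) * (sqrt (Q x) - sqrt (Q' x)))) =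
      N' x / sqrt (Q' x) - N x / sqrt (Q x)"
    using ev \<delta>(2)
  proof eventually_elim
    case (elim x)
    then have "sqrt (Q x) \<noteq> 0" "sqrt (Q' x) \<noteq> 0" using \<delta>(1) by auto
    then show ?case by (simp add: field_simps)
  qed
  ultimately show ?thesis unfolding add_0 by (rule Lim_transform_eventually)
qed

lemma mean_square_perturb:
  fixes d e :: "'i \<Rightarrow> real"
  assumes "finite I"
  shows "\<bar>(\<Sum>i\<in>I. (e i + d i)\<^sup>2) - (\<Sum>i\<in>I. (e i)\<^sup>2)\<bar> \<le> (\<Sum>i\<in>I. (d i)\<^sup>2) + 2 * sqrt ((\<Sum>i\<in>I. (d i)\<^sup>2) * (\<Sum>i\<in>I. (e i)\<^sup>2))"
proof -
  have "(\<Sum>i\<in>I. (e i + d i)\<^sup>2) - (\<Sum>i\<in>I. (e i)\<^sup>2) = (\<Sum>i\<in>I. (d i)\<^sup>2) + 2 * (\<Sum>i\<in>I. e i * d i)"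
    by (simp add: power2_sum sum.distrib sum_distrib_left algebra_simps)
  moreover have "\<bar>\<Sum>i\<in>I. e i * d i\<bar> \<le> sqrt ((\<Sum>i\<in>I. (d i)\<^sup>2) * (\<Sum>i\<in>I. (e i)\<^sup>2))"
    using Cauchy_Schwarz_ineq_sum[of e d I] by (intro real_le_rsqrt) (simp add: mult.commute)
  moreover have "0 \<le> (\<Sum>i\<in>I. (d i)\<^sup>2)" by (intro sum_nonneg) auto
  ultimately show ?thesis by linarith
qed

context two_sample
begin

text \<open>Localization: along the restricted filter, \<open>regular K \<delta>\<close> holds
  eventually, so K and \<delta> serve as constants in ordinary limit arguments.\<close>

lemma tendsto_inprob_regular:
  fixes X :: "nat \<Rightarrow> 'w \<Rightarrow> 'b::metric_space"
  assumes "\<And>K \<delta>. K > 0 \<Longrightarrow> \<delta> > 0 \<Longrightarrow> ((\<lambda>(n, w). X n w) \<longlongrightarrow> l) (inf (inprob M) (principal {(n, w). regular K \<delta> n w}))"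
  shows "((\<lambda>(n, w). X n w) \<longlongrightarrow> l) (inprob M)"
proof (rule tendstoI)
  fix e :: real assume e: "e > 0"
  have "\<forall>\<^sub>F (n, w) in inprob M. dist (X n w) l < e"
  proof (rule eventually_inprob_regular)
    fix K \<delta> :: real assume "K > 0" "\<delta> > 0"
    from tendstoD[OF assms[OF this] e]
    show "\<forall>\<^sub>F (n, w) in inprob M. regular K \<delta> n w \<longrightarrow> dist (X n w) l < e"
      by (simp add: eventually_inf_principal case_prod_unfold)
  qed
  then show "\<forall>\<^sub>F x in inprob M. dist (case x of (n, w) \<Rightarrow> X n w) l < e"
    by (simp add: case_prod_unfold)
qed

lemma tendsto_enn_imp_real:
  assumes "((\<lambda>(n, w). ennreal ((X n w)\<^sup>2)) \<longlongrightarrow> 0) F"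
  shows "((\<lambda>(n, w). X n w :: real) \<longlongrightarrow> 0) F"
proof -
  have "((\<lambda>x. (X (fst x) (snd x))\<^sup>2) \<longlongrightarrow> 0) F"
    using assms by (subst tendsto_ennreal_iff[symmetric]) (auto simp: case_prod_unfold)
  then show ?thesis
    using tendsto_real_sqrt[of "\<lambda>x. (X (fst x) (snd x))\<^sup>2" 0 F] by (simp add: case_prod_unfold tendsto_rabs_zero_iff)
qed

lemma lln_norm_sq:
  "((\<lambda>(n, w). (1 / n) * (\<Sum>i\<in>{1..n}. (norm (\<phi> (Z i w)))\<^sup>2) - m2) \<longlongrightarrow> 0) (inprob M)"
proof (rule tendsto_enn_imp_real, rule inprob_Markov)
  show "(\<lambda>w. ennreal (((1 / n) * (\<Sum>i\<in>{1..n}. (norm (\<phi> (Z i w)))\<^sup>2) - m2)\<^sup>2)) \<in> borel_measurable M" for n :: nat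
    by measurable
  have h2: "integrable P (\<lambda>z. (norm ((norm (\<phi> z))\<^sup>2))\<^sup>2)" using \<phi>4 by (simp add: power_mult[symmetric])
  have le: "(\<integral>\<^sup>+w. ennreal (((1 / n) * (\<Sum>i\<in>{1..n}. (norm (\<phi> (Z i w)))\<^sup>2) - m2)\<^sup>2) \<partial>M) \<le> ennreal (m4 / n)"
    if n: "n > 0" for n :: nat
  proof -
    note * = iid_second_moment[OF prob_M iid_sample_subset[OF prob_M Z, of "{1..n}"] _ _ h2, simplified]
    have eq: "((1 / n) * (\<Sum>i\<in>{1..n}. (norm (\<phi> (Z i w)))\<^sup>2) - m2)\<^sup>2 = (1 / n)\<^sup>2 * (\<Sum>i\<in>{1..n}. (norm (\<phi> (Z i w)))\<^sup>2 - m2)\<^sup>2" for w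
      using n by (simp add: sum_subtractf power_mult_distrib[symmetric] field_simps)
    have "(\<integral>w. ((1 / n) * (\<Sum>i\<in>{1..n}. (norm (\<phi> (Z i w)))\<^sup>2) - m2)\<^sup>2 \<partial>M) \<le> (1 / n)\<^sup>2 * (n * m4)"
      unfolding eq using *(2) by (simp add: m2_def m4_def power_mult[symmetric] mult_left_mono divide_right_mono)
    also have "\<dots> = m4 / n" using n by (simp add: power2_eq_square field_simps)
    finally show ?thesis
      unfolding eq using *(1) by (subst nn_integral_eq_integral) (auto simp: m2_def ennreal_leI)
  qed
  have lim: "(\<lambda>n. ennreal (m4 / real n)) \<longlonglongrightarrow> 0"
    unfolding ennreal_0[symmetric]
    by (intro tendsto_ennrealI tendsto_divide_0[OF tendsto_const] filterlim_at_top_imp_at_infinity filterlim_real_sequentially)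
  show "(\<lambda>n. \<integral>\<^sup>+w. ennreal (((1 / n) * (\<Sum>i\<in>{1..n}. (norm (\<phi> (Z i w)))\<^sup>2) - m2)\<^sup>2) \<partial>M) \<longlonglongrightarrow> 0"
  proof (rule tendsto_sandwich[OF _ _ tendsto_const lim])
    show "\<forall>\<^sub>F n in sequentially. (\<integral>\<^sup>+w. ennreal (((1 / n) * (\<Sum>i\<in>{1..n}. (norm (\<phi> (Z i w)))\<^sup>2) - m2)\<^sup>2) \<partial>M) \<le> ennreal (m4 / real n)"
      using eventually_gt_at_top[of 0] by eventually_elim (rule le)
  qed simp
qed

text \<open>The direction \<open>V\<close> is random but independent of the first block. Chebyshev's
  inequality for fixed v has variance bound \<parallel>v\<parallel>^4 * m4 / n, and the conditional
  Markov inequality carries it over to v = V.\<close>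

lemma lln_quadratic_form:
  "((\<lambda>(n, w). (1 / n) * (\<Sum>i\<in>{1..n}. (\<phi> (Z i w) \<bullet> V n w)\<^sup>2) - q (V n w)) \<longlongrightarrow> 0) (inprob M)"
proof (rule tendsto_enn_imp_real)
  define K where "K n = (\<lambda>(v, d). ennreal (((1 / real n) * (\<Sum>i\<in>{1..n}. (\<phi> (d i) \<bullet> v)\<^sup>2) - q v)\<^sup>2))" for n :: nat
  have K: "K n \<in> borel_measurable (borel \<Otimes>\<^sub>M PiM {1..n} (\<lambda>_. P))" for n
    unfolding K_def by measurable
  have bound: "(\<integral>\<^sup>+w'. K n (v, \<lambda>i\<in>{1..n}. Z i w') \<partial>M) \<le> ennreal (norm v ^ 4 * m4 / n)" if n: "n > 0" for n v
  proof -
    have h2: "integrable P (\<lambda>z. (norm ((\<phi> z \<bullet> v)\<^sup>2))\<^sup>2)" using inner_power4(1)[of v] by (simp add: power_mult[symmetric])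
    note * = iid_second_moment[OF prob_M iid_sample_subset[OF prob_M Z, of "{1..n}"] _ _ h2, simplified]
    have eq: "((1 / n) * (\<Sum>i\<in>{1..n}. (\<phi> (Z i w) \<bullet> v)\<^sup>2) - q v)\<^sup>2 = (1 / n)\<^sup>2 * (\<Sum>i\<in>{1..n}. (\<phi> (Z i w) \<bullet> v)\<^sup>2 - q v)\<^sup>2" for w
      using n by (simp add: sum_subtractf power_mult_distrib[symmetric] field_simps)
    have "(\<integral>w. (\<Sum>i\<in>{1..n}. (\<phi> (Z i w) \<bullet> v)\<^sup>2 - q v)\<^sup>2 \<partial>M) \<le> n * (norm v ^ 4 * m4)"
      using order_trans[OF *(2) mult_left_mono[of "(\<integral>z. (\<phi> z \<bullet> v) ^ 4 \<partial>P)" "norm v ^ 4 * m4" "real n"]] inner_power4(2)[of v]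
      by (simp add: q_def)
    then have "(1 / n)\<^sup>2 * (\<integral>w. (\<Sum>i\<in>{1..n}. (\<phi> (Z i w) \<bullet> v)\<^sup>2 - q v)\<^sup>2 \<partial>M) \<le> (1 / n)\<^sup>2 * (n * (norm v ^ 4 * m4))"
      by (intro mult_left_mono) auto
    also have "\<dots> = norm v ^ 4 * m4 / n" using n by (simp add: power2_eq_square field_simps)
    finally have "(\<integral>w. (1 / n)\<^sup>2 * (\<Sum>i\<in>{1..n}. (\<phi> (Z i w) \<bullet> v)\<^sup>2 - q v)\<^sup>2 \<partial>M) \<le> norm v ^ 4 * m4 / n" by simp
    moreover have "(\<integral>\<^sup>+w'. K n (v, \<lambda>i\<in>{1..n}. Z i w') \<partial>M) = (\<integral>\<^sup>+w. ennreal ((1 / n)\<^sup>2 * (\<Sum>i\<in>{1..n}. (\<phi> (Z i w) \<bullet> v)\<^sup>2 - q v)\<^sup>2) \<partial>M)"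
    proof (intro nn_integral_cong)
      fix w
      have "K n (v, \<lambda>i\<in>{1..n}. Z i w) = ennreal (((1 / n) * (\<Sum>i\<in>{1..n}. (\<phi> (Z i w) \<bullet> v)\<^sup>2) - q v)\<^sup>2)"
        by (simp add: K_def)
      then show "K n (v, \<lambda>i\<in>{1..n}. Z i w) = ennreal ((1 / n)\<^sup>2 * (\<Sum>i\<in>{1..n}. (\<phi> (Z i w) \<bullet> v)\<^sup>2 - q v)\<^sup>2)"
        unfolding eq .
    qed
    ultimately show ?thesis
      using *(1) by (subst (asm) nn_integral_eq_integral) (auto simp: q_def intro!: ennreal_leI)
  qed
  have "((\<lambda>(n, w). K n (V n w, \<lambda>i\<in>{1..n}. Z i w)) \<longlongrightarrow> 0) (inprob M)"
  proof (rule inprob_conditional_Markov[OF V_independent K])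
    show "((\<lambda>(n, w). \<integral>\<^sup>+w'. K n (V n w, \<lambda>i\<in>{1..n}. Z i w') \<partial>M) \<longlongrightarrow> 0) (inprob M)"
    proof (rule ennreal_tendsto_0I)
      fix e :: real assume e: "e > 0"
      have "\<forall>\<^sub>F (n, w) in inprob M. (\<integral>\<^sup>+w'. K n (V n w, \<lambda>i\<in>{1..n}. Z i w') \<partial>M) \<le> ennreal e"
      proof (rule eventually_inprob_regular)
        fix C \<delta> :: real assume C: "C > 0"
        have "(\<lambda>n. C ^ 4 * m4 / real n) \<longlonglongrightarrow> 0"
          by (intro tendsto_divide_0[OF tendsto_const] filterlim_at_top_imp_at_infinity filterlim_real_sequentially)
        then have "\<forall>\<^sub>F n in sequentially. C ^ 4 * m4 / real n < e \<and> n > 0"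
          using e by (auto intro!: eventually_conj order_tendstoD(2) eventually_gt_at_top)
        from inprob_sequentially[OF this]
        show "\<forall>\<^sub>F (n, w) in inprob M. regular C \<delta> n w \<longrightarrow> (\<integral>\<^sup>+w'. K n (V n w, \<lambda>i\<in>{1..n}. Z i w') \<partial>M) \<le> ennreal e"
        proof (eventually_elim, clarify)
          fix n w assume n: "C ^ 4 * m4 / real n < e" "n > 0" and r: "regular C \<delta> n w"
          have "norm (V n w) ^ 4 * m4 / n \<le> C ^ 4 * m4 / n"
            using r m4_nonneg by (intro divide_right_mono mult_right_mono power_mono) (auto simp: regular_def)
          also note n(1)
          finally have "ennreal (norm (V n w) ^ 4 * m4 / n) \<le> ennreal e" by (intro ennreal_leI) simp
          then show "(\<integral>\<^sup>+w'. K n (V n w, \<lambda>i\<in>{1..n}. Z i w') \<partial>M) \<le> ennreal e"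
            using bound[OF n(2), of "V n w"] by (rule order_trans[rotated])
        qed
      qed
      then show "\<forall>\<^sub>F x in inprob M. (case x of (n, w) \<Rightarrow> \<integral>\<^sup>+w'. K n (V n w, \<lambda>i\<in>{1..n}. Z i w') \<partial>M) \<le> ennreal e"
        by (simp add: case_prod_unfold)
    qed
  qed
  then show "((\<lambda>(n, w). ennreal (((1 / n) * (\<Sum>i\<in>{1..n}. (\<phi> (Z i w) \<bullet> V n w)\<^sup>2) - q (V n w))\<^sup>2)) \<longlongrightarrow> 0) (inprob M)"
    by (simp add: K_def)
qed

text \<open>The conditional characteristic function \<open>\<psi> n v\<close> given V = v is close
  to the normal one for all regular v. The limit does not depend on v, so averaging over
  \<open>V\<close> by bounded convergence preserves it.\<close>

lemma oracle_char:
  "(\<lambda>n. char (distr M borel (\<lambda>w. (U n w \<bullet> V n w) / sqrt (q (V n w)))) t) \<longlonglongrightarrow> exp (- (t\<^sup>2) / 2)"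
proof -
  define \<psi> where "\<psi> n v = (\<integral>w. iexp (t * ((U n w \<bullet> v) / sqrt (q v))) \<partial>M)" for n v
  have char_eq: "char (distr M borel (\<lambda>w. (U n w \<bullet> V n w) / sqrt (q (V n w)))) t = (\<integral>w. \<psi> n (V n w) \<partial>M)" for n
  proof -
    have "char (distr M borel (\<lambda>w. (U n w \<bullet> V n w) / sqrt (q (V n w)))) t = (\<integral>w. iexp (t * ((U n w \<bullet> V n w) / sqrt (q (V n w)))) \<partial>M)"
      unfolding char_def by (subst integral_distr) auto
    also have "\<dots> = (\<integral>w. \<psi> n (V n w) \<partial>M)"
    proof -
      define \<kappa> where "\<kappa> = (\<lambda>(v, u). iexp (t * ((u \<bullet> v) / sqrt (q v))))"
      have \<kappa>[measurable]: "\<kappa> \<in> borel_measurable (borel \<Otimes>\<^sub>M borel)"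
        unfolding \<kappa>_def by measurable
      have "norm (\<kappa> x) \<le> 1" for x by (cases x) (simp only: \<kappa>_def split_conv norm_exp_i_times order_refl)
      then have "integrable M (\<lambda>w. \<kappa> (V n w, U n w))"
        by (intro integrable_const_bound[of _ 1] always_eventually allI) measurable
      note integral_decouple[OF UV_independent \<kappa> this]
      then show ?thesis by (simp only: \<psi>_def \<kappa>_def split_conv)
    qed
    finally show ?thesis .
  qed
  have \<psi>_meas[measurable]: "\<psi> n \<in> borel_measurable borel" for n
    unfolding \<psi>_def by measurable
  have \<psi>_bound: "norm (\<psi> n v) \<le> 1" for n v
  proof -
    have "norm (\<psi> n v) \<le> (\<integral>w. norm (iexp (t * ((U n w \<bullet> v) / sqrt (q v)))) \<partial>M)"
      unfolding \<psi>_def by (rule integral_norm_bound)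
    then show ?thesis by (simp add: prob_space)
  qed
  have "((\<lambda>(n, w). \<psi> n (V n w) - exp (- (t\<^sup>2) / 2)) \<longlongrightarrow> 0) (inprob M)"
  proof (rule tendsto_inprob_regular)
    fix K \<delta> :: real assume K: "K > 0" and \<delta>: "\<delta> > 0"
    \<comment> \<open>On the regular event the projection normalized by sqrt (q v) has fourth moment
      at most K^4 * m4 / \<delta>^2, so c serves for all such v.\<close>
    define c where "c = \<bar>t\<bar> ^ 3 * (1 + K ^ 4 * m4 / \<delta>\<^sup>2) + t ^ 4"
    have bound: "norm (\<psi> n (V n w) - exp (- (t\<^sup>2) / 2)) \<le> c / sqrt n" if n: "n > 0" and r: "regular K \<delta> n w" for n w
    proof -
      define v where "v = V n w"
      have v: "q v \<ge> \<delta>" "norm v \<le> K" using r by (auto simp: regular_def v_def)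
      then have qv: "q v > 0" using \<delta> by simp
      define f where "f z = (\<phi> z \<bullet> v) / sqrt (q v)" for z
      have f[measurable]: "f \<in> borel_measurable P" unfolding f_def by measurable
      have f4: "integrable P (\<lambda>z. f z ^ 4)" using inner_power4(1)[of v] by (simp add: f_def power_divide)
      have f0: "(\<integral>z. f z \<partial>P) = 0" using inner_mean[of v] by (simp add: f_def)
      have f2: "(\<integral>z. (f z)\<^sup>2 \<partial>P) = 1" using qv by (simp add: f_def power_divide q_def)
      have sq4: "sqrt (q v) ^ 4 = (q v)\<^sup>2"
        using qv by (simp add: power4_eq_xxxx power2_eq_square mult.assoc)
      have "(\<integral>z. f z ^ 4 \<partial>P) = (\<integral>z. (\<phi> z \<bullet> v) ^ 4 \<partial>P) / (q v)\<^sup>2"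
        by (simp add: f_def power_divide sq4)
      also have "\<dots> \<le> K ^ 4 * m4 / \<delta>\<^sup>2"
      proof (rule frac_le)
        have "norm v ^ 4 * m4 \<le> K ^ 4 * m4" using v m4_nonneg by (intro mult_right_mono power_mono) auto
        then show "(\<integral>z. (\<phi> z \<bullet> v) ^ 4 \<partial>P) \<le> K ^ 4 * m4" using inner_power4(2)[of v] by simp
        show "\<delta>\<^sup>2 \<le> (q v)\<^sup>2" using v \<delta> by (intro power_mono) auto
      qed (use \<delta> K m4_nonneg in auto)
      finally have f4': "(\<integral>z. f z ^ 4 \<partial>P) \<le> K ^ 4 * m4 / \<delta>\<^sup>2" .
      have "\<psi> n v = char (distr M borel (\<lambda>w. (\<Sum>i\<in>{1..n}. f (Z i w)) / sqrt n)) t"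
      proof -
        have [measurable]: "(\<lambda>w. (\<Sum>i\<in>{1..n}. f (Z i w)) / sqrt n) \<in> borel_measurable M"
          by (intro borel_measurable_divide borel_measurable_sum borel_measurable_const) auto
        have "(U n w \<bullet> v) / sqrt (q v) = (\<Sum>i\<in>{1..n}. f (Z i w)) / sqrt n" for w
          by (simp add: f_def U_def inner_sum_left sum_divide_distrib mult.commute)
        then show ?thesis unfolding \<psi>_def char_def by (subst integral_distr) auto
      qed
      also have "cmod (\<dots> - exp (- (t\<^sup>2) / 2)) \<le> (\<bar>t\<bar> ^ 3 * (1 + (\<integral>z. f z ^ 4 \<partial>P)) + t ^ 4) / sqrt n"
        by (rule iid_sum_char_bound[OF prob_M iid_sample_subset[OF prob_M Z] _ _ n f f4 f0 f2]) auto
      also have "\<dots> \<le> c / sqrt n"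
        unfolding c_def using f4' by (intro divide_right_mono add_mono mult_left_mono) auto
      finally show ?thesis by (simp add: v_def)
    qed
    let ?F = "inf (inprob M) (principal {(n, w). regular K \<delta> n w})"
    have c0: "((\<lambda>(n, w). c / sqrt (real n)) \<longlongrightarrow> 0) ?F"
    proof (rule tendsto_mono[OF inf_le1 inprob_tendsto_const])
      show "(\<lambda>n. c / sqrt (real n)) \<longlonglongrightarrow> 0"
        by (intro tendsto_divide_0[OF tendsto_const] filterlim_at_top_imp_at_infinity filterlim_compose[OF sqrt_at_top filterlim_real_sequentially])
    qed
    show "((\<lambda>(n, w). \<psi> n (V n w) - exp (- (t\<^sup>2) / 2)) \<longlongrightarrow> 0) ?F"
    proof (rule Lim_null_comparison[OF _ c0])
      show "\<forall>\<^sub>F x in ?F. norm (case x of (n, w) \<Rightarrow> \<psi> n (V n w) - exp (- (t\<^sup>2) / 2)) \<le> (case x of (n, w) \<Rightarrow> c / sqrt (real n))"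
        unfolding eventually_inf_principal
        using inprob_sequentially[OF eventually_gt_at_top[of 0]]
        by eventually_elim (use bound in auto)
    qed
  qed
  then have "(\<lambda>n. \<integral>w. \<psi> n (V n w) - exp (- (t\<^sup>2) / 2) \<partial>M) \<longlonglongrightarrow> 0"
  proof (rule inprob_bounded_convergence[rotated 2])
    show "norm (\<psi> n (V n w) - complex_of_real (exp (- (t\<^sup>2) / 2))) \<le> 2" for n w
    proof -
      have "exp (- (t\<^sup>2) / 2) \<le> 1" by simp
      then show ?thesis
        using norm_triangle_ineq4[of "\<psi> n (V n w)" "complex_of_real (exp (- (t\<^sup>2) / 2))"] \<psi>_bound[of n "V n w"]
        by (simp only: norm_of_real abs_exp_cancel)
    qed
  qed measurable
  moreover have "(\<integral>w. \<psi> n (V n w) - exp (- (t\<^sup>2) / 2) \<partial>M) = (\<integral>w. \<psi> n (V n w) \<partial>M) - exp (- (t\<^sup>2) / 2)" for n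
  proof -
    have "integrable M (\<lambda>w. \<psi> n (V n w))"
      by (rule integrable_const_bound[of _ 1]) (use \<psi>_bound in auto)
    then show ?thesis by (simp add: prob_space)
  qed
  ultimately show ?thesis by (simp add: char_eq LIM_zero_iff)
qed

end

section \<open>The studentized statistic\<close>

text \<open>Each \<open>f_dagger\<close> value is g1 (z i) \<bullet> b / sqrt n, so the squared
  \<open>S_dagger\<close> is a mean square minus a squared mean, and the powers of n cancel in the
  ratio. What is subtracted under the root is (a \<bullet> b)^2 / n, which is negligible.\<close>

lemma T_dagger_eq:
  fixes g1 g2 :: "'z \<Rightarrow> 'h::real_inner" and z :: "nat \<Rightarrow> 'z" and n :: nat
  assumes n: "n > 0"
  defines "a \<equiv> (1 / sqrt n) *\<^sub>R (\<Sum>i\<in>{1..n}. g1 (z i))"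
    and "b \<equiv> (1 / sqrt n) *\<^sub>R (\<Sum>i\<in>{n+1..2*n}. g2 (z i))"
  shows "T_dagger n g1 g2 z = (a \<bullet> b) / sqrt ((1 / n) * (\<Sum>i\<in>{1..n}. (g1 (z i) \<bullet> b)\<^sup>2) - (a \<bullet> b)\<^sup>2 * (1 / n))"
proof -
  define s where "s = sqrt (real n)"
  have s: "s > 0" "real n = s * s" using n by (auto simp: s_def)
  define c where "c = (\<lambda>i. g1 (z i) \<bullet> b)"
  have f: "f_dagger n g1 g2 z i = c i / s" for i
    using s unfolding c_def f_dagger_def b_def s_def[symmetric] by (simp add: inner_sum_right[symmetric] field_simps)
  have fb: "f_bar n g1 g2 z = (a \<bullet> b) / n"
    using s unfolding f_bar_def f c_def a_def s_def[symmetric] by (simp add: inner_sum_left sum_divide_distrib[symmetric] field_simps)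
  have sc: "(\<Sum>i = 1..n. c i) = s * (a \<bullet> b)"
    using s by (simp add: c_def a_def s_def[symmetric] inner_sum_left)
  have "(\<Sum>i = 1..n. (f_dagger n g1 g2 z i - f_bar n g1 g2 z)\<^sup>2) =
      (\<Sum>i = 1..n. (c i)\<^sup>2 / n - 2 * (a \<bullet> b) / (n * s) * c i + ((a \<bullet> b) / n)\<^sup>2)"
    using s unfolding f fb
    by (intro sum.cong refl) (simp add: power2_diff power_divide power2_eq_square[of s] field_simps)
  also have "\<dots> = (\<Sum>i = 1..n. (c i)\<^sup>2) / n - 2 * (a \<bullet> b) / (n * s) * (\<Sum>i = 1..n. c i) + n * ((a \<bullet> b) / n)\<^sup>2"
    by (simp add: sum.distrib sum_subtractf sum_distrib_left sum_divide_distrib)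
  also have "\<dots> = (\<Sum>i = 1..n. (c i)\<^sup>2) / n - (a \<bullet> b)\<^sup>2 / n"
    unfolding sc using s n by (simp add: power2_eq_square field_simps)
  finally have "S_dagger n g1 g2 z = sqrt ((1 / n) * ((1 / n) * (\<Sum>i = 1..n. (c i)\<^sup>2) - (a \<bullet> b)\<^sup>2 * (1 / n)))"
    unfolding S_dagger_def by (simp add: field_simps)
  also have "\<dots> = sqrt ((1 / n) * (\<Sum>i = 1..n. (c i)\<^sup>2) - (a \<bullet> b)\<^sup>2 * (1 / n)) / s"
    by (simp add: real_sqrt_mult real_sqrt_divide s_def)
  finally have S: "S_dagger n g1 g2 z = sqrt ((1 / n) * (\<Sum>i = 1..n. (c i)\<^sup>2) - (a \<bullet> b)\<^sup>2 * (1 / n)) / s" .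
  show ?thesis
    unfolding T_dagger_def S fb using s by (simp add: c_def s_def[symmetric] field_simps)
qed

lemma T_dagger_measurable:
  fixes g1 g2 :: "'w \<Rightarrow> 'z \<Rightarrow> 'h::{real_inner, second_countable_topology}"
  assumes Z: "\<And>i. 1 \<le> i \<Longrightarrow> Z i \<in> measurable M P"
    and g: "(\<lambda>(w, z). g1 w z) \<in> borel_measurable (M \<Otimes>\<^sub>M P)" "(\<lambda>(w, z). g2 w z) \<in> borel_measurable (M \<Otimes>\<^sub>M P)"
  shows "(\<lambda>w. T_dagger n (g1 w) (g2 w) (\<lambda>i. Z i w)) \<in> borel_measurable M"
proof -
  have m[measurable]: "(\<lambda>w. g1 w (Z i w)) \<in> borel_measurable M" "(\<lambda>w. g2 w (Z i w)) \<in> borel_measurable M" if "1 \<le> i" for i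
    using measurable_compose[OF measurable_Pair[OF measurable_ident_sets[OF refl] Z[OF that]] g(1)]
      measurable_compose[OF measurable_Pair[OF measurable_ident_sets[OF refl] Z[OF that]] g(2)] by simp_all
  have f: "(\<lambda>w. f_dagger n (g1 w) (g2 w) (\<lambda>i. Z i w) i) \<in> borel_measurable M" if "1 \<le> i" for i
    unfolding f_dagger_def using that
    by (intro borel_measurable_times borel_measurable_const borel_measurable_sum borel_measurable_inner m) auto
  have fb: "(\<lambda>w. f_bar n (g1 w) (g2 w) (\<lambda>i. Z i w)) \<in> borel_measurable M"
    unfolding f_bar_def by (intro borel_measurable_times borel_measurable_const borel_measurable_sum f) auto
  have S: "(\<lambda>w. S_dagger n (g1 w) (g2 w) (\<lambda>i. Z i w)) \<in> borel_measurable M"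
    unfolding S_dagger_def
    by (rule measurable_compose[OF _ borel_measurable_sqrt], intro borel_measurable_times borel_measurable_const borel_measurable_sum borel_measurable_power borel_measurable_diff f fb) auto
  show ?thesis
    unfolding T_dagger_def by (intro borel_measurable_times borel_measurable_const borel_measurable_divide fb S)
qed

context two_sample
begin

text \<open>The errors of the estimates enter only through scaled sums and a mean square, whichever
  way the estimates are built. The mean square concerns the first half: the variance estimate runs
  over its points, while the second half enters through \<open>b\<close> alone.\<close>

theorem studentized_clt:
  fixes g1 g2 :: "nat \<Rightarrow> 'w \<Rightarrow> 'z \<Rightarrow> 'h"
  assumes g1: "\<And>n. (\<lambda>(w, z). g1 n w z) \<in> borel_measurable (M \<Otimes>\<^sub>M P)"
    and g2: "\<And>n. (\<lambda>(w, z). g2 n w z) \<in> borel_measurable (M \<Otimes>\<^sub>M P)"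
    and mean1: "((\<lambda>(n, w). (1 / sqrt n) *\<^sub>R (\<Sum>i\<in>{1..n}. g1 n w (Z i w) - \<phi> (Z i w))) \<longlongrightarrow> 0) (inprob M)"
    and mean2: "((\<lambda>(n, w). (1 / sqrt n) *\<^sub>R (\<Sum>i\<in>{n+1..2*n}. g2 n w (Z i w) - \<phi> (Z i w))) \<longlongrightarrow> 0) (inprob M)"
    and sq1: "((\<lambda>(n, w). (1 / n) * (\<Sum>i\<in>{1..n}. (norm (g1 n w (Z i w) - \<phi> (Z i w)))\<^sup>2)) \<longlongrightarrow> 0) (inprob M)"
  shows "weak_conv_m (\<lambda>n. distr M borel (\<lambda>w. T_dagger n (g1 n w) (g2 n w) (\<lambda>i. Z i w))) std_normal_distribution"
proof -
  define T where "T n w = T_dagger n (g1 n w) (g2 n w) (\<lambda>i. Z i w)" for n w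
  define W where "W n w = (U n w \<bullet> V n w) / sqrt (q (V n w))" for n w
  define a where "a n w = (1 / sqrt n) *\<^sub>R (\<Sum>i\<in>{1..n}. g1 n w (Z i w))" for n w
  define b where "b n w = (1 / sqrt n) *\<^sub>R (\<Sum>i\<in>{n+1..2*n}. g2 n w (Z i w))" for n w
  define Q where "Q n w = (1 / n) * (\<Sum>i\<in>{1..n}. (g1 n w (Z i w) \<bullet> b n w)\<^sup>2) - (a n w \<bullet> b n w)\<^sup>2 * (1 / n)" for n w
  define H where "H n w = (1 / n) * (\<Sum>i\<in>{1..n}. (norm (g1 n w (Z i w) - \<phi> (Z i w)))\<^sup>2)" for n w
  define \<Phi> where "\<Phi> n w = (1 / n) * (\<Sum>i\<in>{1..n}. (norm (\<phi> (Z i w)))\<^sup>2)" for n w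
  define E where "E n w = (1 / n) * (\<Sum>i\<in>{1..n}. (\<phi> (Z i w) \<bullet> V n w)\<^sup>2)" for n w
  define E' where "E' n w = (1 / n) * (\<Sum>i\<in>{1..n}. (g1 n w (Z i w) \<bullet> b n w)\<^sup>2)" for n w
  have T_meas[measurable]: "T n \<in> borel_measurable M" for n
    unfolding T_def by (rule T_dagger_measurable[OF Z_meas g1 g2])
  have W_meas[measurable]: "W n \<in> borel_measurable M" for n
    unfolding W_def by measurable
  have aU: "((\<lambda>(n, w). a n w - U n w) \<longlongrightarrow> 0) (inprob M)"
    using mean1 by (simp add: a_def U_def scaleR_diff_right[symmetric] sum_subtractf)
  have bV: "((\<lambda>(n, w). b n w - V n w) \<longlongrightarrow> 0) (inprob M)"
    using mean2 by (simp add: b_def V_def scaleR_diff_right[symmetric] sum_subtractf)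
  \<comment> \<open>The perturbation inside the square is (g1 - \<phi>) \<bullet> b + \<phi>
    \<bullet> (b - V); its mean square is bounded by the two bracketed terms, and Cauchy--Schwarz
    handles the cross term.\<close>
  have EE: "\<bar>E' n w - E n w\<bar> \<le>
      (2 * (norm (b n w))\<^sup>2 * H n w + 2 * (norm (b n w - V n w))\<^sup>2 * \<Phi> n w) +
      2 * sqrt ((2 * (norm (b n w))\<^sup>2 * H n w + 2 * (norm (b n w - V n w))\<^sup>2 * \<Phi> n w) * E n w)" for n w
  proof -
    define e where "e = (\<lambda>i. \<phi> (Z i w) \<bullet> V n w)"
    define d where "d = (\<lambda>i. g1 n w (Z i w) \<bullet> b n w - \<phi> (Z i w) \<bullet> V n w)"
    define D where "D = (1 / n) * (\<Sum>i\<in>{1..n}. (d i)\<^sup>2)"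
    define R where "R = 2 * (norm (b n w))\<^sup>2 * H n w + 2 * (norm (b n w - V n w))\<^sup>2 * \<Phi> n w"
    have di: "(d i)\<^sup>2 \<le> 2 * (norm (b n w))\<^sup>2 * (norm (g1 n w (Z i w) - \<phi> (Z i w)))\<^sup>2 + 2 * (norm (b n w - V n w))\<^sup>2 * (norm (\<phi> (Z i w)))\<^sup>2" for i
    proof -
      define x where "x = (g1 n w (Z i w) - \<phi> (Z i w)) \<bullet> b n w"
      define y where "y = \<phi> (Z i w) \<bullet> (b n w - V n w)"
      have "d i = x + y" by (simp add: d_def x_def y_def inner_diff_left inner_diff_right)
      moreover have "(x + y)\<^sup>2 \<le> 2 * x\<^sup>2 + 2 * y\<^sup>2"
        using sum_squares_bound[of x y] by (simp add: power2_sum)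
      moreover have "x\<^sup>2 \<le> (norm (g1 n w (Z i w) - \<phi> (Z i w)) * norm (b n w))\<^sup>2"
        unfolding x_def by (rule abs_le_square_iff[THEN iffD1]) (simp add: Cauchy_Schwarz_ineq2)
      moreover have "y\<^sup>2 \<le> (norm (\<phi> (Z i w)) * norm (b n w - V n w))\<^sup>2"
        unfolding y_def by (rule abs_le_square_iff[THEN iffD1]) (simp add: Cauchy_Schwarz_ineq2)
      ultimately show ?thesis by (simp add: power_mult_distrib mult_ac)
    qed
    have "(\<Sum>i\<in>{1..n}. (d i)\<^sup>2) \<le> (\<Sum>i\<in>{1..n}. 2 * (norm (b n w))\<^sup>2 * (norm (g1 n w (Z i w) - \<phi> (Z i w)))\<^sup>2 + 2 * (norm (b n w - V n w))\<^sup>2 * (norm (\<phi> (Z i w)))\<^sup>2)"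
      by (intro sum_mono di)
    then have "D \<le> (1 / n) * (\<Sum>i\<in>{1..n}. 2 * (norm (b n w))\<^sup>2 * (norm (g1 n w (Z i w) - \<phi> (Z i w)))\<^sup>2 + 2 * (norm (b n w - V n w))\<^sup>2 * (norm (\<phi> (Z i w)))\<^sup>2)"
      unfolding D_def by (intro mult_left_mono) auto
    also have "\<dots> = R"
      by (simp add: R_def H_def \<Phi>_def sum.distrib sum_distrib_left[symmetric] add_divide_distrib)
    finally have DR: "D \<le> R" .
    have E0: "0 \<le> E n w" unfolding E_def by (intro mult_nonneg_nonneg sum_nonneg) auto
    have "\<bar>E' n w - E n w\<bar> = (1 / n) * \<bar>(\<Sum>i\<in>{1..n}. (e i + d i)\<^sup>2) - (\<Sum>i\<in>{1..n}. (e i)\<^sup>2)\<bar>"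
      by (simp add: E'_def E_def e_def d_def abs_mult diff_divide_distrib[symmetric])
    also have "\<dots> \<le> (1 / n) * ((\<Sum>i\<in>{1..n}. (d i)\<^sup>2) + 2 * sqrt ((\<Sum>i\<in>{1..n}. (d i)\<^sup>2) * (\<Sum>i\<in>{1..n}. (e i)\<^sup>2)))"
      by (intro mult_left_mono mean_square_perturb) auto
    also have "\<dots> = D + 2 * sqrt (D * E n w)"
      by (simp add: D_def E_def e_def distrib_left real_sqrt_mult real_sqrt_divide add_divide_distrib)
    also have "\<dots> \<le> R + 2 * sqrt (R * E n w)"
      using DR E0 by (intro add_mono mult_left_mono real_sqrt_le_mono mult_right_mono) auto
    finally show ?thesis unfolding R_def .
  qed
  have TW: "((\<lambda>(n, w). T n w - W n w) \<longlongrightarrow> 0) (inprob M)"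
  proof (rule tendsto_inprob_regular)
    fix K \<delta> :: real assume K: "K > 0" and \<delta>: "\<delta> > 0"
    define F where "F = inf (inprob M) (principal {(n, w). regular K \<delta> n w})"
    have le: "F \<le> inprob M" by (simp add: F_def)
    have reg: "\<forall>\<^sub>F (n, w) in F. regular K \<delta> n w"
      by (simp add: F_def eventually_inf_principal case_prod_unfold)
    have inv_n: "((\<lambda>(n, w). 1 / real n) \<longlongrightarrow> 0) F"
      by (rule tendsto_mono[OF le inprob_tendsto_const])
         (intro tendsto_divide_0[OF tendsto_const] filterlim_at_top_imp_at_infinity filterlim_real_sequentially)
    note aU' = tendsto_mono[OF le aU, unfolded case_prod_unfold]
    note bV' = tendsto_mono[OF le bV, unfolded case_prod_unfold]
    note H0 = tendsto_mono[OF le sq1[folded H_def], unfolded case_prod_unfold]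
    note \<Phi>0 = tendsto_mono[OF le lln_norm_sq[folded \<Phi>_def], unfolded case_prod_unfold]
    note E0 = tendsto_mono[OF le lln_quadratic_form[folded E_def], unfolded case_prod_unfold]
    have bU: "\<forall>\<^sub>F x in F. norm (U (fst x) (snd x)) \<le> K" and bdV: "\<forall>\<^sub>F x in F. norm (V (fst x) (snd x)) \<le> K"
      and bq: "\<forall>\<^sub>F x in F. \<delta> \<le> q (V (fst x) (snd x))"
      using reg by (auto simp: case_prod_unfold regular_def elim: eventually_mono)
    have bb: "\<forall>\<^sub>F x in F. norm (b (fst x) (snd x)) \<le> K + 1"
      using tendstoD[OF bV' zero_less_one] bdV
    proof eventually_elim
      case (elim x)
      then show ?case using norm_triangle_ineq[of "V (fst x) (snd x)" "b (fst x) (snd x) - V (fst x) (snd x)"] by simp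
    qed
    \<comment> \<open>a \<bullet> b - U \<bullet> V = b \<bullet> (a - U) + U \<bullet> (b - V): in
      each summand a bounded factor meets a vanishing one.\<close>
    have ab: "((\<lambda>x. a (fst x) (snd x) \<bullet> b (fst x) (snd x) - U (fst x) (snd x) \<bullet> V (fst x) (snd x)) \<longlongrightarrow> 0) F"
    proof -
      have "((\<lambda>x. b (fst x) (snd x) \<bullet> (a (fst x) (snd x) - U (fst x) (snd x)) + U (fst x) (snd x) \<bullet> (b (fst x) (snd x) - V (fst x) (snd x))) \<longlongrightarrow> 0 + 0) F"
        by (intro tendsto_add bounded_inner_tendsto_0[OF bb aU'] bounded_inner_tendsto_0[OF bU bV'])
      then show ?thesis by (simp add: inner_diff_right inner_commute algebra_simps)
    qed
    have bN: "\<forall>\<^sub>F x in F. \<bar>U (fst x) (snd x) \<bullet> V (fst x) (snd x)\<bar> \<le> K * K"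
      using bU bdV
    proof eventually_elim
      case (elim x)
      have "\<bar>U (fst x) (snd x) \<bullet> V (fst x) (snd x)\<bar> \<le> norm (U (fst x) (snd x)) * norm (V (fst x) (snd x))"
        by (rule Cauchy_Schwarz_ineq2)
      also have "\<dots> \<le> K * K" using elim K by (intro mult_mono) auto
      finally show ?case .
    qed
    have bab: "\<forall>\<^sub>F x in F. \<bar>(a (fst x) (snd x) \<bullet> b (fst x) (snd x))\<^sup>2\<bar> \<le> (K * K + 1)\<^sup>2"
      using tendstoD[OF ab zero_less_one] bN
    proof eventually_elim
      case (elim x)
      then have "\<bar>a (fst x) (snd x) \<bullet> b (fst x) (snd x)\<bar> \<le> K * K + 1" by (simp add: dist_real_def)
      then show ?case using K abs_le_square_iff[of "a (fst x) (snd x) \<bullet> b (fst x) (snd x)" "K * K + 1"] by simp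
    qed
    have q_le: "q v \<le> m2 * (norm v)\<^sup>2" for v
    proof -
      have "q v \<le> (\<integral>z. (norm (\<phi> z))\<^sup>2 * (norm v)\<^sup>2 \<partial>P)"
        unfolding q_def
      proof (rule integral_mono)
        fix z
        show "(\<phi> z \<bullet> v)\<^sup>2 \<le> (norm (\<phi> z))\<^sup>2 * (norm v)\<^sup>2"
          using Cauchy_Schwarz_ineq[of "\<phi> z" v] by (simp add: power2_norm_eq_inner)
      qed (use inner_power2 \<phi>2 in auto)
      then show ?thesis by (simp add: m2_def)
    qed
    have bE: "\<forall>\<^sub>F x in F. E (fst x) (snd x) \<le> m2 * K\<^sup>2 + 1"
      using tendstoD[OF E0 zero_less_one] bdV
    proof eventually_elim
      case (elim x)
      have "q (V (fst x) (snd x)) \<le> m2 * (norm (V (fst x) (snd x)))\<^sup>2" by (rule q_le)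
      also have "\<dots> \<le> m2 * K\<^sup>2" using elim m2_nonneg by (intro mult_left_mono power_mono) auto
      finally show ?case using elim by (simp add: dist_real_def abs_if split: if_splits)
    qed
    have b\<Phi>: "\<forall>\<^sub>F x in F. \<bar>\<Phi> (fst x) (snd x)\<bar> \<le> m2 + 1"
      using tendstoD[OF \<Phi>0 zero_less_one]
      by eventually_elim (use m2_nonneg in \<open>auto simp: dist_real_def abs_if split: if_splits\<close>)
    define R where "R x = 2 * (norm (b (fst x) (snd x)))\<^sup>2 * H (fst x) (snd x) + 2 * (norm (b (fst x) (snd x) - V (fst x) (snd x)))\<^sup>2 * \<Phi> (fst x) (snd x)" for x
    have R0: "(R \<longlongrightarrow> 0) F"
    proof -
      have 1: "((\<lambda>x. (norm (b (fst x) (snd x)))\<^sup>2 * H (fst x) (snd x)) \<longlongrightarrow> 0) F"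
      proof (rule bounded_mult_tendsto_0[OF _ H0])
        show "\<forall>\<^sub>F x in F. \<bar>(norm (b (fst x) (snd x)))\<^sup>2\<bar> \<le> (K + 1)\<^sup>2"
          using bb by eventually_elim (simp add: power_mono)
      qed
      have "((\<lambda>x. (norm (b (fst x) (snd x) - V (fst x) (snd x)))\<^sup>2) \<longlongrightarrow> 0\<^sup>2) F"
        by (intro tendsto_power tendsto_norm_zero bV')
      then have 2: "((\<lambda>x. \<Phi> (fst x) (snd x) * (norm (b (fst x) (snd x) - V (fst x) (snd x)))\<^sup>2) \<longlongrightarrow> 0) F"
        by (intro bounded_mult_tendsto_0[OF b\<Phi>]) simp
      have "((\<lambda>x. 2 * ((norm (b (fst x) (snd x)))\<^sup>2 * H (fst x) (snd x)) + 2 * (\<Phi> (fst x) (snd x) * (norm (b (fst x) (snd x) - V (fst x) (snd x)))\<^sup>2)) \<longlongrightarrow> 2 * 0 + 2 * 0) F"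
        by (intro tendsto_add tendsto_mult_left 1 2)
      then show ?thesis unfolding R_def by (simp add: mult_ac)
    qed
    have RE0: "((\<lambda>x. R x * E (fst x) (snd x)) \<longlongrightarrow> 0) F"
    proof -
      have "0 \<le> E n w" for n w unfolding E_def by (intro mult_nonneg_nonneg sum_nonneg) auto
      then have "\<forall>\<^sub>F x in F. \<bar>E (fst x) (snd x)\<bar> \<le> m2 * K\<^sup>2 + 1"
        using bE by (simp add: abs_of_nonneg)
      from bounded_mult_tendsto_0[OF this R0] show ?thesis by (simp add: mult.commute)
    qed
    have E'E: "((\<lambda>x. E' (fst x) (snd x) - E (fst x) (snd x)) \<longlongrightarrow> 0) F"
    proof (rule Lim_null_comparison)
      have "((\<lambda>x. R x + 2 * sqrt (R x * E (fst x) (snd x))) \<longlongrightarrow> 0 + 2 * sqrt 0) F"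
        by (intro tendsto_add tendsto_mult_left tendsto_real_sqrt R0 RE0)
      then show "((\<lambda>x. R x + 2 * sqrt (R x * E (fst x) (snd x))) \<longlongrightarrow> 0) F" by simp
      show "\<forall>\<^sub>F x in F. norm (E' (fst x) (snd x) - E (fst x) (snd x)) \<le> R x + 2 * sqrt (R x * E (fst x) (snd x))"
        using EE unfolding R_def by (intro always_eventually allI) simp
    qed
    have Qq: "((\<lambda>x. Q (fst x) (snd x) - q (V (fst x) (snd x))) \<longlongrightarrow> 0) F"
    proof -
      have "((\<lambda>x. (E' (fst x) (snd x) - E (fst x) (snd x)) + (E (fst x) (snd x) - q (V (fst x) (snd x))) -
          (a (fst x) (snd x) \<bullet> b (fst x) (snd x))\<^sup>2 * (1 / real (fst x))) \<longlongrightarrow> 0 + 0 - 0) F"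
        by (intro tendsto_add tendsto_diff E'E E0 bounded_mult_tendsto_0[OF bab inv_n[unfolded case_prod_unfold]])
      then show ?thesis by (simp add: Q_def E'_def algebra_simps)
    qed
    have "((\<lambda>x. (a (fst x) (snd x) \<bullet> b (fst x) (snd x)) / sqrt (Q (fst x) (snd x)) - W (fst x) (snd x)) \<longlongrightarrow> 0) F"
      unfolding W_def by (rule studentization_tendsto[OF ab Qq bN \<delta> bq])
    moreover have "\<forall>\<^sub>F x in F. (a (fst x) (snd x) \<bullet> b (fst x) (snd x)) / sqrt (Q (fst x) (snd x)) - W (fst x) (snd x) = (case x of (n, w) \<Rightarrow> T n w - W n w)"
      using filter_leD[OF le inprob_sequentially[OF eventually_gt_at_top[of 0]]]
      by eventually_elim (auto simp: T_def T_dagger_eq a_def b_def Q_def)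
    ultimately show "((\<lambda>(n, w). T n w - W n w) \<longlongrightarrow> 0) (inf (inprob M) (principal {(n, w). regular K \<delta> n w}))"
      unfolding F_def[symmetric] by (rule Lim_transform_eventually)
  qed
  show ?thesis
    unfolding T_def[symmetric]
  proof (rule levy_continuity)
    show "real_distribution (distr M borel (T n))" for n by simp
    show "real_distribution std_normal_distribution" by (rule real_dist_normal_dist)
    fix t :: real
    have bnd: "norm (iexp (t * T n w) - iexp (t * W n w)) \<le> 2" for n w
      using norm_triangle_ineq4[of "iexp (t * T n w)" "iexp (t * W n w)"] by (simp only: norm_exp_i_times)
    have diff: "norm (iexp x - iexp y) \<le> \<bar>x - y\<bar>" for x y :: real
    proof -
      have "iexp x - iexp y = iexp y * (iexp (x - y) - 1)"
        by (simp add: right_diff_distrib exp_add[symmetric] algebra_simps)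
      then have "norm (iexp x - iexp y) = norm (iexp (x - y) - 1)"
        by (simp only: norm_mult norm_exp_i_times mult_1)
      then show ?thesis using iexp_approx1[of "x - y" 0] by simp
    qed
    \<comment> \<open>The integrand is bounded by 2 and by |t| * |T - W|, so convergence of T - W to
      0 in probability makes the two characteristic functions merge.\<close>
    have "(\<lambda>n. \<integral>w. iexp (t * T n w) - iexp (t * W n w) \<partial>M) \<longlonglongrightarrow> 0"
    proof (rule inprob_bounded_convergence[OF _ bnd])
      have "((\<lambda>(n, w). \<bar>t\<bar> * \<bar>T n w - W n w\<bar>) \<longlongrightarrow> \<bar>t\<bar> * \<bar>0\<bar>) (inprob M)"
        using TW unfolding case_prod_unfold by (intro tendsto_mult_left tendsto_rabs)
      then have 0: "((\<lambda>(n, w). \<bar>t\<bar> * \<bar>T n w - W n w\<bar>) \<longlongrightarrow> 0) (inprob M)" by simp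
      show "((\<lambda>(n, w). iexp (t * T n w) - iexp (t * W n w)) \<longlongrightarrow> 0) (inprob M)"
      proof (rule Lim_null_comparison[OF _ 0], intro always_eventually allI)
        fix x :: "nat \<times> 'w"
        show "norm (case x of (n, w) \<Rightarrow> iexp (t * T n w) - iexp (t * W n w)) \<le> (case x of (n, w) \<Rightarrow> \<bar>t\<bar> * \<bar>T n w - W n w\<bar>)"
          using diff[of "t * T (fst x) (snd x)" "t * W (fst x) (snd x)"]
          by (simp only: case_prod_unfold right_diff_distrib[symmetric] abs_mult)
      qed
    qed measurable
    moreover have "(\<integral>w. iexp (t * T n w) - iexp (t * W n w) \<partial>M) = char (distr M borel (T n)) t - char (distr M borel (W n)) t" for n
    proof -
      have i: "integrable M (\<lambda>w. iexp (t * X w))" if [measurable]: "X \<in> borel_measurable M" for X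
        by (rule integrable_const_bound[of _ 1]) (auto simp only: norm_exp_i_times intro!: always_eventually, measurable)
      have c: "char (distr M borel X) t = (\<integral>w. iexp (t * X w) \<partial>M)" if [measurable]: "X \<in> borel_measurable M" for X
        unfolding char_def by (subst integral_distr) auto
      show ?thesis
        unfolding c[OF T_meas] c[OF W_meas] by (rule Bochner_Integration.integral_diff[OF i[OF T_meas] i[OF W_meas]])
    qed
    ultimately have "(\<lambda>n. char (distr M borel (T n)) t - char (distr M borel (W n)) t) \<longlonglongrightarrow> 0" by simp
    from tendsto_add[OF this oracle_char[of t, folded W_def]]
    show "(\<lambda>n. char (distr M borel (T n)) t) \<longlonglongrightarrow> char std_normal_distribution t"
      by (simp add: char_std_normal_distribution)
  qed
qed

end

section \<open>Symmetrization over mixed samples\<close>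

text \<open>A Rademacher sum: E is the set of indices with sign +, and expectations over random
  signs become averages over \<open>Pow I\<close>.\<close>

definition sgnsum :: "'i set \<Rightarrow> ('i \<Rightarrow> 'h::real_vector) \<Rightarrow> 'i set \<Rightarrow> 'h" where
  "sgnsum I x E = (\<Sum>i\<in>I. if i \<in> E then x i else - x i)"

lemma sum_Pow_insert:
  assumes "finite I" "a \<notin> I"
  shows "(\<Sum>E\<in>Pow (insert a I). f (sgnsum (insert a I) x E)) =
    (\<Sum>E\<in>Pow I. f (sgnsum I x E - x a) + f (sgnsum I x E + x a))"
proof -
  have inj: "inj_on (insert a) (Pow I)"
    using assms by (auto simp: inj_on_def)
  have 1: "sgnsum (insert a I) x E = sgnsum I x E - x a" if "E \<in> Pow I" for E
    using assms that by (auto simp: sgnsum_def)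
  have 2: "sgnsum (insert a I) x (insert a E) = sgnsum I x E + x a" if "E \<in> Pow I" for E
    using assms that unfolding sgnsum_def by (subst sum.insert) (auto intro!: sum.cong)
  have "(\<Sum>E\<in>Pow (insert a I). f (sgnsum (insert a I) x E)) =
      (\<Sum>E\<in>Pow I. f (sgnsum (insert a I) x E)) + (\<Sum>E\<in>insert a ` Pow I. f (sgnsum (insert a I) x E))"
    unfolding Pow_insert using assms by (intro sum.union_disjoint) auto
  also have "(\<Sum>E\<in>insert a ` Pow I. f (sgnsum (insert a I) x E)) = (\<Sum>E\<in>Pow I. f (sgnsum (insert a I) x (insert a E)))"
    by (simp add: sum.reindex[OF inj])
  finally show ?thesis
    by (simp add: 1 2 sum.distrib)
qed

text \<open>The parallelogram law, one index at a time.\<close>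

lemma sgnsum_second_moment:
  fixes x :: "'i \<Rightarrow> 'h::real_inner"
  assumes "finite I"
  shows "(\<Sum>E\<in>Pow I. (norm (sgnsum I x E))\<^sup>2) = 2 ^ card I * (\<Sum>i\<in>I. (norm (x i))\<^sup>2)"
  using assms
proof (induction I)
  case empty
  then show ?case by (simp add: sgnsum_def)
next
  case (insert a I)
  have "(norm (s - x a))\<^sup>2 + (norm (s + x a))\<^sup>2 = 2 * (norm s)\<^sup>2 + 2 * (norm (x a))\<^sup>2" for s
    using norm_sq_diff[of s "x a"] norm_sq_diff[of s "- x a"] by simp
  then show ?case
    using insert by (simp add: sum_Pow_insert[where f="\<lambda>s. (norm s)\<^sup>2"] sum.distrib sum_distrib_left[symmetric] card_Pow distrib_left)
qed

text \<open>Khintchine's inequality for vectors; the constant 3 is the fourth moment of a standard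
  normal variable.\<close>

lemma sgnsum_fourth_moment:
  fixes x :: "'i \<Rightarrow> 'h::real_inner"
  assumes "finite I"
  shows "(\<Sum>E\<in>Pow I. (norm (sgnsum I x E)) ^ 4) \<le> 3 * 2 ^ card I * (\<Sum>i\<in>I. (norm (x i))\<^sup>2)\<^sup>2"
  using assms
proof (induction I)
  case empty
  then show ?case by (simp add: sgnsum_def)
next
  case (insert a I)
  define \<sigma> where "\<sigma> = (\<Sum>i\<in>I. (norm (x i))\<^sup>2)"
  define \<alpha> where "\<alpha> = (norm (x a))\<^sup>2"
  have *: "(norm (s - x a)) ^ 4 + (norm (s + x a)) ^ 4 \<le> 2 * norm s ^ 4 + 12 * \<alpha> * (norm s)\<^sup>2 + 2 * \<alpha>\<^sup>2" for s
  proof -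
    have sq: "y ^ 4 = (y\<^sup>2)\<^sup>2" for y :: real by (simp add: power_mult[symmetric])
    have "(s \<bullet> x a)\<^sup>2 \<le> (norm s)\<^sup>2 * \<alpha>"
      using Cauchy_Schwarz_ineq[of s "x a"] by (simp add: power2_norm_eq_inner \<alpha>_def)
    moreover have "(norm (s - x a)) ^ 4 + (norm (s + x a)) ^ 4 = 2 * ((norm s)\<^sup>2 + \<alpha>)\<^sup>2 + 8 * (s \<bullet> x a)\<^sup>2"
    proof -
      have e: "(norm (s - x a))\<^sup>2 = (norm s)\<^sup>2 - 2 * (s \<bullet> x a) + \<alpha>" "(norm (s + x a))\<^sup>2 = (norm s)\<^sup>2 + 2 * (s \<bullet> x a) + \<alpha>"
        using norm_sq_diff[of s "x a"] norm_sq_diff[of s "- x a"] by (simp_all add: \<alpha>_def)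
      show ?thesis unfolding sq e by (simp add: power2_eq_square algebra_simps)
    qed
    ultimately show ?thesis unfolding sq by (simp add: power2_eq_square algebra_simps)
  qed
  have "(\<Sum>E\<in>Pow (insert a I). (norm (sgnsum (insert a I) x E)) ^ 4) \<le>
      (\<Sum>E\<in>Pow I. 2 * norm (sgnsum I x E) ^ 4 + 12 * \<alpha> * (norm (sgnsum I x E))\<^sup>2 + 2 * \<alpha>\<^sup>2)"
    unfolding sum_Pow_insert[OF insert(1,2), where f="\<lambda>s. (norm s)^4"] by (intro sum_mono *)
  also have "\<dots> = 2 * (\<Sum>E\<in>Pow I. norm (sgnsum I x E) ^ 4) + 12 * \<alpha> * (2 ^ card I * \<sigma>) + 2 * \<alpha>\<^sup>2 * 2 ^ card I"
    using insert(1) sgnsum_second_moment[OF insert(1), of x] by (simp add: sum.distrib sum_distrib_left[symmetric] card_Pow \<sigma>_def)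
  \<comment> \<open>The last coefficient is raised from 2 to 6 to complete the square 6 (\<sigma> +
    \<alpha>)^2.\<close>
  also have "\<dots> \<le> 2 * (3 * 2 ^ card I * \<sigma>\<^sup>2) + 12 * \<alpha> * (2 ^ card I * \<sigma>) + 6 * \<alpha>\<^sup>2 * 2 ^ card I"
    using insert(3) by (intro add_mono mult_left_mono mult_right_mono) (auto simp: \<sigma>_def \<alpha>_def)
  also have "\<dots> = 3 * 2 ^ card (insert a I) * (\<sigma> + \<alpha>)\<^sup>2"
    using insert by (simp add: power2_eq_square algebra_simps)
  finally show ?case using insert by (simp add: \<sigma>_def \<alpha>_def add.commute)
qed

text \<open>Paley--Zygmund: the fourth moment bound prevents the signed sums from concentrating near \<open>0\<close>.\<close>

lemma sgnsum_small_imp_squares_small: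
  fixes x :: "'i \<Rightarrow> 'h::real_inner"
  assumes I: "finite I" and bad: "6 * card {E\<in>Pow I. norm (sgnsum I x E) > B} \<le> 2 ^ card I" and B: "B \<ge> 0"
  shows "(\<Sum>i\<in>I. (norm (x i))\<^sup>2) \<le> 4 * B\<^sup>2"
proof (cases "(\<Sum>i\<in>I. (norm (x i))\<^sup>2) = 0")
  case True
  then show ?thesis by simp
next
  case False
  define \<sigma> where "\<sigma> = (\<Sum>i\<in>I. (norm (x i))\<^sup>2)"
  define N :: real where "N = 2 ^ card I"
  define \<beta> where "\<beta> = {E\<in>Pow I. norm (sgnsum I x E) > B}"
  have \<sigma>: "\<sigma> > 0" using False by (simp add: \<sigma>_def less_le sum_nonneg)
  have N: "N > 0" by (simp add: N_def)
  have badN: "6 * real (card \<beta>) \<le> N"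
    using bad unfolding \<beta>_def[symmetric] N_def by (metis of_nat_le_iff of_nat_mult of_nat_numeral of_nat_power)
  \<comment> \<open>On the bad set, (y - 3 \<sigma>)^2 \<ge> 0 gives y \<le> y^2 / (6 \<sigma>) + 3
    \<sigma> / 2. On average the fourth moment bound makes the first term at most \<sigma> / 2, and
    the bad fraction 1/6 makes the second at most \<sigma> / 4; hence \<sigma> \<le> B^2 + 3
    \<sigma> / 4.\<close>
  have pt: "(norm (sgnsum I x E))\<^sup>2 \<le> B\<^sup>2 + (norm (sgnsum I x E) ^ 4 / (6 * \<sigma>) + 3 * \<sigma> / 2 * indicator \<beta> E)" if "E \<in> Pow I" for E
  proof (cases "norm (sgnsum I x E) > B")
    case True
    define y where "y = (norm (sgnsum I x E))\<^sup>2"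
    have "0 \<le> (y - 3 * \<sigma>)\<^sup>2" by simp
    then have "6 * \<sigma> * y \<le> y\<^sup>2 + 9 * \<sigma>\<^sup>2" by (simp add: power2_eq_square algebra_simps)
    then have "y \<le> y\<^sup>2 / (6 * \<sigma>) + 3 * \<sigma> / 2" using \<sigma> by (simp add: field_simps power2_eq_square)
    moreover have "norm (sgnsum I x E) ^ 4 = y\<^sup>2" by (simp add: y_def power_mult[symmetric])
    moreover have "E \<in> \<beta>" using True that by (simp add: \<beta>_def)
    ultimately show ?thesis using zero_le_power2[of B] unfolding y_def[symmetric] by (simp add: add_increasing)
  next
    case False
    then have "(norm (sgnsum I x E))\<^sup>2 \<le> B\<^sup>2" by (intro power_mono) auto
    then show ?thesis using \<sigma> False by (simp add: \<beta>_def add_increasing2)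
  qed
  have "N * \<sigma> = (\<Sum>E\<in>Pow I. (norm (sgnsum I x E))\<^sup>2)"
    using sgnsum_second_moment[OF I, of x] by (simp add: N_def \<sigma>_def)
  also have "\<dots> \<le> (\<Sum>E\<in>Pow I. B\<^sup>2 + (norm (sgnsum I x E) ^ 4 / (6 * \<sigma>) + 3 * \<sigma> / 2 * indicator \<beta> E))"
    by (intro sum_mono pt)
  also have "\<dots> = N * B\<^sup>2 + (\<Sum>E\<in>Pow I. norm (sgnsum I x E) ^ 4) / (6 * \<sigma>) + 3 * \<sigma> / 2 * (\<Sum>E\<in>Pow I. indicator \<beta> E)"
    using I by (simp add: sum.distrib sum_distrib_left sum_divide_distrib card_Pow N_def)
  also have "(\<Sum>E\<in>Pow I. indicator \<beta> E :: real) = card \<beta>"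
  proof -
    have "Pow I \<inter> \<beta> = \<beta>" by (auto simp: \<beta>_def)
    then show ?thesis using I by (simp add: indicator_def of_bool_def sum.If_cases Int_def[symmetric])
  qed
  also have "N * B\<^sup>2 + (\<Sum>E\<in>Pow I. norm (sgnsum I x E) ^ 4) / (6 * \<sigma>) + 3 * \<sigma> / 2 * card \<beta> \<le>
      N * B\<^sup>2 + (3 * N * \<sigma>\<^sup>2) / (6 * \<sigma>) + 3 * \<sigma> / 2 * (N / 6)"
    using \<sigma> badN sgnsum_fourth_moment[OF I, of x]
    by (intro add_mono divide_right_mono mult_left_mono) (auto simp: N_def \<sigma>_def)
  also have "\<dots> = N * (B\<^sup>2 + 3 / 4 * \<sigma>)" using \<sigma> by (simp add: field_simps power2_eq_square)
  finally have "\<sigma> \<le> B\<^sup>2 + 3 / 4 * \<sigma>" using N by simp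
  then show ?thesis by (simp add: \<sigma>_def[symmetric])
qed

lemma bij_betw_shift_mod:
  fixes n k :: nat
  assumes n: "n > 0"
  shows "bij_betw (\<lambda>i. (i + k) mod n) {..<n} {..<n}"
proof (rule bij_betw_byWitness[where f' = "\<lambda>j. (j + (n - k mod n)) mod n"])
  have k: "k mod n \<le> n" using n by (simp add: less_imp_le)
  have *: "((i + k) mod n + (n - k mod n)) mod n = i mod n" for i
  proof -
    have "((i + k) mod n + (n - k mod n)) mod n = (i + k mod n + (n - k mod n)) mod n"
      by (metis mod_add_left_eq mod_add_right_eq)
    also have "i + k mod n + (n - k mod n) = i + n" using k by simp
    finally show ?thesis by simp
  qed
  have **: "((j + (n - k mod n)) mod n + k) mod n = j mod n" for j
  proof -
    have "((j + (n - k mod n)) mod n + k) mod n = (j + (n - k mod n) + k mod n) mod n"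
      by (metis mod_add_left_eq mod_add_right_eq)
    also have "j + (n - k mod n) + k mod n = j + n" using k by simp
    finally show ?thesis by simp
  qed
  show "\<forall>a\<in>{..<n}. ((a + k) mod n + (n - k mod n)) mod n = a"
    by (metis * lessThan_iff mod_less)
  show "\<forall>a'\<in>{..<n}. ((a' + (n - k mod n)) mod n + k) mod n = a'"
    by (metis ** lessThan_iff mod_less)
qed (use n in auto)

lemma sum_shift_mod:
  fixes n k :: nat
  assumes "n > 0"
  shows "(\<Sum>i<n. f ((i + k) mod n)) = (\<Sum>j<n. f j)"
  using sum.reindex_bij_betw[OF bij_betw_shift_mod[OF assms], of f k] by simp

text \<open>
  Index \<open>i\<close> of the mixed sample takes its point from the first block if \<open>i \<in> E\<close>, and otherwise
  from the cyclic shift by \<open>k\<close> of the second block.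
\<close>

definition mix :: "nat \<Rightarrow> (nat \<Rightarrow> 'b) \<Rightarrow> (nat \<Rightarrow> 'b) \<Rightarrow> nat \<Rightarrow> nat set \<Rightarrow> nat \<Rightarrow> 'b" where
  "mix n a b k E i = (if i \<in> E then a i else b ((i + k) mod n))"

text \<open>Passing to the complement of E takes the other member of every pair, so the difference
  carries the signs and the centering m cancels.\<close>

lemma sum_mix_diff:
  fixes a b :: "nat \<Rightarrow> 'h::real_vector"
  assumes "E \<subseteq> {..<n}"
  shows "(\<Sum>i<n. mix n a b k E i - m) - (\<Sum>i<n. mix n a b k ({..<n} - E) i - m) = sgnsum {..<n} (\<lambda>i. a i - b ((i + k) mod n)) E"
  unfolding sgnsum_def sum_subtractf[symmetric] by (intro sum.cong refl) (auto simp: mix_def)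

text \<open>As 48 = 4 * 12, at most n / 4 shifts k have more than a fraction 1/12 of bad sets E. For
  any other shift, counting E and its complement, a signed sum exceeds 2 B for at most 1/6 of the
  sets, as Paley--Zygmund allows, and D k \<le> 4 (2 B)^2. The bad shifts are bounded crudely by 2 A
  each; together they cost n A / 2, which the left side absorbs.\<close>

lemma mixed_samples_bound:
  fixes a b :: "nat \<Rightarrow> 'h::real_inner"
  assumes n: "n > 0" and B: "B \<ge> 0"
    and bad: "48 * card {(k, E). k < n \<and> E \<subseteq> {..<n} \<and> norm (\<Sum>i<n. mix n a b k E i - m) > B} \<le> n * 2 ^ n"
  shows "(\<Sum>i<n. (norm (a i))\<^sup>2) + (\<Sum>j<n. (norm (b j))\<^sup>2) \<le> 32 * B\<^sup>2 + 4 / n * ((\<Sum>i<n. a i) \<bullet> (\<Sum>j<n. b j))"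
proof -
  define \<beta> where "\<beta> k = {E. E \<subseteq> {..<n} \<and> norm (\<Sum>i<n. mix n a b k E i - m) > B}" for k
  define A where "A = (\<Sum>i<n. (norm (a i))\<^sup>2) + (\<Sum>j<n. (norm (b j))\<^sup>2)"
  define D where "D k = (\<Sum>i<n. (norm (a i - b ((i + k) mod n)))\<^sup>2)" for k
  define kbad where "kbad = {k. k < n \<and> 12 * card (\<beta> k) > 2 ^ n}"
  have A0: "A \<ge> 0" by (auto simp: A_def intro!: add_nonneg_nonneg sum_nonneg)
  have fin: "finite (\<beta> k)" for k by (rule finite_subset[of _ "Pow {..<n}"]) (auto simp: \<beta>_def)
  have "{(k, E). k < n \<and> E \<subseteq> {..<n} \<and> norm (\<Sum>i<n. mix n a b k E i - m) > B} = (SIGMA k:{..<n}. \<beta> k)"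
    by (auto simp: \<beta>_def)
  then have tot: "48 * (\<Sum>k<n. card (\<beta> k)) \<le> n * 2 ^ n"
    using bad fin by (simp add: card_SigmaI)
  have "card kbad * 2 ^ n = (\<Sum>k\<in>kbad. 2 ^ n)" by simp
  also have "\<dots> \<le> (\<Sum>k\<in>kbad. 12 * card (\<beta> k))" by (intro sum_mono) (auto simp: kbad_def)
  also have "\<dots> \<le> (\<Sum>k<n. 12 * card (\<beta> k))" by (intro sum_mono2) (auto simp: kbad_def)
  also have "\<dots> = 12 * (\<Sum>k<n. card (\<beta> k))" by (simp only: sum_distrib_left)
  finally have "4 * (card kbad * 2 ^ n) \<le> n * 2 ^ n" using tot by linarith
  then have kbad: "4 * card kbad \<le> n" by simp
  have D_good: "D k \<le> 16 * B\<^sup>2" if k: "k < n" "k \<notin> kbad" for k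
  proof -
    have "{E\<in>Pow {..<n}. norm (sgnsum {..<n} (\<lambda>i. a i - b ((i + k) mod n)) E) > 2 * B} \<subseteq> \<beta> k \<union> (\<lambda>E. {..<n} - E) ` \<beta> k"
    proof
      fix E assume E: "E \<in> {E\<in>Pow {..<n}. norm (sgnsum {..<n} (\<lambda>i. a i - b ((i + k) mod n)) E) > 2 * B}"
      have "norm (sgnsum {..<n} (\<lambda>i. a i - b ((i + k) mod n)) E) \<le>
          norm (\<Sum>i<n. mix n a b k E i - m) + norm (\<Sum>i<n. mix n a b k ({..<n} - E) i - m)"
        using E by (subst sum_mix_diff[symmetric]) (auto intro: norm_triangle_ineq4)
      with E have "E \<in> \<beta> k \<or> {..<n} - E \<in> \<beta> k" by (auto simp: \<beta>_def)
      moreover have "E = {..<n} - ({..<n} - E)" using E by auto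
      ultimately show "E \<in> \<beta> k \<union> (\<lambda>E. {..<n} - E) ` \<beta> k" by blast
    qed
    then have "card {E\<in>Pow {..<n}. norm (sgnsum {..<n} (\<lambda>i. a i - b ((i + k) mod n)) E) > 2 * B} \<le> card (\<beta> k \<union> (\<lambda>E. {..<n} - E) ` \<beta> k)"
      using fin by (intro card_mono) auto
    also have "\<dots> \<le> card (\<beta> k) + card ((\<lambda>E. {..<n} - E) ` \<beta> k)" by (rule card_Un_le)
    also have "\<dots> \<le> card (\<beta> k) + card (\<beta> k)" using fin by (intro add_left_mono card_image_le)
    finally have "6 * card {E\<in>Pow {..<n}. norm (sgnsum {..<n} (\<lambda>i. a i - b ((i + k) mod n)) E) > 2 * B} \<le> 2 ^ card {..<n}"
      using k by (simp add: kbad_def)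
    from sgnsum_small_imp_squares_small[OF _ this] B
    show ?thesis by (simp add: D_def power_mult_distrib)
  qed
  have D_bad: "D k \<le> 2 * A" for k
  proof -
    have "D k \<le> (\<Sum>i<n. 2 * (norm (a i))\<^sup>2 + 2 * (norm (b ((i + k) mod n)))\<^sup>2)"
      unfolding D_def
    proof (rule sum_mono)
      fix i
      have "(norm (a i - b ((i + k) mod n)))\<^sup>2 \<le> (norm (a i) + norm (b ((i + k) mod n)))\<^sup>2"
        by (intro power_mono norm_triangle_ineq4) auto
      also have "\<dots> \<le> 2 * (norm (a i))\<^sup>2 + 2 * (norm (b ((i + k) mod n)))\<^sup>2"
        using sum_squares_bound[of "norm (a i)" "norm (b ((i + k) mod n))"] by (simp add: power2_sum)
      finally show "(norm (a i - b ((i + k) mod n)))\<^sup>2 \<le> 2 * (norm (a i))\<^sup>2 + 2 * (norm (b ((i + k) mod n)))\<^sup>2" .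
    qed
    also have "\<dots> = 2 * A"
      using sum_shift_mod[OF n, of "\<lambda>j. (norm (b j))\<^sup>2" k] by (simp add: A_def sum.distrib sum_distrib_left[symmetric])
    finally show ?thesis .
  qed
  \<comment> \<open>Over all shifts each pair (i, j) occurs exactly once, so the sum compares every
    a i with every b j; only the product of the two total sums spoils the identity with n *
    A.\<close>
  have "(\<Sum>k<n. D k) = (\<Sum>i<n. \<Sum>k<n. (norm (a i - b ((k + i) mod n)))\<^sup>2)"
    unfolding D_def by (subst sum.swap) (simp add: add.commute)
  also have "\<dots> = (\<Sum>i<n. \<Sum>j<n. (norm (a i - b j))\<^sup>2)"
    using sum_shift_mod[OF n, of "\<lambda>j. (norm (a _ - b j))\<^sup>2"] by simp
  also have "\<dots> = n * A - 2 * ((\<Sum>i<n. a i) \<bullet> (\<Sum>j<n. b j))"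
    by (simp add: norm_sq_diff sum.distrib sum_subtractf A_def inner_sum_left inner_sum_right sum_distrib_left[symmetric] distrib_left)
       (rule sum.swap)
  finally have "n * A - 2 * ((\<Sum>i<n. a i) \<bullet> (\<Sum>j<n. b j)) = (\<Sum>k<n. D k)" ..
  also have "\<dots> = (\<Sum>k\<in>{..<n} - kbad. D k) + (\<Sum>k\<in>kbad. D k)"
    by (intro sum.subset_diff) (auto simp: kbad_def)
  also have "\<dots> \<le> (\<Sum>k\<in>{..<n} - kbad. 16 * B\<^sup>2) + (\<Sum>k\<in>kbad. 2 * A)"
    by (intro add_mono sum_mono D_good D_bad) auto
  also have "\<dots> \<le> n * (16 * B\<^sup>2) + (real n / 4) * (2 * A)"
  proof (intro add_mono)
    have "card ({..<n} - kbad) \<le> n" using card_mono[of "{..<n}" "{..<n} - kbad"] by auto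
    then show "(\<Sum>k\<in>{..<n} - kbad. 16 * B\<^sup>2) \<le> n * (16 * B\<^sup>2)" by (simp add: mult_right_mono)
    have "real (card kbad) \<le> real n / 4" using kbad by linarith
    then have "real (card kbad) * (2 * A) \<le> (real n / 4) * (2 * A)" using A0 by (intro mult_right_mono) auto
    then show "(\<Sum>k\<in>kbad. 2 * A) \<le> (real n / 4) * (2 * A)" by simp
  qed
  finally have "n * A \<le> n * (32 * B\<^sup>2) + 4 * ((\<Sum>i<n. a i) \<bullet> (\<Sum>j<n. b j))" by (simp add: algebra_simps)
  then have "A \<le> 32 * B\<^sup>2 + 4 / n * ((\<Sum>i<n. a i) \<bullet> (\<Sum>j<n. b j))" using n by (simp add: field_simps)
  then show ?thesis by (simp add: A_def)
qed

section \<open>Empirical remainder terms\<close>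

lemma L2norm_leD:
  fixes f :: "'z \<Rightarrow> 'b::{real_normed_vector, second_countable_topology}"
  assumes [measurable]: "f \<in> borel_measurable P" and le: "L2norm P f \<le> ennreal d" and d: "d \<ge> 0"
  shows "integrable P (\<lambda>z. (norm (f z))\<^sup>2)" "(\<integral>z. (norm (f z))\<^sup>2 \<partial>P) \<le> d\<^sup>2"
proof -
  define I where "I = (\<integral>\<^sup>+ z. ennreal ((norm (f z))\<^sup>2) \<partial>P)"
  have top: "I \<noteq> \<top>" using le by (auto simp: L2norm_def I_def[symmetric] top_unique)
  show int: "integrable P (\<lambda>z. (norm (f z))\<^sup>2)"
    using top by (intro integrableI_bounded) (auto simp: I_def[symmetric] less_top)
  have "ennreal (sqrt (enn2real I)) \<le> ennreal d"
    using le top by (simp add: L2norm_def I_def[symmetric])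
  then have "sqrt (enn2real I) \<le> d" using d by simp
  then have "enn2real I \<le> d\<^sup>2" using d by (metis real_sqrt_le_iff real_sqrt_abs abs_of_nonneg)
  moreover have "(\<integral>z. (norm (f z))\<^sup>2 \<partial>P) = enn2real I"
    unfolding I_def by (intro integral_eq_nn_integral) auto
  ultimately show "(\<integral>z. (norm (f z))\<^sup>2 \<partial>P) \<le> d\<^sup>2" by simp
qed

lemma (in sigma_finite_measure) L2norm_measurable:
  fixes f :: "'w \<Rightarrow> 'a \<Rightarrow> 'b::{real_normed_vector, second_countable_topology}"
  assumes [measurable]: "(\<lambda>(w, z). f w z) \<in> borel_measurable (N \<Otimes>\<^sub>M M)"
  shows "(\<lambda>w. L2norm M (f w)) \<in> borel_measurable N"
  unfolding L2norm_def Let_def by measurable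

text \<open>Nonnegativity of the variance, which avoids a separate appeal to Jensen's
  inequality.\<close>

lemma norm_integral_le_L2norm:
  fixes f :: "'z \<Rightarrow> 'h::{real_inner, banach, second_countable_topology}"
  assumes P: "prob_space P" and f: "f \<in> borel_measurable P" and le: "L2norm P f \<le> ennreal d" and d: "d \<ge> 0"
  shows "norm (\<integral>z. f z \<partial>P) \<le> d"
proof -
  interpret prob_space P by fact
  note * = L2norm_leD[OF f le d]
  have "0 \<le> (\<integral>z. (norm (f z - (\<integral>z. f z \<partial>P)))\<^sup>2 \<partial>P)" by (intro Bochner_Integration.integral_nonneg) auto
  then have "(norm (\<integral>z. f z \<partial>P))\<^sup>2 \<le> d\<^sup>2"
    using integral_norm_sq_centered[OF f *(1)] *(2) by simp
  then show ?thesis using d by (rule power2_le_imp_le)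
qed

context two_sample
begin

lemma sample_meas:
  fixes g :: "'w \<Rightarrow> 'z \<Rightarrow> 'b::topological_space"
  assumes g: "(\<lambda>(w, z). g w z) \<in> borel_measurable (M \<Otimes>\<^sub>M P)" and i: "1 \<le> i"
  shows "(\<lambda>w. g w (Z i w)) \<in> borel_measurable M"
  using measurable_compose[OF measurable_Pair[OF measurable_ident_sets[OF refl] Z_meas[OF i]] g] by simp

text \<open>Given the \<sigma>-algebra \<open>F n\<close> the estimate is a fixed function and the
  block is still i.i.d. Both the squared norm of the centered sum and the mean square then have
  conditional mean at most the squared L2 distance to \<phi>.\<close>

lemma constructed_indep_block:
  fixes g :: "nat \<Rightarrow> 'w \<Rightarrow> 'z \<Rightarrow> 'h"
  assumes con: "constructed_indep M P Z I g"
    and small: "((\<lambda>(n, w). L2norm P (\<lambda>z. g n w z - \<phi> z)) \<longlongrightarrow> 0) (inprob M)"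
    and I: "\<And>n. finite (I n)" "\<And>n. I n \<subseteq> {1..}" "\<And>n. card (I n) = n"
  shows "((\<lambda>(n, w). (1 / sqrt n) *\<^sub>R (\<Sum>i\<in>I n. g n w (Z i w) - \<phi> (Z i w) - (\<integral>z. g n w z - \<phi> z \<partial>P))) \<longlongrightarrow> 0) (inprob M)"
    and "((\<lambda>(n, w). (1 / n) * (\<Sum>i\<in>I n. (norm (g n w (Z i w) - \<phi> (Z i w)))\<^sup>2)) \<longlongrightarrow> 0) (inprob M)"
proof -
  have "\<exists>F. \<forall>n. subalgebra M (F n) \<and> (\<lambda>(w, z). g n w z) \<in> borel_measurable (F n \<Otimes>\<^sub>M P) \<and>
    indep_set (sets (F n)) (sets (vimage_algebra (space M) (\<lambda>w. \<lambda>i\<in>I n. Z i w) (Pi\<^sub>M (I n) (\<lambda>_. P))))"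
    using con unfolding constructed_indep_def by (rule choice)
  then obtain F where "\<forall>n. subalgebra M (F n) \<and> (\<lambda>(w, z). g n w z) \<in> borel_measurable (F n \<Otimes>\<^sub>M P) \<and>
    indep_set (sets (F n)) (sets (vimage_algebra (space M) (\<lambda>w. \<lambda>i\<in>I n. Z i w) (Pi\<^sub>M (I n) (\<lambda>_. P))))" ..
  then have F: "subalgebra M (F n)" "(\<lambda>(w, z). g n w z) \<in> borel_measurable (F n \<Otimes>\<^sub>M P)"
    "indep_set (sets (F n)) (sets (vimage_algebra (space M) (\<lambda>w. \<lambda>i\<in>I n. Z i w) (Pi\<^sub>M (I n) (\<lambda>_. P))))" for n
    by simp_all
  have Zm: "(\<lambda>w. \<lambda>i\<in>I n. Z i w) \<in> measurable M (Pi\<^sub>M (I n) (\<lambda>_. P))" for n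
    by (intro measurable_restrict Z_meas) (use I(2)[of n] in auto)
  \<comment> \<open>Conditioning on \<open>F n\<close> is expressed by the identity map into
    \<open>F n\<close>; in the kernels below, the outcome w enters only through the estimate and the
    data only through d.\<close>
  have ind: "independent_rv M (F n) (\<lambda>w. w) (Pi\<^sub>M (I n) (\<lambda>_. P)) (\<lambda>w. \<lambda>i\<in>I n. Z i w)" for n
  proof (rule independent_rvI[OF _ Zm])
    show "(\<lambda>w. w) \<in> measurable M (F n)"
      using F(1)[of n] by (auto simp: subalgebra_def measurable_def sets.Int_space_eq2[of _ M])
    fix A B assume AB: "A \<in> sets (F n)" "B \<in> sets (Pi\<^sub>M (I n) (\<lambda>_. P))"
    have "A \<inter> space M = A" using AB(1) F(1)[of n] sets.sets_into_space[of A "F n"] by (auto simp: subalgebra_def)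
    moreover have "(\<lambda>w. \<lambda>i\<in>I n. Z i w) -` B \<inter> space M \<in> sets (vimage_algebra (space M) (\<lambda>w. \<lambda>i\<in>I n. Z i w) (Pi\<^sub>M (I n) (\<lambda>_. P)))"
      by (rule in_vimage_algebra[OF AB(2)])
    ultimately show "prob ((\<lambda>w. w) -` A \<inter> space M \<inter> ((\<lambda>w. \<lambda>i\<in>I n. Z i w) -` B \<inter> space M)) =
       prob ((\<lambda>w. w) -` A \<inter> space M) * prob ((\<lambda>w. \<lambda>i\<in>I n. Z i w) -` B \<inter> space M)"
      using indep_setD[OF F(3) AB(1)] by simp
  qed
  have [measurable]: "(\<lambda>(w, z). g n w z) \<in> borel_measurable (F n \<Otimes>\<^sub>M P)" for n by (rule F(2))
  have gw[measurable]: "g n w \<in> borel_measurable P" if "w \<in> space M" for n w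
  proof -
    have "w \<in> space (F n)" using that F(1)[of n] by (simp add: subalgebra_def)
    from measurable_compose[OF measurable_Pair1'[OF this] F(2)] show ?thesis by simp
  qed
  have ev: "\<forall>\<^sub>F (n, w) in inprob M. w \<in> space M \<and> 0 < n \<and> L2norm P (\<lambda>z. g n w z - \<phi> z) \<le> ennreal (sqrt d)" if "d > 0" for d
    using ennreal_tendsto_0D[OF small, of "sqrt d"] inprob_space inprob_sequentially[OF eventually_gt_at_top[of 0]] that
    by (auto elim!: eventually_elim2 simp: case_prod_unfold eventually_conj_iff)
  define K1 where "K1 n = (\<lambda>(w, d). ennreal ((norm ((1 / sqrt (real n)) *\<^sub>R (\<Sum>i\<in>I n. g n w (d i) - \<phi> (d i) - (\<integral>z. g n w z - \<phi> z \<partial>P))))\<^sup>2))" for n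
  define K2 where "K2 n = (\<lambda>(w, d). ennreal ((1 / real n) * (\<Sum>i\<in>I n. (norm (g n w (d i) - \<phi> (d i)))\<^sup>2)))" for n
  have K1: "K1 n \<in> borel_measurable (F n \<Otimes>\<^sub>M Pi\<^sub>M (I n) (\<lambda>_. P))" for n
    unfolding K1_def using I(1) by measurable
  have K2: "K2 n \<in> borel_measurable (F n \<Otimes>\<^sub>M Pi\<^sub>M (I n) (\<lambda>_. P))" for n
    unfolding K2_def using I(1) by measurable
  have lim1: "((\<lambda>(n, w). \<integral>\<^sup>+w'. K1 n (w, \<lambda>i\<in>I n. Z i w') \<partial>M) \<longlongrightarrow> 0) (inprob M)"
  proof (rule ennreal_tendsto_0I)
    fix e :: real assume e: "e > 0"
    show "\<forall>\<^sub>F x in inprob M. (case x of (n, w) \<Rightarrow> \<integral>\<^sup>+w'. K1 n (w, \<lambda>i\<in>I n. Z i w') \<partial>M) \<le> ennreal e"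
      using ev[OF e]
    proof (eventually_elim, clarify)
      fix n w assume w: "w \<in> space M" and n: "(0::nat) < n" and L: "L2norm P (\<lambda>z. g n w z - \<phi> z) \<le> ennreal (sqrt e)"
      define h where "h z = g n w z - \<phi> z" for z
      have h[measurable]: "h \<in> borel_measurable P" unfolding h_def using w by measurable
      note L2 = L2norm_leD[OF h L[folded h_def] real_sqrt_ge_zero[OF less_imp_le[OF e]]]
      note mom = iid_second_moment[OF prob_M iid_sample_subset[OF prob_M Z I(2)] I(1) h L2(1)]
      have "(\<integral>\<^sup>+w'. K1 n (w, \<lambda>i\<in>I n. Z i w') \<partial>M) = (\<integral>\<^sup>+w'. ennreal ((1 / n) * (norm (\<Sum>i\<in>I n. h (Z i w') - (\<integral>z. h z \<partial>P)))\<^sup>2) \<partial>M)"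
        by (intro nn_integral_cong) (simp add: K1_def h_def power_mult_distrib power_divide)
      also have "\<dots> = ennreal ((1 / n) * (\<integral>w'. (norm (\<Sum>i\<in>I n. h (Z i w') - (\<integral>z. h z \<partial>P)))\<^sup>2 \<partial>M))"
        using mom(1) e by (subst nn_integral_eq_integral) auto
      also have "\<dots> \<le> ennreal ((1 / n) * (n * e))"
      proof (intro ennreal_leI mult_left_mono)
        have "real (card (I n)) * (\<integral>z. (norm (h z))\<^sup>2 \<partial>P) \<le> n * e"
          using L2(2) e I(3)[of n] by (intro mult_mono) auto
        then show "(\<integral>w'. (norm (\<Sum>i\<in>I n. h (Z i w') - (\<integral>z. h z \<partial>P)))\<^sup>2 \<partial>M) \<le> n * e"
          by (rule order_trans[OF mom(2)])
      qed simp
      also have "\<dots> = ennreal e" using n by simp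
      finally show "(\<integral>\<^sup>+w'. K1 n (w, \<lambda>i\<in>I n. Z i w') \<partial>M) \<le> ennreal e" .
    qed
  qed
  have lim2: "((\<lambda>(n, w). \<integral>\<^sup>+w'. K2 n (w, \<lambda>i\<in>I n. Z i w') \<partial>M) \<longlongrightarrow> 0) (inprob M)"
  proof (rule ennreal_tendsto_0I)
    fix e :: real assume e: "e > 0"
    show "\<forall>\<^sub>F x in inprob M. (case x of (n, w) \<Rightarrow> \<integral>\<^sup>+w'. K2 n (w, \<lambda>i\<in>I n. Z i w') \<partial>M) \<le> ennreal e"
      using ev[OF e]
    proof (eventually_elim, clarify)
      fix n w assume w: "w \<in> space M" and n: "(0::nat) < n" and L: "L2norm P (\<lambda>z. g n w z - \<phi> z) \<le> ennreal (sqrt e)"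
      define h where "h z = g n w z - \<phi> z" for z
      have h[measurable]: "h \<in> borel_measurable P" unfolding h_def using w by measurable
      note L2 = L2norm_leD[OF h L[folded h_def] real_sqrt_ge_zero[OF less_imp_le[OF e]]]
      have i: "integrable M (\<lambda>w'. (norm (h (Z i w')))\<^sup>2)" "(\<integral>w'. (norm (h (Z i w')))\<^sup>2 \<partial>M) = (\<integral>z. (norm (h z))\<^sup>2 \<partial>P)" if "i \<in> I n" for i
        using iid_sampleD[OF prob_M Z, of i] that I(2)[of n] L2(1) e integrable_distr_eq[of "Z i" M P "\<lambda>z. (norm (h z))\<^sup>2"]
          integral_distr[of "Z i" M P "\<lambda>z. (norm (h z))\<^sup>2"] by auto
      have "(\<integral>\<^sup>+w'. K2 n (w, \<lambda>i\<in>I n. Z i w') \<partial>M) = (\<integral>\<^sup>+w'. ennreal ((1 / n) * (\<Sum>i\<in>I n. (norm (h (Z i w')))\<^sup>2)) \<partial>M)"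
        by (intro nn_integral_cong) (simp add: K2_def h_def)
      also have "\<dots> = ennreal (\<integral>w'. (1 / n) * (\<Sum>i\<in>I n. (norm (h (Z i w')))\<^sup>2) \<partial>M)"
        using i(1) by (intro nn_integral_eq_integral integrable_mult_right Bochner_Integration.integrable_sum) (auto intro!: sum_nonneg divide_nonneg_nonneg)
      also have "(\<integral>w'. (1 / n) * (\<Sum>i\<in>I n. (norm (h (Z i w')))\<^sup>2) \<partial>M) = (1 / n) * (\<Sum>i\<in>I n. (\<integral>z. (norm (h z))\<^sup>2 \<partial>P))"
        using i by (simp add: Bochner_Integration.integral_sum)
      also have "\<dots> = (\<integral>z. (norm (h z))\<^sup>2 \<partial>P)" using n I(3)[of n] by simp
      also have "ennreal \<dots> \<le> ennreal e" using L2(2) e by (intro ennreal_leI) simp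
      finally show "(\<integral>\<^sup>+w'. K2 n (w, \<lambda>i\<in>I n. Z i w') \<partial>M) \<le> ennreal e" .
    qed
  qed
  have c1: "((\<lambda>(n, w). K1 n (w, \<lambda>i\<in>I n. Z i w)) \<longlongrightarrow> 0) (inprob M)"
    by (rule inprob_conditional_Markov[OF ind K1 lim1])
  have c2: "((\<lambda>(n, w). K2 n (w, \<lambda>i\<in>I n. Z i w)) \<longlongrightarrow> 0) (inprob M)"
    by (rule inprob_conditional_Markov[OF ind K2 lim2])
  have "((\<lambda>(n, w). norm ((1 / sqrt n) *\<^sub>R (\<Sum>i\<in>I n. g n w (Z i w) - \<phi> (Z i w) - (\<integral>z. g n w z - \<phi> z \<partial>P)))) \<longlongrightarrow> 0) (inprob M)"
    by (rule tendsto_enn_imp_real) (use c1 in \<open>simp add: K1_def cong: sum.cong\<close>)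
  then show "((\<lambda>(n, w). (1 / sqrt n) *\<^sub>R (\<Sum>i\<in>I n. g n w (Z i w) - \<phi> (Z i w) - (\<integral>z. g n w z - \<phi> z \<partial>P))) \<longlongrightarrow> 0) (inprob M)"
    unfolding case_prod_unfold by (rule tendsto_norm_zero_cancel)
  have "((\<lambda>x. ennreal ((1 / real (fst x)) * (\<Sum>i\<in>I (fst x). (norm (g (fst x) (snd x) (Z i (snd x)) - \<phi> (Z i (snd x))))\<^sup>2))) \<longlongrightarrow> ennreal 0) (inprob M)"
    using c2 by (simp add: K2_def case_prod_unfold cong: sum.cong)
  then show "((\<lambda>(n, w). (1 / n) * (\<Sum>i\<in>I n. (norm (g n w (Z i w) - \<phi> (Z i w)))\<^sup>2)) \<longlongrightarrow> 0) (inprob M)"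
    unfolding case_prod_unfold by (subst (asm) tendsto_ennreal_iff) (auto intro!: always_eventually divide_nonneg_nonneg sum_nonneg)
qed

end

context two_sample
begin

text \<open>
  The mixed samples turn equicontinuity into a symmetrization: their differences are Rademacher sums
  of \<open>h(Z\<^sub>i) - h(Z'\<^sub>j)\<close>, and averaging over the cyclic shift forces \<open>h\<close> to be nearly constant on the
  sample, hence small because its empirical mean is small.
\<close>

lemma equicontinuous_block:
  fixes g :: "nat \<Rightarrow> 'w \<Rightarrow> 'z \<Rightarrow> 'h"
  assumes g: "\<And>n. (\<lambda>(w, z). g n w z) \<in> borel_measurable (M \<Otimes>\<^sub>M P)"
    and equi: "asymp_equicontinuous M P G \<phi>" and mem: "\<And>n. AE w in M. g n w \<in> G"
    and small: "((\<lambda>(n, w). L2norm P (\<lambda>z. g n w z - \<phi> z)) \<longlongrightarrow> 0) (inprob M)"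
    and inj: "\<And>n. inj_on (s n) {..<n}" "\<And>n. inj_on (s' n) {..<n}"
    and disj: "\<And>n. s n ` {..<n} \<inter> s' n ` {..<n} = {}"
    and pos: "\<And>n i. 1 \<le> s n i" "\<And>n i. 1 \<le> s' n i"
  shows "((\<lambda>(n, w). (1 / sqrt n) *\<^sub>R (\<Sum>i<n. g n w (Z (s n i) w) - \<phi> (Z (s n i) w) - (\<integral>z. g n w z - \<phi> z \<partial>P))) \<longlongrightarrow> 0) (inprob M)"
    and "((\<lambda>(n, w). (1 / n) * (\<Sum>i<n. (norm (g n w (Z (s n i) w) - \<phi> (Z (s n i) w)))\<^sup>2)) \<longlongrightarrow> 0) (inprob M)"
proof -
  define h where "h n w z = g n w z - \<phi> z" for n w z
  define m where "m n w = (\<integral>z. h n w z \<partial>P)" for n w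
  define c where "c n k E = mix n (s n) (s' n) k E" for n k E
  define R where "R n k E w = norm ((1 / sqrt (real n)) *\<^sub>R (\<Sum>i<n. h n w (Z (c n k E i) w) - m n w))" for n k E w
  have c_pos: "1 \<le> c n k E i" for n k E i using pos by (simp add: c_def mix_def)
  \<comment> \<open>The two index maps have disjoint ranges and a cyclic shift is a bijection, so a
    mixed sample never uses a point twice and is again i.i.d.\<close>
  have c_inj: "inj_on (c n k E) {..<n}" for n k E
  proof (rule inj_onI)
    fix i j assume ij: "i \<in> {..<n}" "j \<in> {..<n}" and eq: "c n k E i = c n k E j"
    have n: "n > 0" using ij by auto
    have inI: "(i + k) mod n \<in> {..<n}" "(j + k) mod n \<in> {..<n}" using n by auto
    have ne: "s n a \<noteq> s' n b" if "a \<in> {..<n}" "b \<in> {..<n}" for a b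
      using disj[of n] that by (auto simp: disjoint_iff)
    show "i = j"
    proof (cases "i \<in> E"; cases "j \<in> E")
      assume "i \<in> E" "j \<in> E"
      then show ?thesis using eq inj_onD[OF inj(1)] ij by (simp add: c_def mix_def)
    next
      assume "i \<notin> E" "j \<notin> E"
      then have "(i + k) mod n = (j + k) mod n"
        using eq inj_onD[OF inj(2) _ inI] by (simp add: c_def mix_def)
      then show ?thesis
        using inj_onD[OF bij_betw_imp_inj_on[OF bij_betw_shift_mod[OF n, of k]] _ ij] by simp
    next
      assume "i \<in> E" "j \<notin> E"
      then show ?thesis using eq ne[OF ij(1) inI(2)] by (simp add: c_def mix_def)
    next
      assume "i \<notin> E" "j \<in> E"
      then show ?thesis using eq ne[OF ij(2) inI(1)] by (simp add: c_def mix_def)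
    qed
  qed
  note g[measurable]
  have gw: "g n w \<in> borel_measurable P" if "w \<in> space M" for n w
    using measurable_compose[OF measurable_Pair1'[OF that] g] by simp
  have h_meas: "(\<lambda>(w, z). h n w z) \<in> borel_measurable (M \<Otimes>\<^sub>M P)" for n
    unfolding h_def by measurable
  have hZ[measurable]: "(\<lambda>w. h n w (Z i w)) \<in> borel_measurable M" if "1 \<le> i" for n i
    by (rule sample_meas[OF h_meas that])
  have m_meas[measurable]: "m n \<in> borel_measurable M" for n
    unfolding m_def using h_meas by measurable
  have R_meas[measurable]: "R n k E \<in> borel_measurable M" for n k E
    unfolding R_def
    by (rule measurable_compose[OF _ borel_measurable_norm],
        intro borel_measurable_scaleR borel_measurable_const borel_measurable_sum borel_measurable_diff m_meas hZ c_pos)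

  \<comment> \<open>Equicontinuity asks for membership in the class at every outcome. Replacing the
    estimate by \<phi> on a null set provides it and leaves all limits in probability
    unchanged.\<close>
  have "\<exists>N. \<forall>n. N n \<in> null_sets M \<and> {w\<in>space M. g n w \<notin> G} \<subseteq> N n"
    using mem unfolding eventually_ae_filter by (intro choice) blast
  then obtain N where N: "N n \<in> null_sets M" "{w\<in>space M. g n w \<notin> G} \<subseteq> N n" for n by auto
  have N_sets[measurable]: "N n \<in> sets M" for n using N(1) by auto
  have AE_N: "AE w in M. w \<notin> N n" for n using N(1) by (rule AE_not_in)
  define g' where "g' n w = (if w \<in> N n then \<phi> else g n w)" for n w
  have G\<phi>: "\<phi> \<in> G" and Gint: "\<And>f. f \<in> G \<Longrightarrow> integrable P f"
    using equi by (auto simp: asymp_equicontinuous_def)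
  have g'_meas: "(\<lambda>(w, z). g' n w z) \<in> borel_measurable (M \<Otimes>\<^sub>M P)" for n
  proof -
    have "(\<lambda>(w, z). g' n w z) = (\<lambda>(w, z). if w \<in> N n then \<phi> z else g n w z)"
      by (auto simp: g'_def fun_eq_iff)
    also have "\<dots> \<in> borel_measurable (M \<Otimes>\<^sub>M P)" by measurable
    finally show ?thesis .
  qed
  have g'_G: "g' n w \<in> G" if "w \<in> space M" for n w
    using N(2)[of n] G\<phi> that by (auto simp: g'_def)
  have small': "small_o_P M (\<lambda>n w. L2norm P (\<lambda>z. g' n w z - \<phi> z)) (\<lambda>_. 1)"
  proof (rule tendsto_imp_small_o_P, rule Lim_transform_eventually[OF small])
    have "\<forall>\<^sub>F (n, w) in inprob M. w \<notin> N n" by (rule eventually_inprob_AE[OF AE_N])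
    then show "\<forall>\<^sub>F x in inprob M. (case x of (n, w) \<Rightarrow> L2norm P (\<lambda>z. g n w z - \<phi> z)) = (case x of (n, w) \<Rightarrow> L2norm P (\<lambda>z. g' n w z - \<phi> z))"
      by eventually_elim (auto simp: g'_def)
  qed

  \<comment> \<open>For each deterministic sequence of patterns (k n, E n), equicontinuity is
    applied to the corresponding mixed sample with the same estimate.\<close>
  have lim_choice: "(\<lambda>n. measure M {w\<in>space M. R n (k n) (E n) w > \<eta>}) \<longlonglongrightarrow> 0" if \<eta>: "\<eta> > 0" for \<eta> k E
  proof -
    \<comment> \<open>Samples in the definition of equicontinuity are indexed from 1 to n, the
      patterns from 0 to n - 1.\<close>
    define S where "S n i = Z (c n (k n) (E n) (i - 1))" for n and i :: nat
    have S: "iid_sample M P {1..n} (S n)" for n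
      unfolding S_def
    proof (rule iid_sample_reindex[OF prob_M Z])
      show "inj_on (\<lambda>i. c n (k n) (E n) (i - 1)) {1..n}"
        using inj_onD[OF c_inj] by (intro inj_onI) (force dest: inj_onD[OF c_inj])
      show "(\<lambda>i. c n (k n) (E n) (i - 1)) ` {1..n} \<subseteq> {1..}" using c_pos by auto
    qed
    define X where "X n w = norm (emp_process P n (\<lambda>i. S n i w) (g' n w) - emp_process P n (\<lambda>i. S n i w) \<phi>)" for n w
    have "small_o_P M (\<lambda>n w. ennreal (X n w)) (\<lambda>_. 1)"
      using equi S g'_meas g'_G small' unfolding asymp_equicontinuous_def X_def by blast
    then have lim: "(\<lambda>n. measure M {w\<in>space M. X n w > \<eta>}) \<longlonglongrightarrow> 0"
      using \<eta> by (auto simp: small_o_P_def X_def ennreal_less_iff)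
    have S_meas[measurable]: "S n i \<in> measurable M P" for n i
      unfolding S_def by (rule Z_meas[OF c_pos])
    have [measurable]: "X n \<in> borel_measurable M" for n
    proof -
      have 1: "(\<lambda>w. g' n w (S n i w)) \<in> borel_measurable M" for i
        unfolding S_def by (rule sample_meas[OF g'_meas c_pos])
      have 2: "(\<lambda>w. \<integral>u. g' n w u \<partial>P) \<in> borel_measurable M"
        by (rule P.borel_measurable_lebesgue_integral[OF g'_meas])
      have 3: "(\<lambda>w. \<phi> (S n i w)) \<in> borel_measurable M" for i by measurable
      show ?thesis
        unfolding X_def emp_process_def
        by (rule measurable_compose[OF _ borel_measurable_norm],
            intro borel_measurable_scaleR borel_measurable_const borel_measurable_sum borel_measurable_diff 1 2 3)
    qed
    have eq: "X n w = R n (k n) (E n) w" if w: "w \<in> space M" "w \<notin> N n" and n: "n > 0" for n w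
    proof -
      have int: "integrable P (g n w)" "integrable P \<phi>"
        using N(2)[of n] w Gint G\<phi> by auto
      have sh: "(\<Sum>i = 1..n. f (S n i w)) = (\<Sum>i<n. f (Z (c n (k n) (E n) i) w))" for f :: "'z \<Rightarrow> 'h"
        unfolding S_def by (rule sum.reindex_bij_witness[of _ Suc "\<lambda>i. i - 1"]) auto
      have "emp_process P n (\<lambda>i. S n i w) (g' n w) - emp_process P n (\<lambda>i. S n i w) \<phi> =
          sqrt n *\<^sub>R ((1 / n) *\<^sub>R (\<Sum>i<n. h n w (Z (c n (k n) (E n) i) w)) - m n w)"
        unfolding emp_process_def sh using int w by (simp add: g'_def h_def m_def sum_subtractf scaleR_diff_right algebra_simps)
      also have "\<dots> = (1 / sqrt n) *\<^sub>R (\<Sum>i<n. h n w (Z (c n (k n) (E n) i) w) - m n w)"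
      proof -
        have "sqrt (real n) * (1 / real n) = 1 / sqrt n" "sqrt (real n) = (1 / sqrt n) * n"
          using n by (simp_all add: field_simps)
        then show ?thesis
          by (simp add: sum_subtractf scaleR_diff_right sum_constant_scaleR)
      qed
      finally show ?thesis by (simp add: X_def R_def)
    qed
    have "\<forall>\<^sub>F n in sequentially. measure M {w\<in>space M. X n w > \<eta>} = measure M {w\<in>space M. R n (k n) (E n) w > \<eta>}"
      using eventually_gt_at_top[of 0]
    proof eventually_elim
      case (elim n)
      show ?case
      proof (rule measure_eq_AE)
        show "AE w in M. (w \<in> {w\<in>space M. X n w > \<eta>}) = (w \<in> {w\<in>space M. R n (k n) (E n) w > \<eta>})"
          using AE_N[of n] AE_space by eventually_elim (use eq elim in auto)
      qed measurable
    qed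
    then show ?thesis by (rule Lim_transform_eventually[OF lim])
  qed

  \<comment> \<open>Choosing for each n a violating pattern whenever there is one yields a single
    sequence to which \<open>lim_choice\<close> applies; this makes the bound uniform over all
    patterns.\<close>
  have lim_uniform: "\<forall>\<^sub>F n in sequentially. \<forall>k E. measure M {w\<in>space M. R n k E w > \<eta>} \<le> \<delta>" if \<eta>: "\<eta> > 0" and \<delta>: "\<delta> > 0" for \<eta> \<delta>
  proof -
    have "\<exists>p. (\<exists>k E. measure M {w\<in>space M. R n k E w > \<eta>} > \<delta>) \<longrightarrow> measure M {w\<in>space M. R n (fst p) (snd p) w > \<eta>} > \<delta>" for n
      by fastforce
    then have "\<exists>p. \<forall>n. (\<exists>k E. measure M {w\<in>space M. R n k E w > \<eta>} > \<delta>) \<longrightarrow> measure M {w\<in>space M. R n (fst (p n)) (snd (p n)) w > \<eta>} > \<delta>"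
      by (intro choice) blast
    then obtain p where p: "\<And>n k E. measure M {w\<in>space M. R n k E w > \<eta>} > \<delta> \<Longrightarrow> measure M {w\<in>space M. R n (fst (p n)) (snd (p n)) w > \<eta>} > \<delta>"
      by blast
    have "\<forall>\<^sub>F n in sequentially. measure M {w\<in>space M. R n (fst (p n)) (snd (p n)) w > \<eta>} < \<delta>"
      using order_tendstoD(2)[OF lim_choice[OF \<eta>] \<delta>] .
    then show ?thesis
    proof eventually_elim
      case (elim n)
      show ?case
      proof (intro allI, rule ccontr)
        fix k E assume "\<not> measure M {w\<in>space M. R n k E w > \<eta>} \<le> \<delta>"
        then have "measure M {w\<in>space M. R n k E w > \<eta>} > \<delta>" by simp
        from p[OF this] elim show False by simp
      qed
    qed
  qed

  have R_tendsto: "((\<lambda>(n, w). R n (k n) (E n) w) \<longlongrightarrow> 0) (inprob M)" for k E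
  proof (rule tendstoI)
    fix e :: real assume e: "e > 0"
    have "\<forall>\<^sub>F (n, w) in inprob M. R n (k n) (E n) w \<le> e/2"
      using lim_choice[of "e/2" k E] e by (intro eventually_inprobI) (auto simp: not_le)
    then show "\<forall>\<^sub>F x in inprob M. dist (case x of (n, w) \<Rightarrow> R n (k n) (E n) w) 0 < e"
    proof eventually_elim
      case (elim x)
      obtain n w where x: "x = (n, w)" by (cases x)
      have "0 \<le> R n (k n) (E n) w" by (simp add: R_def)
      with elim e show ?case by (simp add: x dist_real_def)
    qed
  qed

  \<comment> \<open>The pattern E = UNIV takes all points from the first block, so the unmixed
    sample is one of the mixed ones. Later E = {} with k = 0 gives the other block.\<close>
  have "((\<lambda>(n, w). norm ((1 / sqrt n) *\<^sub>R (\<Sum>i<n. g n w (Z (s n i) w) - \<phi> (Z (s n i) w) - (\<integral>z. g n w z - \<phi> z \<partial>P)))) \<longlongrightarrow> 0) (inprob M)"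
    using R_tendsto[of "\<lambda>_. 0" "\<lambda>_. UNIV"] by (simp add: R_def h_def m_def c_def mix_def)
  then show first: "((\<lambda>(n, w). (1 / sqrt n) *\<^sub>R (\<Sum>i<n. g n w (Z (s n i) w) - \<phi> (Z (s n i) w) - (\<integral>z. g n w z - \<phi> z \<partial>P))) \<longlongrightarrow> 0) (inprob M)"
    unfolding case_prod_unfold by (rule tendsto_norm_zero_cancel)

  have m0: "((\<lambda>(n, w). norm (m n w)) \<longlongrightarrow> 0) (inprob M)"
  proof (rule tendstoI)
    fix e :: real assume e: "e > 0"
    have "\<forall>\<^sub>F x in inprob M. norm (m (fst x) (snd x)) < e"
      using ennreal_tendsto_0D[OF small half_gt_zero[OF e]] inprob_space
    proof eventually_elim
      case (elim x)
      obtain n w where x: "x = (n, w)" by (cases x)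
      have "norm (\<integral>z. g n w z - \<phi> z \<partial>P) \<le> e/2"
        using elim e by (intro norm_integral_le_L2norm[OF P.prob_space_axioms]) (auto simp: x gw)
      then show ?case using e by (simp add: x m_def h_def)
    qed
    then show "\<forall>\<^sub>F x in inprob M. dist (case x of (n, w) \<Rightarrow> norm (m n w)) 0 < e"
      by (simp add: case_prod_unfold)
  qed

  \<comment> \<open>The empirical mean of h is the population mean m, small by the L2 distance, plus
    a centered part that is small even before dividing sqrt n down to n.\<close>
  have avg: "((\<lambda>(n, w). norm ((1 / real n) *\<^sub>R (\<Sum>i<n. h n w (Z (c n (k n) (E n) i) w)))) \<longlongrightarrow> 0) (inprob M)" for k E
  proof (rule Lim_null_comparison)
    show "((\<lambda>x. (case x of (n, w) \<Rightarrow> R n (k n) (E n) w) + (case x of (n, w) \<Rightarrow> norm (m n w))) \<longlongrightarrow> 0) (inprob M)"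
      using tendsto_add[OF R_tendsto m0] by simp
    show "\<forall>\<^sub>F x in inprob M. norm (case x of (n, w) \<Rightarrow> norm ((1 / real n) *\<^sub>R (\<Sum>i<n. h n w (Z (c n (k n) (E n) i) w)))) \<le>
        (case x of (n, w) \<Rightarrow> R n (k n) (E n) w) + (case x of (n, w) \<Rightarrow> norm (m n w))"
      using inprob_sequentially[OF eventually_gt_at_top[of 0]]
    proof eventually_elim
      case (elim x)
      obtain n w where x: "x = (n, w)" by (cases x)
      have n: "n > 0" using elim by (simp add: x)
      define y where "y = (\<Sum>i<n. h n w (Z (c n (k n) (E n) i) w) - m n w)"
      have "(1 / real n) *\<^sub>R (\<Sum>i<n. h n w (Z (c n (k n) (E n) i) w)) = (1 / real n) *\<^sub>R y + m n w"
        using n by (simp add: y_def sum_subtractf scaleR_diff_right sum_constant_scaleR)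
      also have "norm \<dots> \<le> norm ((1 / real n) *\<^sub>R y) + norm (m n w)" by (rule norm_triangle_ineq)
      also have "norm ((1 / real n) *\<^sub>R y) \<le> R n (k n) (E n) w"
      proof -
        have "sqrt (real n) * 1 \<le> sqrt (real n) * sqrt (real n)" using n by (intro mult_left_mono) auto
        then have "sqrt (real n) \<le> real n" by simp
        then have "1 / real n \<le> 1 / sqrt (real n)" using n by (intro divide_left_mono) auto
        then show ?thesis unfolding R_def y_def[symmetric] norm_scaleR using n by (intro mult_right_mono) auto
      qed
      finally show ?case by (simp add: x)
    qed
  qed

  \<comment> \<open>Each pattern is good for most outcomes; here this is exchanged for most patterns
    being good at a given outcome. The expected fraction of bad patterns is at most \<delta> / 48,
    so by Markov's inequality it exceeds 1/48 with probability at most \<delta>.\<close>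
  have count: "\<forall>\<^sub>F (n, w) in inprob M. 48 * card {(k, E). k < n \<and> E \<subseteq> {..<n} \<and> R n k E w > \<eta>} \<le> n * 2 ^ n" if \<eta>: "\<eta> > 0" for \<eta>
    unfolding eventually_inprob
  proof (intro allI impI)
    fix \<delta> :: real assume \<delta>: "\<delta> > 0"
    then have d: "\<delta> / 48 > 0" by simp
    show "\<forall>\<^sub>F n in sequentially. fails_at_most M \<delta> (\<lambda>w. case (n, w) of (n, w) \<Rightarrow>
        48 * card {(k, E). k < n \<and> E \<subseteq> {..<n} \<and> R n k E w > \<eta>} \<le> n * 2 ^ n)"
      using lim_uniform[OF \<eta> d] eventually_gt_at_top[of 0]
    proof eventually_elim
      case (elim n)
      define J where "J = {..<n} \<times> Pow {..<n}"
      have J: "finite J" "card J = n * 2 ^ n" by (auto simp: J_def card_Pow card_cartesian_product)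
      define Y where "Y w = (\<Sum>p\<in>J. indicator {w\<in>space M. R n (fst p) (snd p) w > \<eta>} w :: real)" for w
      have card: "real (card {(k, E). k < n \<and> E \<subseteq> {..<n} \<and> R n k E w > \<eta>}) = Y w" if "w \<in> space M" for w
      proof -
        have "{(k, E). k < n \<and> E \<subseteq> {..<n} \<and> R n k E w > \<eta>} = {p\<in>J. R n (fst p) (snd p) w > \<eta>}"
          by (auto simp: J_def)
        moreover have "Y w = (\<Sum>p\<in>J. if R n (fst p) (snd p) w > \<eta> then 1 else 0)"
          unfolding Y_def using that by (intro sum.cong) (auto simp: indicator_def)
        ultimately show ?thesis using J(1) by (simp add: sum.If_cases Int_def)
      qed
      have int: "integrable M (\<lambda>w. indicator {w\<in>space M. R n (fst p) (snd p) w > \<eta>} w :: real)" for p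
        by (intro integrable_real_indicator) (auto simp: less_top[symmetric])
      have Yint: "integrable M Y" unfolding Y_def by (intro Bochner_Integration.integrable_sum int)
      have "(\<integral>w. Y w \<partial>M) = (\<Sum>p\<in>J. measure M {w\<in>space M. R n (fst p) (snd p) w > \<eta>})"
        unfolding Y_def by (subst Bochner_Integration.integral_sum[OF int]) (simp add: Int_absorb1 Collect_restrict)
      also have "\<dots> \<le> (\<Sum>p\<in>J. \<delta> / 48)" using elim(1) by (intro sum_mono) auto
      finally have EY: "(\<integral>w. Y w \<partial>M) \<le> (n * 2 ^ n) * (\<delta> / 48)" using J by simp
      define C where "C = {w\<in>space M. real (n * 2 ^ n) / 48 \<le> Y w}"
      have Ymeas[measurable]: "Y \<in> borel_measurable M" using Yint by auto
      have Y0: "Y w \<ge> 0" for w unfolding Y_def by (intro sum_nonneg) simp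
      have np: "real (n * 2 ^ n) / 48 > 0" using elim by simp
      have "measure M C \<le> (\<integral>w. Y w \<partial>M) / (real (n * 2 ^ n) / 48)"
        unfolding C_def using Yint np Y0 by (intro integral_Markov_inequality_measure[where A="{}"]) auto
      also have "\<dots> \<le> ((n * 2 ^ n) * (\<delta> / 48)) / (real (n * 2 ^ n) / 48)"
        using EY np by (intro divide_right_mono) auto
      also have "\<dots> = \<delta>" using elim by simp
      finally have "measure M C \<le> \<delta>" .
      moreover have "48 * card {(k, E). k < n \<and> E \<subseteq> {..<n} \<and> R n k E w > \<eta>} \<le> n * 2 ^ n" if "w \<in> space M - C" for w
      proof -
        have "real (48 * card {(k, E). k < n \<and> E \<subseteq> {..<n} \<and> R n k E w > \<eta>}) \<le> real (n * 2 ^ n)"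
          using that card[of w] by (auto simp: C_def not_le)
        then show ?thesis by (simp only: of_nat_le_iff)
      qed
      moreover have "C \<in> sets M" unfolding C_def by measurable
      ultimately show ?case by (intro bexI[of _ C]) auto
    qed
  qed

  have bound: "\<forall>\<^sub>F (n, w) in inprob M. (1 / n) * (\<Sum>i<n. (norm (h n w (Z (s n i) w)))\<^sup>2) \<le>
      32 * \<eta>\<^sup>2 + 4 * (norm ((1 / real n) *\<^sub>R (\<Sum>i<n. h n w (Z (s n i) w))) * norm ((1 / real n) *\<^sub>R (\<Sum>i<n. h n w (Z (s' n i) w))))" if \<eta>: "\<eta> > 0" for \<eta>
    using count[OF \<eta>] inprob_sequentially[OF eventually_gt_at_top[of 0]]
  proof (eventually_elim, clarify)
    fix n :: nat and w
    assume cnt: "48 * card {(k, E). k < n \<and> E \<subseteq> {..<n} \<and> R n k E w > \<eta>} \<le> n * 2 ^ n" and n: "0 < n"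
    define a where "a i = h n w (Z (s n i) w)" for i
    define b where "b i = h n w (Z (s' n i) w)" for i
    \<comment> \<open>Undoes the scaling by 1 / sqrt n in R; after division by n the term 32 * B^2
      becomes 32 * \<eta>^2.\<close>
    define B where "B = \<eta> * sqrt n"
    have B: "B \<ge> 0" "B\<^sup>2 = \<eta>\<^sup>2 * n" using \<eta> by (auto simp: B_def power_mult_distrib)
    have mixeq: "h n w (Z (c n k E i) w) = mix n a b k E i" for k E i
      by (simp add: c_def mix_def a_def b_def)
    have "(R n k E w > \<eta>) = (norm (\<Sum>i<n. mix n a b k E i - m n w) > B)" for k E
      using n by (simp add: R_def mixeq B_def field_simps)
    with cnt have "48 * card {(k, E). k < n \<and> E \<subseteq> {..<n} \<and> norm (\<Sum>i<n. mix n a b k E i - m n w) > B} \<le> n * 2 ^ n"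
      by simp
    from mixed_samples_bound[OF n B(1) this]
    have "(\<Sum>i<n. (norm (a i))\<^sup>2) \<le> 32 * B\<^sup>2 + 4 / n * ((\<Sum>i<n. a i) \<bullet> (\<Sum>j<n. b j))"
      using sum_nonneg[of "{..<n}" "\<lambda>j. (norm (b j))\<^sup>2"] by simp
    then have "(1 / n) * (\<Sum>i<n. (norm (a i))\<^sup>2) \<le> (1 / n) * (32 * B\<^sup>2 + 4 / n * ((\<Sum>i<n. a i) \<bullet> (\<Sum>j<n. b j)))"
      by (intro mult_left_mono) auto
    also have "\<dots> = 32 * \<eta>\<^sup>2 + 4 * (((1 / real n) *\<^sub>R (\<Sum>i<n. a i)) \<bullet> ((1 / real n) *\<^sub>R (\<Sum>j<n. b j)))"
      using n by (simp add: B field_simps)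
    also have "\<dots> \<le> 32 * \<eta>\<^sup>2 + 4 * (norm ((1 / real n) *\<^sub>R (\<Sum>i<n. a i)) * norm ((1 / real n) *\<^sub>R (\<Sum>j<n. b j)))"
      by (intro add_left_mono mult_left_mono norm_cauchy_schwarz) simp
    finally show "(1 / n) * (\<Sum>i<n. (norm (h n w (Z (s n i) w)))\<^sup>2) \<le>
      32 * \<eta>\<^sup>2 + 4 * (norm ((1 / real n) *\<^sub>R (\<Sum>i<n. h n w (Z (s n i) w))) * norm ((1 / real n) *\<^sub>R (\<Sum>i<n. h n w (Z (s' n i) w))))"
      by (simp only: a_def b_def)
  qed

  have avg1: "((\<lambda>(n, w). norm ((1 / real n) *\<^sub>R (\<Sum>i<n. h n w (Z (s n i) w)))) \<longlongrightarrow> 0) (inprob M)"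
    using avg[of "\<lambda>_. 0" "\<lambda>_. UNIV"] by (simp add: c_def mix_def)
  have avg2: "((\<lambda>(n, w). norm ((1 / real n) *\<^sub>R (\<Sum>i<n. h n w (Z (s' n i) w)))) \<longlongrightarrow> 0) (inprob M)"
  proof -
    have "(\<Sum>i<n. h n w (Z (c n 0 {} i) w)) = (\<Sum>i<n. h n w (Z (s' n i) w))" for n w
      by (intro sum.cong) (auto simp: c_def mix_def)
    then show ?thesis using avg[of "\<lambda>_. 0" "\<lambda>_. {}"] by simp
  qed
  have prod: "((\<lambda>x. 4 * ((case x of (n, w) \<Rightarrow> norm ((1 / real n) *\<^sub>R (\<Sum>i<n. h n w (Z (s n i) w)))) *
      (case x of (n, w) \<Rightarrow> norm ((1 / real n) *\<^sub>R (\<Sum>i<n. h n w (Z (s' n i) w)))))) \<longlongrightarrow> 0) (inprob M)"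
    using tendsto_mult_left[OF tendsto_mult[OF avg1 avg2], of 4] by simp
  have "((\<lambda>(n, w). (1 / n) * (\<Sum>i<n. (norm (h n w (Z (s n i) w)))\<^sup>2)) \<longlongrightarrow> 0) (inprob M)"
  proof (rule tendstoI)
    fix e :: real assume e: "e > 0"
    define \<eta> where "\<eta> = sqrt (e / 64)"
    have \<eta>: "\<eta> > 0" "32 * \<eta>\<^sup>2 = e/2" using e by (auto simp: \<eta>_def)
    show "\<forall>\<^sub>F x in inprob M. dist (case x of (n, w) \<Rightarrow> (1 / n) * (\<Sum>i<n. (norm (h n w (Z (s n i) w)))\<^sup>2)) 0 < e"
      using bound[OF \<eta>(1)] order_tendstoD(2)[OF prod half_gt_zero[OF e]]
    proof eventually_elim
      case (elim x)
      obtain n w where x: "x = (n, w)" by (cases x)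
      have "0 \<le> (1 / real n) * (\<Sum>i<n. (norm (h n w (Z (s n i) w)))\<^sup>2)"
        by (intro mult_nonneg_nonneg sum_nonneg) auto
      moreover have "(1 / real n) * (\<Sum>i<n. (norm (h n w (Z (s n i) w)))\<^sup>2) < e"
        using elim \<eta>(2) unfolding x split_conv by linarith
      ultimately show ?case unfolding x split_conv dist_real_def by linarith
    qed
  qed
  then show "((\<lambda>(n, w). (1 / n) * (\<Sum>i<n. (norm (g n w (Z (s n i) w) - \<phi> (Z (s n i) w)))\<^sup>2)) \<longlongrightarrow> 0) (inprob M)"
    by (simp add: h_def)
qed

end

section \<open>The bias of the estimated pseudo-outcome\<close>

text \<open>\<open>is_regression\<close> tests only against indicators. The component g (V)
  \<bullet> e is a version of the conditional expectation given the \<sigma>-algebra generated by V,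
  and this extends the identity to bounded test functions of V.\<close>

lemma is_regression_test:
  fixes U :: "'q \<Rightarrow> 'b::{real_inner, banach, second_countable_topology}"
  assumes Q: "prob_space Q" and reg: "is_regression Q U N V g"
    and u[measurable]: "u \<in> borel_measurable N" and bnd: "\<And>v. \<bar>u v\<bar> \<le> C"
  shows "integrable Q (\<lambda>w. u (V w) * (U w \<bullet> e))" "integrable Q (\<lambda>w. u (V w) * (g (V w) \<bullet> e))"
    "(\<integral>w. u (V w) * (U w \<bullet> e) \<partial>Q) = (\<integral>w. u (V w) * (g (V w) \<bullet> e) \<partial>Q)"
proof -
  interpret prob_space Q by fact
  have U: "integrable Q U" and V[measurable]: "V \<in> measurable Q N" and g[measurable]: "g \<in> borel_measurable N"
    and gV: "integrable Q (\<lambda>w. g (V w))"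
    and eq: "\<And>B. B \<in> sets N \<Longrightarrow> (LINT w:(V -` B \<inter> space Q)|Q. U w) = (LINT w:(V -` B \<inter> space Q)|Q. g (V w))"
    using reg by (auto simp: is_regression_def)
  have [measurable]: "U \<in> borel_measurable Q" using U by simp
  define F where "F = vimage_algebra (space Q) V N"
  have sub: "subalgebra Q F"
    using measurable_space[OF V] measurable_sets[OF V]
    by (auto simp: subalgebra_def F_def sets_vimage_algebra2[of V "space Q" N])
  interpret finite_measure_subalgebra Q F by standard (rule sub)
  have VF[measurable]: "V \<in> measurable F N"
    unfolding F_def using measurable_space[OF V] by (intro measurable_vimage_algebra1) auto
  have bdd: "integrable Q (\<lambda>w. u (V w) * f w)" if "integrable Q f" for f :: "'q \<Rightarrow> real"
  proof (rule Bochner_Integration.integrable_bound)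
    show "integrable Q (\<lambda>w. C * f w)" using that by simp
    show "(\<lambda>w. u (V w) * f w) \<in> borel_measurable Q" using that by measurable
    show "AE w in Q. norm (u (V w) * f w) \<le> norm (C * f w)"
      by (intro always_eventually allI) (simp add: abs_mult mult_right_mono order_trans[OF bnd abs_ge_self])
  qed
  have i: "integrable Q (\<lambda>w. U w \<bullet> e)" "integrable Q (\<lambda>w. g (V w) \<bullet> e)" using U gV by simp_all
  show 1: "integrable Q (\<lambda>w. u (V w) * (U w \<bullet> e))" "integrable Q (\<lambda>w. u (V w) * (g (V w) \<bullet> e))"
    using i by (auto intro: bdd)
  have "AE w in Q. real_cond_exp Q F (\<lambda>w. U w \<bullet> e) w = g (V w) \<bullet> e"
  proof (rule real_cond_exp_charact)
    fix A assume "A \<in> sets F"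
    then obtain B where B: "B \<in> sets N" "A = V -` B \<inter> space Q"
      using measurable_space[OF V] by (auto simp: F_def sets_vimage_algebra2[of V "space Q" N])
    have A[measurable]: "A \<in> sets Q" using B measurable_sets[OF V] by simp
    have inner: "(LINT w:A|Q. f w \<bullet> e) = (LINT w:A|Q. f w) \<bullet> e" if "integrable Q f" for f :: "'q \<Rightarrow> 'b"
    proof -
      have "integrable Q (\<lambda>w. indicator A w *\<^sub>R f w)" using that by (intro integrable_mult_indicator) auto
      then show ?thesis unfolding set_lebesgue_integral_def
        by (subst integral_inner_left[symmetric]) auto
    qed
    show "(LINT w:A|Q. U w \<bullet> e) = (LINT w:A|Q. g (V w) \<bullet> e)"
      using eq[OF B(1)] inner[OF U] inner[OF gV] B(2) by simp
  qed (use i in auto)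
  then have "(\<integral>w. u (V w) * (g (V w) \<bullet> e) \<partial>Q) = (\<integral>w. u (V w) * real_cond_exp Q F (\<lambda>w. U w \<bullet> e) w \<partial>Q)"
    by (intro integral_cong_AE) auto
  also have "\<dots> = (\<integral>w. u (V w) * (U w \<bullet> e) \<partial>Q)"
    using 1 by (intro real_cond_exp_intg(2)) auto
  finally show "(\<integral>w. u (V w) * (U w \<bullet> e) \<partial>Q) = (\<integral>w. u (V w) * (g (V w) \<bullet> e) \<partial>Q)" ..
qed

lemma nn_integral_le_L2norm_mult:
  fixes f :: "'z \<Rightarrow> real" and g :: "'z \<Rightarrow> 'b::{real_normed_vector, second_countable_topology}"
  assumes [measurable]: "f \<in> borel_measurable P" "g \<in> borel_measurable P"
  shows "(\<integral>\<^sup>+z. ennreal (\<bar>f z\<bar> * norm (g z)) \<partial>P) \<le> L2norm P f * L2norm P g"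
proof -
  define I where "I = (\<integral>\<^sup>+z. ennreal ((norm (f z))\<^sup>2) \<partial>P)"
  define J where "J = (\<integral>\<^sup>+z. ennreal ((norm (g z))\<^sup>2) \<partial>P)"
  define T where "T = (\<integral>\<^sup>+z. ennreal (\<bar>f z\<bar> * norm (g z)) \<partial>P)"
  have CS: "T\<^sup>2 \<le> I * J"
    using Cauchy_Schwarz_nn_integral[of "\<lambda>z. ennreal \<bar>f z\<bar>" P "\<lambda>z. ennreal (norm (g z))"]
    by (simp add: T_def I_def J_def ennreal_mult ennreal_power)
  have L: "L2norm P f = (if I = \<top> then \<top> else ennreal (sqrt (enn2real I)))" "L2norm P g = (if J = \<top> then \<top> else ennreal (sqrt (enn2real J)))"
    by (simp_all add: L2norm_def I_def J_def)
  \<comment> \<open>If one norm is 0 then so is T, in agreement with 0 * \<infinity> = 0; if both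
    are nonzero and one is infinite, the right side is infinite.\<close>
  have "T \<le> L2norm P f * L2norm P g"
  proof (cases "I = 0 \<or> J = 0")
    case True
    then have "T\<^sup>2 = 0" using CS by auto
    then show ?thesis by simp
  next
    case False
    show ?thesis
    proof (cases "I = \<top> \<or> J = \<top>")
      case True
      have pos: "ennreal (sqrt (enn2real x)) \<noteq> 0" if "x \<noteq> 0" "x \<noteq> \<top>" for x
        using that by (simp add: enn2real_eq_0_iff ennreal_eq_0_iff not_le enn2real_positive_iff less_top zero_less_iff_neq_zero)
      then have "L2norm P f * L2norm P g = \<top>"
        using True False pos[of I] pos[of J] by (auto simp: L ennreal_mult_top ennreal_top_mult)
      then show ?thesis by simp
    next
      case fin: False
      obtain i j where ij: "I = ennreal i" "J = ennreal j" "i \<ge> 0" "j \<ge> 0"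
        using fin by (metis ennreal_cases)
      have "T\<^sup>2 \<le> ennreal (i * j)" using CS ij by (simp add: ennreal_mult)
      then have "T \<noteq> \<top>" by (auto simp: top_unique ennreal_top_eq_mult_iff power2_eq_square)
      then obtain t where t: "T = ennreal t" "t \<ge> 0" by (metis ennreal_cases)
      have "t\<^sup>2 \<le> i * j" using \<open>T\<^sup>2 \<le> ennreal (i * j)\<close> t ij by (simp add: ennreal_power)
      then have "t \<le> sqrt i * sqrt j" using t by (simp add: real_sqrt_mult[symmetric] real_le_rsqrt)
      then show ?thesis using ij t fin by (simp add: L ennreal_mult[symmetric])
    qed
  qed
  then show ?thesis by (simp add: T_def)
qed

text \<open>The case distinction reduces measurability in (x, a, y) to that of the two functions
  \<open>b True\<close> and \<open>b False\<close>.\<close>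

lemma pseudo_outcome_eq:
  "pseudo_outcome kf p b (x, a, y) = (of_bool a / p x - (1 - of_bool a) / (1 - p x)) *\<^sub>R (kf y - (if a then b True x else b False x)) + b True x - b False x"
  by (simp add: pseudo_outcome_def)

locale regression_model = prob_space Q for Q :: "'q measure" +
  fixes MX :: "'x measure" and MY :: "'y measure" and X :: "'q \<Rightarrow> 'x" and A :: "'q \<Rightarrow> bool" and Y :: "'q \<Rightarrow> 'y"
    and P :: "('x \<times> bool \<times> 'y) measure" and \<epsilon> :: real and \<pi> :: "'x \<Rightarrow> real"
    and kf :: "'y \<Rightarrow> 'h::{real_inner, banach, second_countable_topology}" and \<beta> :: "bool \<Rightarrow> 'x \<Rightarrow> 'h"
  assumes X[measurable]: "X \<in> measurable Q MX"
    and A[measurable]: "A \<in> measurable Q (count_space UNIV)"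
    and Y[measurable]: "Y \<in> measurable Q MY"
    and P: "P = distr Q (MX \<Otimes>\<^sub>M (count_space UNIV \<Otimes>\<^sub>M MY)) (\<lambda>w. (X w, A w, Y w))"
    and propensity: "is_regression Q (\<lambda>w. of_bool (A w)) MX X \<pi>"
    and \<epsilon>: "\<epsilon> > 0" and overlap: "AE w in Q. \<epsilon> < \<pi> (X w) \<and> \<pi> (X w) < 1 - \<epsilon>"
    and kf[measurable]: "kf \<in> borel_measurable MY"
    and \<beta>: "is_regression Q (\<lambda>w. kf (Y w)) (count_space UNIV \<Otimes>\<^sub>M MX) (\<lambda>w. (A w, X w)) (\<lambda>(a, x). \<beta> a x)"
begin

lemma prob_Q: "prob_space Q" by (rule prob_space_axioms)

lemma \<pi>_meas[measurable]: "\<pi> \<in> borel_measurable MX"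
  using propensity by (simp add: is_regression_def)

lemma \<beta>_meas[measurable]: "\<beta> a \<in> borel_measurable MX"
proof -
  have "(\<lambda>(a, x). \<beta> a x) \<in> borel_measurable (count_space UNIV \<Otimes>\<^sub>M MX)"
    using \<beta> by (simp add: is_regression_def)
  from measurable_compose[OF measurable_Pair1' this, of a] show ?thesis by simp
qed

lemma sets_P: "sets P = sets (MX \<Otimes>\<^sub>M (count_space UNIV \<Otimes>\<^sub>M MY))" by (simp add: P)

lemma XAY[measurable]: "(\<lambda>w. (X w, A w, Y w)) \<in> measurable Q (MX \<Otimes>\<^sub>M (count_space UNIV \<Otimes>\<^sub>M MY))"
  by measurable

lemma pseudo_outcome_meas:
  assumes [measurable]: "p \<in> borel_measurable MX" "b True \<in> borel_measurable MX" "b False \<in> borel_measurable MX"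
  shows "pseudo_outcome kf p b \<in> borel_measurable (MX \<Otimes>\<^sub>M (count_space UNIV \<Otimes>\<^sub>M MY))"
proof -
  have "pseudo_outcome kf p b = (\<lambda>(x, a, y). (of_bool a / p x - (1 - of_bool a) / (1 - p x)) *\<^sub>R (kf y - (if a then b True x else b False x)) + b True x - b False x)"
    by (auto simp: pseudo_outcome_eq fun_eq_iff)
  also have "\<dots> \<in> borel_measurable (MX \<Otimes>\<^sub>M (count_space UNIV \<Otimes>\<^sub>M MY))" by measurable
  finally show ?thesis .
qed

abbreviation cond_mean :: "('x \<Rightarrow> real) \<Rightarrow> (bool \<Rightarrow> 'x \<Rightarrow> 'h) \<Rightarrow> 'h \<Rightarrow> 'x \<Rightarrow> real" where
  "cond_mean p b e x \<equiv> (\<pi> x / p x) * ((\<beta> True x - b True x) \<bullet> e)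
     - ((1 - \<pi> x) / (1 - p x)) * ((\<beta> False x - b False x) \<bullet> e) + (b True x - b False x) \<bullet> e"

text \<open>
  \<open>cond_mean p b e\<close> is the regression function of the \<open>e\<close>-component of the pseudo-outcome on \<open>X\<close>.
  The truncation to \<open>B\<close> is needed because \<open>b\<close> need not be integrable.
\<close>

lemma pseudo_outcome_truncated_mean:
  assumes p[measurable]: "p \<in> borel_measurable MX" and b[measurable]: "b True \<in> borel_measurable MX" "b False \<in> borel_measurable MX"
    and B[measurable]: "B \<in> sets MX"
    and pB: "\<And>x. x \<in> B \<Longrightarrow> p x \<in> {\<epsilon>..1-\<epsilon>}"
    and bB: "\<And>x a. x \<in> B \<Longrightarrow> norm (b a x) \<le> m" and \<beta>B: "\<And>x a. x \<in> B \<Longrightarrow> norm (\<beta> a x) \<le> m"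
  shows "integrable Q (\<lambda>w. indicator B (X w) * (pseudo_outcome kf p b (X w, A w, Y w) \<bullet> e))"
    "(\<integral>w. indicator B (X w) * (pseudo_outcome kf p b (X w, A w, Y w) \<bullet> e) \<partial>Q) =
      (\<integral>w. indicator B (X w) * cond_mean p b e (X w) \<partial>Q)"
    "integrable Q (\<lambda>w. indicator B (X w) * cond_mean p b e (X w))"
proof -
  define \<iota> where "\<iota> = (indicator B :: 'x \<Rightarrow> real)"
  have [measurable]: "\<iota> \<in> borel_measurable MX" unfolding \<iota>_def by measurable
  have inner_bd: "\<bar>y \<bullet> e\<bar> \<le> c * norm e" if "norm y \<le> c" for y c
    using Cauchy_Schwarz_ineq2[of y e] that by (meson mult_right_mono norm_ge_zero order_trans)
  \<comment> \<open>The inverse propensity weight is a function of (A, X), bounded by 1 / \<epsilon>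
    after truncation, and so a legitimate test function for the regression of kf (Y) on (A,
    X).\<close>
  define u where "u = (\<lambda>(a, x). \<iota> x * (of_bool a / p x - (1 - of_bool a) / (1 - p x)))"
  have u[measurable]: "u \<in> borel_measurable (count_space UNIV \<Otimes>\<^sub>M MX)" unfolding u_def by measurable
  have p_inv: "\<bar>1 / p x\<bar> \<le> 1 / \<epsilon>" "\<bar>1 / (1 - p x)\<bar> \<le> 1 / \<epsilon>" if "x \<in> B" for x
    using pB[OF that] \<epsilon> by (auto simp: frac_le)
  have u_bd: "\<bar>u v\<bar> \<le> 1 / \<epsilon>" for v
    using p_inv \<epsilon> by (cases v) (auto simp: u_def \<iota>_def indicator_def)
  note T = is_regression_test[OF prob_Q \<beta> u u_bd, of e]
  define v1 where "v1 x = \<iota> x * (1 / p x) * ((\<beta> True x - b True x) \<bullet> e)" for x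
  define v0 where "v0 x = \<iota> x * (1 / (1 - p x)) * ((\<beta> False x - b False x) \<bullet> e)" for x
  define bb where "bb x = \<iota> x * ((b True x - b False x) \<bullet> e)" for x
  have vm[measurable]: "v1 \<in> borel_measurable MX" "v0 \<in> borel_measurable MX" "bb \<in> borel_measurable MX"
    unfolding v1_def v0_def bb_def by measurable
  have m2: "norm (\<beta> a x - b a' x) \<le> 2 * \<bar>m\<bar>" "norm (b a x - b a' x) \<le> 2 * \<bar>m\<bar>" if "x \<in> B" for a a' x
    using norm_triangle_ineq4[of "\<beta> a x" "b a' x"] norm_triangle_ineq4[of "b a x" "b a' x"]
      bB[OF that, of a] bB[OF that, of a'] \<beta>B[OF that, of a] by linarith+
  define C where "C = (1 / \<epsilon>) * (2 * \<bar>m\<bar> * norm e)"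
  have C0: "C \<ge> 0" using \<epsilon> by (simp add: C_def)
  have v1_bd: "\<bar>v1 x\<bar> \<le> C" for x
  proof (cases "x \<in> B")
    case True
    have "\<bar>1 / p x\<bar> * \<bar>(\<beta> True x - b True x) \<bullet> e\<bar> \<le> (1 / \<epsilon>) * (2 * \<bar>m\<bar> * norm e)"
      using m2(1)[OF True] p_inv[OF True] \<epsilon> by (intro mult_mono inner_bd) auto
    then show ?thesis using True by (simp add: v1_def \<iota>_def C_def abs_mult)
  qed (simp add: v1_def \<iota>_def C0)
  have v0_bd: "\<bar>v0 x\<bar> \<le> C" for x
  proof (cases "x \<in> B")
    case True
    have "\<bar>1 / (1 - p x)\<bar> * \<bar>(\<beta> False x - b False x) \<bullet> e\<bar> \<le> (1 / \<epsilon>) * (2 * \<bar>m\<bar> * norm e)"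
      using m2(1)[OF True] p_inv[OF True] \<epsilon> by (intro mult_mono inner_bd) auto
    then show ?thesis using True by (simp add: v0_def \<iota>_def C_def abs_mult)
  qed (simp add: v0_def \<iota>_def C0)
  have bb_bd: "\<bar>bb x\<bar> \<le> 2 * \<bar>m\<bar> * norm e" for x
  proof (cases "x \<in> B")
    case True
    then show ?thesis using inner_bd[of "b True x - b False x" "2 * \<bar>m\<bar>"] m2(2)[OF True, of True False] by (simp add: bb_def \<iota>_def)
  qed (simp add: bb_def \<iota>_def)
  have iv1: "integrable Q (\<lambda>w. v1 (X w))" by (rule integrable_const_bound[of _ C]) (use v1_bd in auto)
  have iv0: "integrable Q (\<lambda>w. v0 (X w))" by (rule integrable_const_bound[of _ C]) (use v0_bd in auto)
  have ibb: "integrable Q (\<lambda>w. bb (X w))" by (rule integrable_const_bound[of _ "2 * \<bar>m\<bar> * norm e"]) (use bb_bd in auto)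
  define ub where "ub w = u (A w, X w) * ((if A w then b True (X w) else b False (X w)) \<bullet> e)" for w
  \<comment> \<open>Once kf (Y) is replaced by \<beta>, the treatment enters linearly with
    coefficients depending on X alone; the second regression then replaces A by \<pi> (X).\<close>
  have e1: "u (A w, X w) * (\<beta> (A w) (X w) \<bullet> e) - ub w = v1 (X w) * of_bool (A w) - (v0 (X w) - v0 (X w) * of_bool (A w))" for w
    by (cases "A w") (auto simp: u_def ub_def v1_def v0_def inner_diff_left algebra_simps)
  have iub: "integrable Q ub"
  proof (rule integrable_const_bound[of _ "(1 / \<epsilon>) * (\<bar>m\<bar> * norm e)"])
    show "ub \<in> borel_measurable Q" unfolding ub_def u_def split_conv by measurable
    show "AE w in Q. norm (ub w) \<le> (1 / \<epsilon>) * (\<bar>m\<bar> * norm e)"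
    proof (intro always_eventually allI)
      fix w
      show "norm (ub w) \<le> (1 / \<epsilon>) * (\<bar>m\<bar> * norm e)"
      proof (cases "X w \<in> B")
        case True
        then have "norm (if A w then b True (X w) else b False (X w)) \<le> \<bar>m\<bar>" by (auto intro: order_trans[OF bB[OF True] abs_ge_self])
        then show ?thesis unfolding ub_def real_norm_def abs_mult using \<epsilon>
          by (intro mult_mono u_bd inner_bd) auto
      next
        case False
        then show ?thesis using \<epsilon> by (simp add: ub_def u_def \<iota>_def)
      qed
    qed
  qed
  have lhs: "indicator B (X w) * (pseudo_outcome kf p b (X w, A w, Y w) \<bullet> e) = u (A w, X w) * (kf (Y w) \<bullet> e) - ub w + bb (X w)" for w
    by (simp add: pseudo_outcome_eq u_def ub_def bb_def \<iota>_def[symmetric] inner_add_left inner_diff_left algebra_simps)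
  show "integrable Q (\<lambda>w. indicator B (X w) * (pseudo_outcome kf p b (X w, A w, Y w) \<bullet> e))"
    unfolding lhs using T(1) iub ibb by (intro Bochner_Integration.integrable_add Bochner_Integration.integrable_diff)
  have rhs: "indicator B (X w) * cond_mean p b e (X w) =
      v1 (X w) * \<pi> (X w) - (v0 (X w) - v0 (X w) * \<pi> (X w)) + bb (X w)" for w
    by (simp add: v1_def v0_def bb_def \<iota>_def[symmetric] diff_divide_distrib algebra_simps)
  have T1': "integrable Q (\<lambda>w. v1 (X w) * of_bool (A w))" "integrable Q (\<lambda>w. v1 (X w) * \<pi> (X w))"
      "(\<integral>w. v1 (X w) * of_bool (A w) \<partial>Q) = (\<integral>w. v1 (X w) * \<pi> (X w) \<partial>Q)"
    using is_regression_test[OF prob_Q propensity vm(1) v1_bd, where e=1] by simp_all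
  have T0': "integrable Q (\<lambda>w. v0 (X w) * of_bool (A w))" "integrable Q (\<lambda>w. v0 (X w) * \<pi> (X w))"
      "(\<integral>w. v0 (X w) * of_bool (A w) \<partial>Q) = (\<integral>w. v0 (X w) * \<pi> (X w) \<partial>Q)"
    using is_regression_test[OF prob_Q propensity vm(2) v0_bd, where e=1] by simp_all
  show "integrable Q (\<lambda>w. indicator B (X w) * cond_mean p b e (X w))"
    unfolding rhs using T1' T0' iv0 ibb by (intro Bochner_Integration.integrable_add Bochner_Integration.integrable_diff)
  have T': "integrable Q (\<lambda>w. u (A w, X w) * (\<beta> (A w) (X w) \<bullet> e))"
    "(\<integral>w. u (A w, X w) * (kf (Y w) \<bullet> e) \<partial>Q) = (\<integral>w. u (A w, X w) * (\<beta> (A w) (X w) \<bullet> e) \<partial>Q)"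
    using T by simp_all
  have "(\<integral>w. indicator B (X w) * (pseudo_outcome kf p b (X w, A w, Y w) \<bullet> e) \<partial>Q) =
      (\<integral>w. u (A w, X w) * (kf (Y w) \<bullet> e) \<partial>Q) - (\<integral>w. ub w \<partial>Q) + (\<integral>w. bb (X w) \<partial>Q)"
    unfolding lhs using T(1) iub ibb by simp
  also have "\<dots> = (\<integral>w. u (A w, X w) * (\<beta> (A w) (X w) \<bullet> e) - ub w \<partial>Q) + (\<integral>w. bb (X w) \<partial>Q)"
    using T' iub by simp
  also have "\<dots> = (\<integral>w. v1 (X w) * \<pi> (X w) - (v0 (X w) - v0 (X w) * \<pi> (X w)) \<partial>Q) + (\<integral>w. bb (X w) \<partial>Q)"
    unfolding e1 using T1' T0' iv0 by simp
  also have "\<dots> = (\<integral>w. v1 (X w) * \<pi> (X w) - (v0 (X w) - v0 (X w) * \<pi> (X w)) + bb (X w) \<partial>Q)"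
    using T1' T0' iv0 ibb by simp
  finally show "(\<integral>w. indicator B (X w) * (pseudo_outcome kf p b (X w, A w, Y w) \<bullet> e) \<partial>Q) =
      (\<integral>w. indicator B (X w) * cond_mean p b e (X w) \<partial>Q)"
    unfolding rhs .
qed

text \<open>Double robustness: the conditional means of the two pseudo-outcomes differ by (\<pi> -
  p) / p and (\<pi> - p) / (1 - p) times the regression errors of the two arms. Each term is a
  product of nuisance errors, to which Cauchy--Schwarz applies.\<close>

lemma bias_bound:
  assumes p[measurable]: "p \<in> borel_measurable MX" and b[measurable]: "b True \<in> borel_measurable MX" "b False \<in> borel_measurable MX"
    and p_AE: "AE (x, a, y) in P. p x \<in> {\<epsilon>..1-\<epsilon>}"
    and int: "integrable P (\<lambda>z. pseudo_outcome kf p b z - pseudo_outcome kf \<pi> \<beta> z)"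
  shows "ennreal (norm (\<integral>z. pseudo_outcome kf p b z - pseudo_outcome kf \<pi> \<beta> z \<partial>P)) \<le>
    ennreal (1 / \<epsilon>) * (L2norm P (\<lambda>(x, a', y). p x - \<pi> x) * (\<Sum>a\<in>UNIV. L2norm P (\<lambda>(x, a', y). b a x - \<beta> a x)))"
proof -
  define D where "D = (\<lambda>z. pseudo_outcome kf p b z - pseudo_outcome kf \<pi> \<beta> z)"
  define DX where "DX w = D (X w, A w, Y w)" for w
  define G where "G x = \<bar>p x - \<pi> x\<bar> * norm (b True x - \<beta> True x) + \<bar>p x - \<pi> x\<bar> * norm (b False x - \<beta> False x)" for x
  define J where "J = (\<integral>\<^sup>+w. ennreal (G (X w)) \<partial>Q)"
  \<comment> \<open>Truncation sets on which the regressions are bounded by m and both propensities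
    stay in the overlap range; as m grows they exhaust almost every value of X.\<close>
  define B where "B m = {x\<in>space MX. p x \<in> {\<epsilon>..1-\<epsilon>} \<and> \<pi> x \<in> {\<epsilon>..1-\<epsilon>} \<and>
      (norm (b True x) \<le> m \<and> norm (b False x) \<le> m) \<and> norm (\<beta> True x) \<le> m \<and> norm (\<beta> False x) \<le> m}" for m :: real
  have B_sets[measurable]: "B m \<in> sets MX" for m unfolding B_def by measurable
  have [measurable]: "G \<in> borel_measurable MX" unfolding G_def by measurable
  have G0: "G x \<ge> 0" for x by (simp add: G_def)
  have D_meas: "D \<in> borel_measurable (MX \<Otimes>\<^sub>M (count_space UNIV \<Otimes>\<^sub>M MY))"
    unfolding D_def by (intro borel_measurable_diff pseudo_outcome_meas) measurable
  have DX: "integrable Q DX" "(\<integral>z. D z \<partial>P) = (\<integral>w. DX w \<partial>Q)"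
    using int D_meas unfolding D_def[symmetric] DX_def P
    by (simp_all add: integrable_distr_eq[OF XAY] integral_distr[OF XAY])
  have pX: "AE w in Q. p (X w) \<in> {\<epsilon>..1-\<epsilon>}"
    using AE_distrD[OF XAY p_AE[unfolded P]] by simp
  have BD: "norm (b a x) \<le> m" "norm (\<beta> a x) \<le> m" "p x \<in> {\<epsilon>..1-\<epsilon>}" "\<pi> x \<in> {\<epsilon>..1-\<epsilon>}" if "x \<in> B m" for x a m
    using that by (cases a; simp add: B_def)+
  have J_le: "J \<le> L2norm P (\<lambda>(x, a', y). p x - \<pi> x) * (\<Sum>a\<in>UNIV. L2norm P (\<lambda>(x, a', y). b a x - \<beta> a x))"
  proof -
    have bm: "b a \<in> borel_measurable MX" for a using b by (cases a) auto
    have dm[measurable]: "(\<lambda>(x, a', y). b a x - \<beta> a x) \<in> borel_measurable P" "(\<lambda>(x, a', y). p x - \<pi> x) \<in> borel_measurable P" for a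
      using bm[of a] unfolding measurable_cong_sets[OF sets_P refl] by measurable
    have "J = (\<integral>\<^sup>+z. ennreal (G (fst z)) \<partial>P)"
      unfolding J_def P by (subst nn_integral_distr[OF XAY]) auto
    also have "\<dots> = (\<integral>\<^sup>+z. (\<Sum>a\<in>UNIV. ennreal (\<bar>(\<lambda>(x, a', y). p x - \<pi> x) z\<bar> * norm ((\<lambda>(x, a', y). b a x - \<beta> a x) z))) \<partial>P)"
      by (intro nn_integral_cong) (auto simp: G_def UNIV_bool ennreal_plus[symmetric] simp del: ennreal_plus)
    also have "\<dots> = (\<Sum>a\<in>UNIV. (\<integral>\<^sup>+z. ennreal (\<bar>(\<lambda>(x, a', y). p x - \<pi> x) z\<bar> * norm ((\<lambda>(x, a', y). b a x - \<beta> a x) z)) \<partial>P))"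
      by (intro nn_integral_sum) measurable
    also have "\<dots> \<le> (\<Sum>a\<in>UNIV. L2norm P (\<lambda>(x, a', y). p x - \<pi> x) * L2norm P (\<lambda>(x, a', y). b a x - \<beta> a x))"
      by (intro sum_mono nn_integral_le_L2norm_mult dm)
    finally show ?thesis by (simp add: sum_distrib_left)
  qed
  show ?thesis
  proof (cases "J = \<top>")
    case True
    then have "L2norm P (\<lambda>(x, a', y). p x - \<pi> x) * (\<Sum>a\<in>UNIV. L2norm P (\<lambda>(x, a', y). b a x - \<beta> a x)) = \<top>"
      using J_le by (simp add: top_unique)
    then show ?thesis using \<epsilon> by (simp add: ennreal_mult_top)
  next
    case False
    then obtain j where j: "J = ennreal j" "j \<ge> 0" by (metis ennreal_cases)
    have Gint: "integrable Q (\<lambda>w. G (X w))"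
      using False G0 by (intro integrableI_nonneg) (auto simp: J_def less_top)
    have Gj: "(\<integral>w. G (X w) \<partial>Q) = j"
      using j G0 by (subst integral_eq_nn_integral) (auto simp: J_def)
    have trunc: "\<bar>\<integral>w. indicator (B m) (X w) * (DX w \<bullet> e) \<partial>Q\<bar> \<le> norm e / \<epsilon> * j" for m e
    proof -
      have bd: "\<And>x. x \<in> B m \<Longrightarrow> p x \<in> {\<epsilon>..1-\<epsilon>}" "\<And>x. x \<in> B m \<Longrightarrow> \<pi> x \<in> {\<epsilon>..1-\<epsilon>}"
        "\<And>x a. x \<in> B m \<Longrightarrow> norm (b a x) \<le> m" "\<And>x a. x \<in> B m \<Longrightarrow> norm (\<beta> a x) \<le> m"
        using BD by blast+
      note T1 = pseudo_outcome_truncated_mean[where p=p and b=b and B="B m" and m=m and e=e, OF p b B_sets bd(1) bd(3) bd(4)]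
      note T2 = pseudo_outcome_truncated_mean[where p=\<pi> and b=\<beta> and B="B m" and m=m and e=e, OF \<pi>_meas \<beta>_meas \<beta>_meas B_sets bd(2) bd(4) bd(4)]
      define F1 where "F1 w = indicator (B m) (X w) * cond_mean p b e (X w)" for w
      define F2 where "F2 w = indicator (B m) (X w) * cond_mean \<pi> \<beta> e (X w)" for w
      note T1' = T1[folded F1_def]
      note T2' = T2[folded F2_def]
      have "(\<integral>w. indicator (B m) (X w) * (DX w \<bullet> e) \<partial>Q) =
          (\<integral>w. indicator (B m) (X w) * (pseudo_outcome kf p b (X w, A w, Y w) \<bullet> e) - indicator (B m) (X w) * (pseudo_outcome kf \<pi> \<beta> (X w, A w, Y w) \<bullet> e) \<partial>Q)"
        by (simp add: DX_def D_def inner_diff_left right_diff_distrib)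
      also have "\<dots> = (\<integral>w. F1 w - F2 w \<partial>Q)"
        using T1' T2' by simp
      finally have eq: "(\<integral>w. indicator (B m) (X w) * (DX w \<bullet> e) \<partial>Q) = (\<integral>w. F1 w - F2 w \<partial>Q)" .
      have pt: "\<bar>F1 w - F2 w\<bar> \<le> norm e / \<epsilon> * G (X w)" for w
      proof (cases "X w \<in> B m")
        case True
        define x where "x = X w"
        have x: "x \<in> B m" using True by (simp add: x_def)
        define dT where "dT = (\<beta> True x - b True x) \<bullet> e"
        define dF where "dF = (\<beta> False x - b False x) \<bullet> e"
        have pp: "p x > 0" "1 - p x > 0" "\<pi> x > 0" "1 - \<pi> x > 0" using BD(3,4)[OF x] \<epsilon> by auto
        \<comment> \<open>The plug-in difference of \<beta> exceeds that of b by dT - dF, which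
          subtracts 1 from each of the weights \<pi> / p and (1 - \<pi>) / (1 - p).\<close>
        have e: "(\<beta> True x - \<beta> False x) \<bullet> e = (b True x - b False x) \<bullet> e + dT - dF"
          by (simp add: dT_def dF_def inner_diff_left)
        have "F1 w - F2 w = (\<pi> x / p x) * dT - ((1 - \<pi> x) / (1 - p x)) * dF - dT + dF"
          using x e by (simp add: F1_def F2_def x_def[symmetric] dT_def[symmetric] dF_def[symmetric])
        also have "\<dots> = ((\<pi> x - p x) / p x) * dT + ((\<pi> x - p x) / (1 - p x)) * dF"
        proof -
          have "\<pi> x / p x = (\<pi> x - p x) / p x + 1" using pp by (simp add: diff_divide_distrib)
          moreover have "(1 - \<pi> x) / (1 - p x) = 1 - (\<pi> x - p x) / (1 - p x)" using pp by (simp add: field_simps)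
          ultimately show ?thesis by (simp only:) (simp add: algebra_simps)
        qed
        finally have eqF: "F1 w - F2 w = ((\<pi> x - p x) / p x) * dT + ((\<pi> x - p x) / (1 - p x)) * dF" .
        have le: "\<bar>((\<pi> x - p x) / r) * ((\<beta> a x - b a x) \<bullet> e)\<bar> \<le> norm e / \<epsilon> * (\<bar>p x - \<pi> x\<bar> * norm (b a x - \<beta> a x))" if r: "r \<ge> \<epsilon>" for r a
        proof -
          have "\<bar>(\<pi> x - p x) / r\<bar> \<le> \<bar>p x - \<pi> x\<bar> / \<epsilon>"
            using r \<epsilon> by (simp add: abs_minus_commute frac_le)
          moreover have "\<bar>(\<beta> a x - b a x) \<bullet> e\<bar> \<le> norm (b a x - \<beta> a x) * norm e"
            using Cauchy_Schwarz_ineq2[of "\<beta> a x - b a x" e] by (simp add: norm_minus_commute)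
          ultimately have "\<bar>(\<pi> x - p x) / r\<bar> * \<bar>(\<beta> a x - b a x) \<bullet> e\<bar> \<le> (\<bar>p x - \<pi> x\<bar> / \<epsilon>) * (norm (b a x - \<beta> a x) * norm e)"
            using \<epsilon> by (intro mult_mono) auto
          then show ?thesis by (simp add: abs_mult mult_ac)
        qed
        have "\<bar>F1 w - F2 w\<bar> \<le> \<bar>((\<pi> x - p x) / p x) * dT\<bar> + \<bar>((\<pi> x - p x) / (1 - p x)) * dF\<bar>"
          unfolding eqF by (rule abs_triangle_ineq)
        also have "\<dots> \<le> norm e / \<epsilon> * (\<bar>p x - \<pi> x\<bar> * norm (b True x - \<beta> True x)) + norm e / \<epsilon> * (\<bar>p x - \<pi> x\<bar> * norm (b False x - \<beta> False x))"
          unfolding dT_def dF_def using BD(3)[OF x] by (intro add_mono le) auto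
        finally show ?thesis by (simp add: G_def x_def[symmetric] distrib_left)
      next
        case False
        then show ?thesis using G0[of "X w"] \<epsilon> by (simp add: F1_def F2_def)
      qed
      have "\<bar>\<integral>w. F1 w - F2 w \<partial>Q\<bar> \<le> (\<integral>w. \<bar>F1 w - F2 w\<bar> \<partial>Q)" by (rule integral_abs_bound)
      also have "\<dots> \<le> (\<integral>w. norm e / \<epsilon> * G (X w) \<partial>Q)"
        using T1'(3) T2'(3) Gint pt by (intro integral_mono) auto
      also have "\<dots> = norm e / \<epsilon> * j" using Gj by simp
      finally show ?thesis unfolding eq .
    qed
    have lim: "(\<lambda>n. \<integral>w. indicator (B (real n)) (X w) * (DX w \<bullet> e) \<partial>Q) \<longlonglongrightarrow> (\<integral>w. DX w \<bullet> e \<partial>Q)" for e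
    proof (rule integral_dominated_convergence)
      show "integrable Q (\<lambda>w. \<bar>DX w \<bullet> e\<bar>)" using DX(1) by simp
      show "(\<lambda>w. DX w \<bullet> e) \<in> borel_measurable Q" using DX(1) by simp
      show "(\<lambda>w. indicator (B (real n)) (X w) * (DX w \<bullet> e)) \<in> borel_measurable Q" for n
        using borel_measurable_integrable[OF DX(1)] by measurable
      show "AE w in Q. norm (indicator (B (real n)) (X w) * (DX w \<bullet> e)) \<le> \<bar>DX w \<bullet> e\<bar>" for n
        by (auto simp: indicator_def abs_mult)
      show "AE w in Q. (\<lambda>n. indicator (B (real n)) (X w) * (DX w \<bullet> e)) \<longlonglongrightarrow> DX w \<bullet> e"
        using pX overlap AE_space
      proof eventually_elim
        case (elim w)
        define c where "c = norm (b True (X w)) + norm (b False (X w)) + norm (\<beta> True (X w)) + norm (\<beta> False (X w))"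
        have inB: "X w \<in> B (real n)" if "real n \<ge> c" for n
        proof -
          have "norm (b True (X w)) \<le> c" "norm (b False (X w)) \<le> c" "norm (\<beta> True (X w)) \<le> c" "norm (\<beta> False (X w)) \<le> c"
            by (simp_all add: c_def)
          then show ?thesis using that elim measurable_space[OF X, of w] by (simp add: B_def)
        qed
        have "\<forall>\<^sub>F n in sequentially. real n \<ge> c"
          using filterlim_real_sequentially by (simp add: filterlim_at_top)
        then have "\<forall>\<^sub>F n in sequentially. DX w \<bullet> e = indicator (B (real n)) (X w) * (DX w \<bullet> e)"
          by eventually_elim (simp add: inB)
        then show ?case by (rule Lim_transform_eventually[OF tendsto_const])
      qed
    qed
    \<comment> \<open>Testing in the direction of the mean E itself recovers its norm from the
      scalar bounds.\<close>
    define E where "E = (\<integral>w. DX w \<partial>Q)"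
    have "\<bar>\<integral>w. DX w \<bullet> E \<partial>Q\<bar> \<le> norm E / \<epsilon> * j"
      using trunc by (intro LIMSEQ_le_const2[OF tendsto_rabs[OF lim]]) auto
    moreover have "(\<integral>w. DX w \<bullet> E \<partial>Q) = norm E * norm E"
      using DX(1) by (simp add: E_def power2_norm_eq_inner[symmetric] power2_eq_square[symmetric])
    ultimately have le: "norm E * norm E \<le> norm E * (j / \<epsilon>)" by simp
    have "norm E \<le> j / \<epsilon>"
    proof (cases "norm E = 0")
      case False
      then have "norm E > 0" by simp
      with le show ?thesis by (simp only: mult_le_cancel_left_pos)
    qed (use j \<epsilon> in simp)
    then have "norm E \<le> (1 / \<epsilon>) * j" by simp
    then have "ennreal (norm E) \<le> ennreal (1 / \<epsilon>) * J"
      using j \<epsilon> by (simp add: ennreal_mult[symmetric])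
    also have "\<dots> \<le> ennreal (1 / \<epsilon>) * (L2norm P (\<lambda>(x, a', y). p x - \<pi> x) * (\<Sum>a\<in>UNIV. L2norm P (\<lambda>(x, a', y). b a x - \<beta> a x)))"
      by (intro mult_left_mono J_le) simp
    finally show ?thesis using DX(2) by (simp add: E_def D_def)
  qed
qed

end

section \<open>Asymptotic normality\<close>

theorem theorem4p1:
  fixes Q :: "'q measure" and MX :: "'x measure" and MY :: "'y measure"
    and X :: "'q \<Rightarrow> 'x" and A :: "'q \<Rightarrow> bool" and Y Y0 Y1 :: "'q \<Rightarrow> 'y"
    and P :: "('x \<times> bool \<times> 'y) measure"
    and \<epsilon> :: real and \<pi> :: "'x \<Rightarrow> real"
    and k :: "'y \<Rightarrow> 'y \<Rightarrow> real"
    and evl :: "'h::{real_inner, banach, second_countable_topology} \<Rightarrow> 'y \<Rightarrow> real"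
    and kf :: "'y \<Rightarrow> 'h"
    and \<beta> :: "bool \<Rightarrow> 'x \<Rightarrow> 'h"
    and \<phi> :: "'x \<times> bool \<times> 'y \<Rightarrow> 'h"
    and M :: "'w measure" and Z :: "nat \<Rightarrow> 'w \<Rightarrow> 'x \<times> bool \<times> 'y"
    and \<pi>h :: "nat \<Rightarrow> nat \<Rightarrow> 'w \<Rightarrow> 'x \<Rightarrow> real"
    and \<beta>h :: "nat \<Rightarrow> nat \<Rightarrow> 'w \<Rightarrow> bool \<Rightarrow> 'x \<Rightarrow> 'h"
    and \<phi>h :: "nat \<Rightarrow> nat \<Rightarrow> 'w \<Rightarrow> 'x \<times> bool \<times> 'y \<Rightarrow> 'h"
  assumes Q: "prob_space Q"
    and X: "X \<in> measurable Q MX"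
    and A: "A \<in> measurable Q (count_space UNIV)"
    and Y: "Y \<in> measurable Q MY"
    and Y0: "Y0 \<in> measurable Q MY"
    and Y1: "Y1 \<in> measurable Q MY"
    and P: "P = distr Q (MX \<Otimes>\<^sub>M (count_space UNIV \<Otimes>\<^sub>M MY)) (\<lambda>w. (X w, A w, Y w))"
    and consistency: "AE w in Q. Y w = (if A w then Y1 w else Y0 w)"
    and unconfounded:
      "cond_indep Q (MY \<Otimes>\<^sub>M MY) (\<lambda>w. (Y0 w, Y1 w)) (count_space UNIV) A MX X"
    and propensity: "is_regression Q (\<lambda>w. of_bool (A w)) MX X \<pi>"
    and overlap: "\<epsilon> > 0" "AE w in Q. \<epsilon> < \<pi> (X w) \<and> \<pi> (X w) < 1 - \<epsilon>"
    and rkhs: "is_rkhs (space MY) k evl kf"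
    and kf: "kf \<in> borel_measurable MY"
    and \<beta>: "is_regression Q (\<lambda>w. kf (Y w)) (count_space UNIV \<Otimes>\<^sub>M MX) (\<lambda>w. (A w, X w))
               (\<lambda>(a, x). \<beta> a x)"
    and \<phi>: "\<phi> = pseudo_outcome kf \<pi> \<beta>"
    and M: "prob_space M"
    and Z: "iid_sample M P {1..} Z"
    and \<pi>h: "\<And>r n. r \<in> {1, 2} \<Longrightarrow> (\<lambda>(w, x). \<pi>h r n w x) \<in> borel_measurable (M \<Otimes>\<^sub>M MX)"
    and \<beta>h: "\<And>r n a. r \<in> {1, 2} \<Longrightarrow> (\<lambda>(w, x). \<beta>h r n w a x) \<in> borel_measurable (M \<Otimes>\<^sub>M MX)"
    and \<phi>h: "\<phi>h = (\<lambda>r n w. pseudo_outcome kf (\<pi>h r n w) (\<beta>h r n w))"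
    and i: "(\<integral>z. \<phi> z \<partial>P) = 0"
    and ii: "(\<integral>w. (\<phi> (Z 1 w) \<bullet> \<phi> (Z 2 w))\<^sup>2 \<partial>M) > 0"
    and iii: "integrable P (\<lambda>z. norm (\<phi> z) ^ 4)"
    and iv_or_v: "\<And>r. r \<in> {1, 2} \<Longrightarrow>
          constructed_indep M P Z (fold_idx r) (\<phi>h r) \<or>
          (\<exists>G. asymp_equicontinuous M P G \<phi> \<and> (\<forall>n. AE w in M. \<phi>h r n w \<in> G)) \<and>
          (\<exists>F. glivenko_cantelli P F \<and> (\<forall>n. AE w in M. (\<lambda>z. (norm (\<phi>h r n w z))\<^sup>2) \<in> F))"
    and vi: "\<And>r. r \<in> {1, 2} \<Longrightarrow>
          small_o_P M (\<lambda>n w. L2norm P (\<lambda>z. \<phi>h r n w z - \<phi> z)) (\<lambda>_. 1)"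
    and vii: "\<And>r n. r \<in> {1, 2} \<Longrightarrow>
          AE w in M. AE (x, a, y) in P. \<pi>h r n w x \<in> {\<epsilon>..1 - \<epsilon>}"
    and rate: "\<And>r. r \<in> {1, 2} \<Longrightarrow>
          small_o_P M (\<lambda>n w. L2norm P (\<lambda>(x, a', y). \<pi>h r n w x - \<pi> x)
              * (\<Sum>a\<in>UNIV. L2norm P (\<lambda>(x, a', y). \<beta>h r n w a x - \<beta> a x)))
            (\<lambda>n. 1 / sqrt (real n))"
  shows "weak_conv_m
     (\<lambda>n. distr M borel (\<lambda>w. T_dagger n (\<phi>h 1 n w) (\<phi>h 2 n w) (\<lambda>i. Z i w)))
     std_normal_distribution"
proof -
  interpret Q: regression_model Q MX MY X A Y P \<epsilon> \<pi> kf \<beta>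
    by (rule regression_model.intro[OF Q], unfold_locales)
       (use X A Y P propensity overlap kf \<beta> in auto)
  have sets_P: "sets P = sets (MX \<Otimes>\<^sub>M (count_space UNIV \<Otimes>\<^sub>M MY))" by (rule Q.sets_P)
  have \<phi>_meas: "\<phi> \<in> borel_measurable P"
    unfolding \<phi> measurable_cong_sets[OF sets_P refl]
    by (rule Q.pseudo_outcome_meas[OF Q.\<pi>_meas Q.\<beta>_meas Q.\<beta>_meas])
  interpret M: two_sample M P Z \<phi>
    by (rule two_sample.intro[OF M], unfold_locales) (use Z \<phi>_meas iii i ii in auto)
  have g_meas: "(\<lambda>(w, z). \<phi>h r n w z) \<in> borel_measurable (M \<Otimes>\<^sub>M P)" if r: "r \<in> {1, 2}" for r n
  proof -
    note [measurable] = \<pi>h[OF r] \<beta>h[OF r] kf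
    have "(\<lambda>(w, z). \<phi>h r n w z) = (\<lambda>(w, x, a, y). (of_bool a / \<pi>h r n w x - (1 - of_bool a) / (1 - \<pi>h r n w x)) *\<^sub>R
        (kf y - (if a then \<beta>h r n w True x else \<beta>h r n w False x)) + \<beta>h r n w True x - \<beta>h r n w False x)"
      by (auto simp: \<phi>h pseudo_outcome_eq fun_eq_iff)
    also have "\<dots> \<in> borel_measurable (M \<Otimes>\<^sub>M (MX \<Otimes>\<^sub>M (count_space UNIV \<Otimes>\<^sub>M MY)))" by measurable
    finally show ?thesis
      by (simp add: measurable_cong_sets[OF sets_pair_measure_cong[OF refl sets_P] refl])
  qed
  have small: "((\<lambda>(n, w). L2norm P (\<lambda>z. \<phi>h r n w z - \<phi> z)) \<longlongrightarrow> 0) (inprob M)" if r: "r \<in> {1, 2}" for r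
  proof (rule M.small_o_P_imp_tendsto[OF vi[OF r]])
    note [measurable] = g_meas[OF r] \<phi>_meas
    show "(\<lambda>w. L2norm P (\<lambda>z. \<phi>h r n w z - \<phi> z)) \<in> borel_measurable M" for n
      by (rule M.P.L2norm_measurable) measurable
  qed
  have bias: "((\<lambda>(n, w). sqrt n *\<^sub>R (\<integral>z. \<phi>h r n w z - \<phi> z \<partial>P)) \<longlongrightarrow> 0) (inprob M)" if r: "r \<in> {1, 2}" for r
  proof (rule tendstoI)
    fix e :: real assume e: "e > 0"
    define L where "L n w = L2norm P (\<lambda>(x, a', y). \<pi>h r n w x - \<pi> x)
              * (\<Sum>a\<in>UNIV. L2norm P (\<lambda>(x, a', y). \<beta>h r n w a x - \<beta> a x))" for n w
    note [measurable] = \<pi>h[OF r] \<beta>h[OF r]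
    have pair: "borel_measurable (M \<Otimes>\<^sub>M P) = borel_measurable (M \<Otimes>\<^sub>M (MX \<Otimes>\<^sub>M (count_space UNIV \<Otimes>\<^sub>M MY)))"
      by (rule measurable_cong_sets[OF sets_pair_measure_cong[OF refl sets_P] refl])
    have [measurable]: "(\<lambda>w. L2norm P (\<lambda>(x, a', y). \<pi>h r n w x - \<pi> x)) \<in> borel_measurable M"
        "(\<lambda>w. L2norm P (\<lambda>(x, a', y). \<beta>h r n w a x - \<beta> a x)) \<in> borel_measurable M" for n a
      by (rule M.P.L2norm_measurable, unfold pair, measurable)+
    have [measurable]: "L n \<in> borel_measurable M" for n unfolding L_def by measurable
    \<comment> \<open>The factor \<epsilon> cancels the 1 / \<epsilon> of \<open>bias_bound\<close>,
      and sqrt n cancels the rate, leaving e / 2.\<close>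
    define d where "d = \<epsilon> * e / 2"
    have d: "d > 0" using e overlap(1) by (simp add: d_def)
    have "(\<lambda>n. measure M {w \<in> space M. L n w > ennreal (d * (1 / sqrt (real n)))}) \<longlonglongrightarrow> 0"
      using rate[OF r] d by (auto simp: small_o_P_def L_def)
    then have "\<forall>\<^sub>F (n, w) in inprob M. L n w \<le> ennreal (d * (1 / sqrt (real n)))"
      by (intro M.eventually_inprobI) (auto simp: not_le)
    moreover have "\<forall>\<^sub>F (n, w) in inprob M. AE (x, a, y) in P. \<pi>h r n w x \<in> {\<epsilon>..1 - \<epsilon>}"
      by (rule M.eventually_inprob_AE[OF vii[OF r]])
    moreover note M.inprob_sequentially[OF eventually_gt_at_top[of 0]] M.inprob_space ennreal_tendsto_0D[OF small[OF r] zero_less_one]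
    ultimately show "\<forall>\<^sub>F x in inprob M. dist (case x of (n, w) \<Rightarrow> sqrt (real n) *\<^sub>R (\<integral>z. \<phi>h r n w z - \<phi> z \<partial>P)) 0 < e"
    proof eventually_elim
      case (elim x)
      obtain n w where x: "x = (n, w)" by (cases x)
      have n: "n > 0" and w: "w \<in> space M" and Lw: "L n w \<le> ennreal (d * (1 / sqrt (real n)))"
        and p: "AE (x, a, y) in P. \<pi>h r n w x \<in> {\<epsilon>..1 - \<epsilon>}"
        and s: "L2norm P (\<lambda>z. \<phi>h r n w z - \<phi> z) \<le> ennreal 1"
        using elim by (simp_all add: x)
      have pm: "\<pi>h r n w \<in> borel_measurable MX"
        using measurable_compose[OF measurable_Pair1'[OF w] \<pi>h[OF r]] by simp
      have bm: "\<beta>h r n w a \<in> borel_measurable MX" for a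
        using measurable_compose[OF measurable_Pair1'[OF w] \<beta>h[OF r]] by simp
      have hm: "(\<lambda>z. \<phi>h r n w z - \<phi> z) \<in> borel_measurable P"
        using measurable_compose[OF measurable_Pair1'[OF w] g_meas[OF r]] \<phi>_meas by simp
      \<comment> \<open>A finite L2 distance guarantees that the mean of the error is a genuine
        integral and not the default value 0.\<close>
      have int: "integrable P (\<lambda>z. \<phi>h r n w z - \<phi> z)"
        by (rule integrable_norm_sq_imp_integrable[OF M.P.finite_measure_axioms hm L2norm_leD(1)[OF hm s]]) simp
      have "ennreal (norm (\<integral>z. \<phi>h r n w z - \<phi> z \<partial>P)) \<le> ennreal (1 / \<epsilon>) * L n w"
        using Q.bias_bound[OF pm bm bm p] int by (simp add: \<phi>h \<phi> L_def)
      also have "\<dots> \<le> ennreal (1 / \<epsilon>) * ennreal (d * (1 / sqrt (real n)))"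
        by (intro mult_left_mono Lw) simp
      also have "\<dots> = ennreal (e / 2 * (1 / sqrt (real n)))"
        using overlap(1) e by (simp add: ennreal_mult[symmetric] d_def)
      finally have "norm (\<integral>z. \<phi>h r n w z - \<phi> z \<partial>P) \<le> e / 2 * (1 / sqrt (real n))"
        using e by simp
      then have "sqrt n * norm (\<integral>z. \<phi>h r n w z - \<phi> z \<partial>P) \<le> e / 2"
        using n by (simp add: field_simps)
      then show ?case using e by (simp add: x)
    qed
  qed
  have I: "fold_idx r n = {(r - 1) * n + 1..r * n}" for r n by (simp add: fold_idx_def)
  have blocks:
    "((\<lambda>(n, w). (1 / sqrt n) *\<^sub>R (\<Sum>i\<in>fold_idx r n. \<phi>h r n w (Z i w) - \<phi> (Z i w) - (\<integral>z. \<phi>h r n w z - \<phi> z \<partial>P))) \<longlongrightarrow> 0) (inprob M) \<and>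
     ((\<lambda>(n, w). (1 / n) * (\<Sum>i\<in>fold_idx r n. (norm (\<phi>h r n w (Z i w) - \<phi> (Z i w)))\<^sup>2)) \<longlongrightarrow> 0) (inprob M)" if r: "r \<in> {1, 2}" for r
    using iv_or_v[OF r]
  proof
    assume con: "constructed_indep M P Z (fold_idx r) (\<phi>h r)"
    show ?thesis
      using M.constructed_indep_block[OF con small[OF r]] r by (auto simp: I)
  next
    assume "(\<exists>G. asymp_equicontinuous M P G \<phi> \<and> (\<forall>n. AE w in M. \<phi>h r n w \<in> G)) \<and>
      (\<exists>F. glivenko_cantelli P F \<and> (\<forall>n. AE w in M. (\<lambda>z. (norm (\<phi>h r n w z))\<^sup>2) \<in> F))"
    then obtain G where G: "asymp_equicontinuous M P G \<phi>" "\<And>n. AE w in M. \<phi>h r n w \<in> G" by auto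
    \<comment> \<open>\<open>s\<close> enumerates the half sample of index r and \<open>s'\<close>
      the other one: the offsets are 0 and n for r = 1, and n and 0 for r = 2.\<close>
    define s where "s n i = (r - 1) * n + 1 + i" for n i
    define s' where "s' n i = (2 - r) * n + 1 + i" for n i
    have "s n ` {..<n} \<inter> s' n ` {..<n} = {}" for n
      using r by (auto simp: s_def s'_def)
    moreover have "inj_on (s n) {..<n}" "inj_on (s' n) {..<n}" "1 \<le> s n i" "1 \<le> s' n i" for n i
      by (auto simp: s_def s'_def inj_on_def)
    ultimately have eb: "((\<lambda>(n, w). (1 / sqrt n) *\<^sub>R (\<Sum>i<n. \<phi>h r n w (Z (s n i) w) - \<phi> (Z (s n i) w) - (\<integral>z. \<phi>h r n w z - \<phi> z \<partial>P))) \<longlongrightarrow> 0) (inprob M)"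
      "((\<lambda>(n, w). (1 / n) * (\<Sum>i<n. (norm (\<phi>h r n w (Z (s n i) w) - \<phi> (Z (s n i) w)))\<^sup>2)) \<longlongrightarrow> 0) (inprob M)"
      using M.equicontinuous_block[OF g_meas[OF r] G small[OF r], of s s'] by blast+
    have bij: "bij_betw (s n) {..<n} (fold_idx r n)" for n
      unfolding s_def I using r
      by (intro bij_betw_byWitness[where f' = "\<lambda>j. j - ((r - 1) * n + 1)"]) auto
    have "(\<Sum>i<n. \<phi>h r n w (Z (s n i) w) - \<phi> (Z (s n i) w) - m) = (\<Sum>i\<in>fold_idx r n. \<phi>h r n w (Z i w) - \<phi> (Z i w) - m)"
      "(\<Sum>i<n. (norm (\<phi>h r n w (Z (s n i) w) - \<phi> (Z (s n i) w)))\<^sup>2) = (\<Sum>i\<in>fold_idx r n. (norm (\<phi>h r n w (Z i w) - \<phi> (Z i w)))\<^sup>2)" for n w m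
      using sum.reindex_bij_betw[OF bij, of "\<lambda>i. \<phi>h r n w (Z i w) - \<phi> (Z i w) - m"]
        sum.reindex_bij_betw[OF bij, of "\<lambda>i. (norm (\<phi>h r n w (Z i w) - \<phi> (Z i w)))\<^sup>2"] by auto
    with eb show ?thesis by (simp only:)
  qed
  have mean: "((\<lambda>(n, w). (1 / sqrt n) *\<^sub>R (\<Sum>i\<in>fold_idx r n. \<phi>h r n w (Z i w) - \<phi> (Z i w))) \<longlongrightarrow> 0) (inprob M)" if r: "r \<in> {1, 2}" for r
  proof -
    have card: "card (fold_idx r n) = n" for n using r by (auto simp: I)
    \<comment> \<open>Undoing the centering: n copies of m scaled by 1 / sqrt n give sqrt n times m,
      which is the bias term. For n = 0 both sides are 0 by the convention 1 / 0 = 0.\<close>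
    have "(1 / sqrt n) *\<^sub>R (\<Sum>i\<in>fold_idx r n. \<phi>h r n w (Z i w) - \<phi> (Z i w) - m) + sqrt n *\<^sub>R m =
      (1 / sqrt n) *\<^sub>R (\<Sum>i\<in>fold_idx r n. \<phi>h r n w (Z i w) - \<phi> (Z i w))" for n w m
    proof -
      have "(1 / sqrt n) *\<^sub>R (\<Sum>i\<in>fold_idx r n. m) = sqrt n *\<^sub>R m"
        by (simp add: sum_constant_scaleR card real_div_sqrt)
      then show ?thesis unfolding sum_subtractf[of _ "\<lambda>_. m"] scaleR_diff_right by simp
    qed
    then show ?thesis
      using tendsto_add[OF blocks[OF r, THEN conjunct1] bias[OF r]] by (simp add: case_prod_unfold)
  qed
  show ?thesis
    using mean[of 1] mean[of 2] blocks[of 1, THEN conjunct2]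
    by (intro M.studentized_clt g_meas) (simp_all add: I)
qed

end
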